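(* Let $\varphi$ be an $N$-function which satisfies the $\Delta_2$ condition. Then the following are equivalent: (1) there exists a constant $C_\varphi>0$ such that for every $n\in\mathbb{N}$ and every trigonometric polynomial $f_n$ of degree $n$, $$\left\Vert f_n\right\Vert_{L^\varphi}\leq C_\varphi\left\Vert f_n\right\Vert_{L^\varphi(\omega_n)};$$ (2) the Hilbert transform is a bounded operator on the space $L^\varphi$.
   Context: $\mathbb{N}=\{1,2,3,\dots\}$, $\mathbb{T}=\mathbb{R}/2\pi\mathbb{Z}$, and functions on $\mathbb{T}$ are complex-valued. A trigonometric polynomial of degree $n$ is a function $f_n(x)=\sum_{k=-n}^n a_ke^{ikx}$ on $\mathbb{T}$ with complex coefficients $a_{-n},\dots,a_n$. The sampling points are $x_{n,k}=\frac{2\pi(n+k)}{2n+1}$ for $k=-n,\dots,n$, and $\omega_n=\frac1{2n+1}\sum_{k=-n}^n\delta_{x_{n,k}}$. An $N$-function is a (convex) function $\varphi:[0,\infty)\to[0,\infty)$ of the form $\varphi(t)=\int_0^t\phi(x)\,dx$, where $\phi:[0,\infty)\to[0,\infty)$ is non-decreasing, right-continuous, strictly positive on $(0,\infty)$, $\phi(0)=0$ and $\lim_{t\to+\infty}\phi(t)=+\infty$. $\varphi$ satisfies the $\Delta_2$ condition if there is $D>0$ with $\varphi(2x)\leq D\varphi(x)$ for every $x>0$. Norms: $\Vert f\Vert_{L^\varphi}=\inf\{\lambda>0:\frac1{2\pi}\int_{\mathbb{T}}\varphi(|f(x)|/\lambda)\,dx\leq1\}$, with $L^\varphi=\{f\in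 L^1(\mathbb{T}):\Vert f\Vert_{L^\varphi}<\infty\}$; and, for trigonometric polynomials of degree $n$, $\Vert f\Vert_{L^\varphi(\omega_n)}=\inf\{\lambda>0:\frac1{2n+1}\sum_{k=-n}^n\varphi(|f(x_{n,k})|/\lambda)\leq1\}$. The Hilbert transform of $f:\mathbb{T}\to\mathbb{C}$ is $H(f)(x)=\lim_{\varepsilon\to0}\frac1{2\pi}\int_{\varepsilon\leq|t|\leq\pi}f(x-t)\cot(t/2)\,dt$ (the convolution operator with Fourier multiplier $-i\,\mathrm{sgn}(n)$, $\mathrm{sgn}(0)=0$). *)

theory Defs
  imports "HOL-Analysis.Analysis"
begin

text \<open>
  A function on the circle \<open>\<real>/2\<pi>\<int>\<close> is represented by a \<open>2\<pi>\<close>-periodic function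
  \<open>real \<Rightarrow> complex\<close>. Elements of the function spaces are such functions themselves, not
  classes modulo null sets; the integral norm and the Hilbert transform below do not
  distinguish between functions that agree almost everywhere. An \<open>N\<close>-function is a total
  function of which only the values on \<open>[0, \<infinity>)\<close> matter.
\<close>

definition N_function :: "(real \<Rightarrow> real) \<Rightarrow> bool" where
  "N_function \<phi> \<longleftrightarrow>
     (\<exists>p :: real \<Rightarrow> real.
        (\<forall>x\<ge>0. 0 \<le> p x) \<and>
        mono_on {0..} p \<and>
        (\<forall>x\<ge>0. continuous (at_right x) p) \<and>
        (\<forall>x>0. 0 < p x) \<and>
        p 0 = 0 \<and>
        filterlim p at_top at_top \<and>
        (\<forall>t\<ge>0. \<phi> t = integral {0..t} p))"

definition Delta2 :: "(real \<Rightarrow> real) \<Rightarrow> bool" where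
  "Delta2 \<phi> \<longleftrightarrow> (\<exists>D>0. \<forall>x>0. \<phi> (2 * x) \<le> D * \<phi> x)"

text \<open>The coefficients of order \<open>\<plusminus>n\<close> may vanish, so the degree is at most \<open>n\<close>.\<close>

definition trig_poly :: "nat \<Rightarrow> (real \<Rightarrow> complex) \<Rightarrow> bool" where
  "trig_poly n f \<longleftrightarrow>
     (\<exists>a :: int \<Rightarrow> complex.
        \<forall>x. f x = (\<Sum>k = - int n..int n. a k * exp (\<i> * of_int k * of_real x)))"

definition sample_point :: "nat \<Rightarrow> int \<Rightarrow> real" where
  "sample_point n k = 2 * pi * (real n + real_of_int k) / (2 * real n + 1)"

text \<open>
  The two Luxemburg norms take values in \<open>[0, \<infinity>]\<close>; the infimum of the empty set is \<open>\<infinity>\<close>.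
\<close>

definition Lphi_norm :: "(real \<Rightarrow> real) \<Rightarrow> (real \<Rightarrow> complex) \<Rightarrow> ennreal" where
  "Lphi_norm \<phi> f =
     (INF l \<in> {l :: real. 0 < l \<and>
        ennreal (1 / (2 * pi)) *
          (\<integral>\<^sup>+ x \<in> {-pi..pi}. ennreal (\<phi> (cmod (f x) / l)) \<partial>lebesgue) \<le> 1}. ennreal l)"

definition Lphi_sample_norm ::
  "(real \<Rightarrow> real) \<Rightarrow> nat \<Rightarrow> (real \<Rightarrow> complex) \<Rightarrow> ennreal" where
  "Lphi_sample_norm \<phi> n f =
     (INF l \<in> {l :: real. 0 < l \<and>
        1 / (2 * real n + 1) *
          (\<Sum>k = - int n..int n. \<phi> (cmod (f (sample_point n k)) / l)) \<le> 1}. ennreal l)"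

definition L1_circle :: "(real \<Rightarrow> complex) set" where
  "L1_circle =
     {f. (\<forall>x. f (x + 2 * pi) = f x) \<and> set_integrable lebesgue {-pi..pi} f}"

definition Lphi :: "(real \<Rightarrow> real) \<Rightarrow> (real \<Rightarrow> complex) set" where
  "Lphi \<phi> = {f \<in> L1_circle. Lphi_norm \<phi> f < \<infinity>}"

text \<open>
  For \<open>f\<close> in \<open>L1_circle\<close> the principal value limit exists for almost every \<open>x\<close>; at the
  remaining points \<open>Lim\<close> returns an unspecified value.
\<close>

definition hilbert_transform :: "(real \<Rightarrow> complex) \<Rightarrow> real \<Rightarrow> complex" where
  "hilbert_transform f x =
     Lim (at_right 0) (\<lambda>\<epsilon> :: real. of_real (1 / (2 * pi)) *
       (LINT t : {t. \<epsilon> \<le> \<bar>t\<bar> \<and> \<bar>t\<bar> \<le> pi} | lebesgue. f (x - t) * of_real (cot (t / 2))))"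

text \<open>
  Linearity (almost everywhere) is a property of \<^const>\<open>hilbert_transform\<close> on
  \<^const>\<open>L1_circle\<close>, so boundedness only requires invariance of the space and the norm estimate.
\<close>

definition hilbert_bounded_on_Lphi :: "(real \<Rightarrow> real) \<Rightarrow> bool" where
  "hilbert_bounded_on_Lphi \<phi> \<longleftrightarrow>
     (\<exists>C::real. C > 0 \<and> (\<forall>f \<in> Lphi \<phi>. hilbert_transform f \<in> Lphi \<phi> \<and>
        Lphi_norm \<phi> (hilbert_transform f) \<le> ennreal C * Lphi_norm \<phi> f))"

end

theory Submission
  imports Defs
begin

text \<open>
  Both statements are equivalent to a third one, a bound for conjugation on trigonometric
  sums: there is a \<open>K\<close> such that \<open>\<Sum> a k * e\<^sup>i\<^sup>k\<^sup>x\<close> having \<open>\<phi>\<close>-mean at most 1 implies that \<open>\<Sum> -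
  \<i> * sgn k * a k * e\<^sup>i\<^sup>k\<^sup>x\<close>, divided by \<open>K\<close>, has \<open>\<phi>\<close>-mean at most 1 (\<open>conj_bound\<close>). The mean
  \<open>modular \<phi> s f\<close> of \<open>\<phi> (s * \<bar>f\<bar>)\<close> over the circle replaces the Luxemburg norm throughout: a
  norm inequality says, up to the constant, that one modular being at most 1 implies the same
  for another.

  Sampling implies conjugation. If \<open>g\<close> interpolates \<open>e\<^sup>-\<^sup>i\<^sup>n\<^sup>x * f\<close> at a translate of the
  \<open>2n+1\<close> sampling points, then each frequency of \<open>f\<close> in \<open>[0, n]\<close> stays where it is, and each
  one in \<open>[-n, -1]\<close> is aliased to a wrong one, with a phase that depends on the translation.
  Translations that differ by half the mesh give opposite phases, so the average of the two
  interpolants is the Riesz projection of \<open>f\<close> onto the frequencies \<open>k \<ge> 0\<close>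
  (\<open>riesz_projection_bound\<close>). An averaging argument over all translations finds a pair at
  which both sampled means of \<open>\<phi> \<bar>f\<bar>\<close> are controlled by the mean of \<open>\<phi> \<bar>f\<bar>\<close> over the circle.
  Two Riesz projections make up conjugation.

  Conjugation implies sampling. A fixed number of modulated conjugations gives a bound,
  independent of \<open>n\<close>, for the partial sum operator \<open>S\<^sub>n\<close>. A polynomial \<open>f\<close> of degree \<open>n\<close> is
  \<open>S\<^sub>n h\<close>, where \<open>h\<close> is the convolution of the point masses \<open>f x\<^sub>k / (2n+1)\<close> with a de la
  Vallee-Poussin kernel. Convexity of \<open>\<phi>\<close> bounds \<open>h\<close> by the samples alone
  (\<open>smoothed_samples_bound\<close>).

  Conjugation on trigonometric sums has to be compared with the Hilbert transform, a
  principal value that need not exist anywhere a priori. With \<open>P\<^sub>r\<close> and \<open>Q\<^sub>r\<close> the Poisson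
  kernel and its conjugate, \<open>\<bar>Q\<^sub>r(t) - cot(t/2) * 1[\<bar>t\<bar> \<ge> 1 - r]\<bar> \<le> 2 * P\<^sub>r(t)\<close>. The
  difference is odd, so at a point where \<open>P\<^sub>r * \<bar>f - f x\<bar>\<close> tends to 0 the truncated integral
  and \<open>Q\<^sub>r * f\<close> have the same limit. If \<open>Q\<^sub>r * f = P\<^sub>r * g\<close> with \<open>g\<close> integrable, that limit is
  \<open>g x\<close> for almost every \<open>x\<close> by Fatou's theorem (\<open>principal_value_AE_eq\<close>). For \<open>f\<close> in the
  Orlicz space, trigonometric sums \<open>p\<^sub>j\<close> converge to \<open>f\<close> fast, which is where the doubling
  condition enters; the bound makes their conjugates converge in \<open>L\<^sup>1\<close>, and the limit is the
  required \<open>g\<close> (\<open>conjugate_extension\<close>).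
\<close>


section \<open>The normalised measure on the circle\<close>

definition circle :: "real measure" where
  "circle = density lborel (\<lambda>x. ennreal (indicator {-pi..pi} x / (2 * pi)))"

definition periodic :: "(real \<Rightarrow> 'a) \<Rightarrow> bool" where
  "periodic f \<longleftrightarrow> (\<forall>x. f (x + 2 * pi) = f x)"

lemma sets_circle [measurable_cong, simp]: "sets circle = sets borel"
  and space_circle [simp]: "space circle = UNIV"
  by (simp_all add: circle_def)

lemma measurable_circle [simp]: "measurable circle M = measurable borel M"
  by (rule measurable_cong_sets) simp_all

lemma nn_integral_circle:
  assumes [measurable]: "f \<in> borel_measurable borel"
  shows "(\<integral>\<^sup>+x. f x \<partial>circle) = ennreal (1 / (2*pi)) * (\<integral>\<^sup>+x\<in>{-pi..pi}. f x \<partial>lborel)"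
proof -
  have "(\<integral>\<^sup>+x. f x \<partial>circle) = (\<integral>\<^sup>+x. ennreal (indicator {-pi..pi} x / (2 * pi)) * f x \<partial>lborel)"
    unfolding circle_def by (subst nn_integral_density) auto
  also have "\<dots> = (\<integral>\<^sup>+x. ennreal (1 / (2*pi)) * (f x * indicator {-pi..pi} x) \<partial>lborel)"
    by (intro nn_integral_cong) (auto simp: indicator_def)
  also have "\<dots> = ennreal (1 / (2*pi)) * (\<integral>\<^sup>+x\<in>{-pi..pi}. f x \<partial>lborel)"
    by (rule nn_integral_cmult) simp
  finally show ?thesis .
qed

lemma integrable_circle:
  fixes f :: "real \<Rightarrow> complex"
  assumes [measurable]: "f \<in> borel_measurable borel"
  shows "integrable circle f \<longleftrightarrow> set_integrable lborel {-pi..pi} f"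
proof -
  have "integrable circle f \<longleftrightarrow> integrable lborel (\<lambda>x. (indicator {-pi..pi} x / (2 * pi)) *\<^sub>R f x)"
    unfolding circle_def by (rule integrable_density) auto
  also have "(\<lambda>x. (indicator {-pi..pi} x / (2 * pi)) *\<^sub>R f x)
      = (\<lambda>x. (1/(2*pi)) *\<^sub>R (indicator {-pi..pi} x *\<^sub>R f x))" by auto
  also have "integrable lborel \<dots> \<longleftrightarrow> set_integrable lborel {-pi..pi} f"
    unfolding set_integrable_def using integrable_scaleR_right[of "2*pi" lborel "\<lambda>x. (1/(2*pi)) *\<^sub>R (indicator {-pi..pi} x *\<^sub>R f x)"]
      integrable_scaleR_right[of "1/(2*pi)" lborel "\<lambda>x. indicator {-pi..pi} x *\<^sub>R f x"] by auto
  finally show ?thesis .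
qed

lemma integral_circle:
  fixes f :: "real \<Rightarrow> complex"
  assumes [measurable]: "f \<in> borel_measurable borel"
  shows "(\<integral>x. f x \<partial>circle) = (1/(2*pi)) *\<^sub>R (LINT x:{-pi..pi}|lborel. f x)"
proof -
  have "(\<integral>x. f x \<partial>circle) = (\<integral>x. (indicator {-pi..pi} x / (2 * pi)) *\<^sub>R f x \<partial>lborel)"
    unfolding circle_def by (rule integral_density) auto
  also have "(\<lambda>x. (indicator {-pi..pi} x / (2 * pi)) *\<^sub>R f x)
      = (\<lambda>x. (1/(2*pi)) *\<^sub>R (indicator {-pi..pi} x *\<^sub>R f x))" by auto
  finally show ?thesis
    unfolding set_lebesgue_integral_def by (simp only: integral_scaleR_right)
qed

lemma emeasure_circle_UNIV: "emeasure circle UNIV = 1"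
proof -
  have "emeasure circle UNIV = (\<integral>\<^sup>+x. 1 \<partial>circle)" by simp
  also have "\<dots> = ennreal (1 / (2*pi)) * ennreal (2 * pi)"
    by (subst nn_integral_circle) (simp_all)
  also have "\<dots> = 1" by (subst ennreal_mult[symmetric]) auto
  finally show ?thesis .
qed

lemma finite_measure_circle: "finite_measure circle"
  by (rule finite_measureI) (simp add: emeasure_circle_UNIV)

interpretation circle: finite_measure circle by (rule finite_measure_circle)

lemma measure_circle_UNIV [simp]: "measure circle UNIV = 1"
  by (simp add: measure_def emeasure_circle_UNIV)

lemma AE_circle: "AE x in lborel. P x \<Longrightarrow> AE x in circle. P x"
  unfolding circle_def by (subst AE_density) auto

lemma integrable_circle_bounded:
  fixes f :: "real \<Rightarrow> 'a::{banach,second_countable_topology}"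
  assumes "f \<in> borel_measurable borel" "\<And>x. norm (f x) \<le> B"
  shows "integrable circle f"
  using assms by (intro circle.integrable_const_bound[of _ B]) auto

lemma periodic_int:
  assumes "periodic f"
  shows "f (x + 2 * pi * of_int k) = f x"
proof -
  have n: "f (x + 2 * pi * real n) = f x" for n x
  proof (induction n)
    case (Suc n)
    have "x + 2 * pi * real (Suc n) = (x + 2 * pi * real n) + 2 * pi" by (simp add: algebra_simps)
    then show ?case using Suc assms unfolding periodic_def by metis
  qed simp
  show ?thesis
  proof (cases k)
    case (nonneg n) then show ?thesis using n by simp
  next
    case (neg n)
    have "f (x + 2 * pi * of_int k) = f (x + 2 * pi * of_int k + 2 * pi * real (Suc n))" using n by metis
    also have "x + 2 * pi * of_int k + 2 * pi * real (Suc n) = x" by (simp add: neg del: of_nat_Suc)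
    finally show ?thesis .
  qed
qed

lemma periodic_minus: "periodic f \<Longrightarrow> periodic (\<lambda>t. f (x - t))"
  unfolding periodic_def
proof
  fix t assume "\<forall>t. f (t + 2*pi) = f t"
  then have "f (x - (t + 2*pi) + 2*pi) = f (x - (t + 2*pi))" by blast
  then show "f (x - (t + 2*pi)) = f (x - t)" by simp
qed

lemma periodic_plus: "periodic f \<Longrightarrow> periodic (\<lambda>t. f (t + x))"
  unfolding periodic_def
proof
  fix t assume "\<forall>t. f (t + 2*pi) = f t"
  then have "f (t + x + 2*pi) = f (t + x)" by blast
  then show "f (t + 2*pi + x) = f (t + x)" by (simp add: add_ac)
qed

abbreviation conv :: "(real \<Rightarrow> real) \<Rightarrow> (real \<Rightarrow> complex) \<Rightarrow> real \<Rightarrow> complex" where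
  "conv k f x \<equiv> \<integral>t. of_real (k t) * f (x - t) \<partial>circle"

lemma nn_integral_shift:
  fixes f :: "real \<Rightarrow> ennreal"
  assumes [measurable]: "f \<in> borel_measurable borel"
  shows "(\<integral>\<^sup>+x. f (x + c) \<partial>lborel) = (\<integral>\<^sup>+x. f x \<partial>lborel)"
  using nn_integral_real_affine[of f 1 c] assms by (simp add: add.commute)

text \<open>
  The measure itself lives on one period, so it is not translation invariant; only integrals
  of periodic functions are. It suffices to move the piece that leaves the interval on one
  side back in by a full period.
\<close>

lemma nn_integral_circle_shift:
  fixes f :: "real \<Rightarrow> ennreal"
  assumes f[measurable]: "f \<in> borel_measurable borel" and per: "periodic f"
  shows "(\<integral>\<^sup>+x. f (x + c) \<partial>circle) = (\<integral>\<^sup>+x. f x \<partial>circle)"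
proof -
  define I where "I a b = (\<integral>\<^sup>+x. f x * indicator {a..b} x \<partial>lborel)" for a b
  have split: "I a b = I a c + I c b" if "a \<le> c" "c \<le> b" for a b c
  proof -
    have "I a b = (\<integral>\<^sup>+x. f x * indicator {a..c} x + f x * indicator {c..b} x \<partial>lborel)"
      unfolding I_def
      by (intro nn_integral_cong_AE, rule AE_mp[OF AE_lborel_singleton[of c]])
         (use that in \<open>auto simp: indicator_def\<close>)
    then show ?thesis by (simp add: I_def nn_integral_add)
  qed
  have shift: "(\<integral>\<^sup>+x. f (x + c) * indicator {a..b} x \<partial>lborel) = I (a + c) (b + c)" for a b c
    using nn_integral_shift[of "\<lambda>x. f x * indicator {a+c..b+c} x" c]
    by (simp add: I_def indicator_def)
  have main: "(\<integral>\<^sup>+x. f (x + c) \<partial>circle) = (\<integral>\<^sup>+x. f x \<partial>circle)" if c: "0 \<le> c" "c \<le> 2*pi" for c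
  proof -
    have "I pi (pi + c) = (\<integral>\<^sup>+x. f (x + 2*pi) * indicator {-pi..c-pi} x \<partial>lborel)"
      by (subst shift) (simp add: algebra_simps)
    also have "\<dots> = I (-pi) (c - pi)" using per by (simp add: I_def periodic_def)
    finally have "I (-pi + c) (pi + c) = I (-pi) (c - pi) + I (c - pi) pi"
      using c split[of "-pi+c" pi "pi+c"] by (simp add: add.commute algebra_simps)
    also have "\<dots> = I (-pi) pi" using c split[of "-pi" "c-pi" pi] by simp
    finally show ?thesis by (simp add: nn_integral_circle shift I_def)
  qed
  define k where "k = \<lfloor>c / (2*pi)\<rfloor>"
  define d where "d = c - 2 * pi * of_int k"
  have "of_int k \<le> c / (2*pi)" "c / (2*pi) < of_int k + 1"
    unfolding k_def by linarith+
  then have "0 \<le> d" "d \<le> 2*pi" by (auto simp: d_def field_simps)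
  have "f (x + c) = f (x + d)" for x
    using periodic_int[OF per, of "x+d" k] by (simp add: d_def algebra_simps)
  then show ?thesis using main[OF \<open>0 \<le> d\<close> \<open>d \<le> 2*pi\<close>] by simp
qed

lemma nn_integral_circle_uminus:
  fixes f :: "real \<Rightarrow> ennreal"
  assumes f[measurable]: "f \<in> borel_measurable borel"
  shows "(\<integral>\<^sup>+x. f (- x) \<partial>circle) = (\<integral>\<^sup>+x. f x \<partial>circle)"
proof -
  have "(\<integral>\<^sup>+x. f x * indicator {-pi..pi} x \<partial>lborel)
      = (\<integral>\<^sup>+x. f (-x) * indicator {-pi..pi} (-x) \<partial>lborel)"
    using nn_integral_real_affine[of "\<lambda>x. f x * indicator {-pi..pi} x" "-1" 0] by simp
  also have "\<dots> = (\<integral>\<^sup>+x. f (-x) * indicator {-pi..pi} x \<partial>lborel)"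
    by (intro nn_integral_cong) (auto simp: indicator_def)
  finally show ?thesis by (simp add: nn_integral_circle)
qed

lemma nn_integral_circle_reflect:
  fixes f :: "real \<Rightarrow> ennreal"
  assumes [measurable]: "f \<in> borel_measurable borel" and "periodic f"
  shows "(\<integral>\<^sup>+t. f (x - t) \<partial>circle) = (\<integral>\<^sup>+t. f t \<partial>circle)"
  using nn_integral_circle_uminus[of "\<lambda>t. f (t + x)"] nn_integral_circle_shift[OF assms, of x]
  by simp

text \<open>
  The representative of a point modulo \<open>2 * pi\<close> in \<open>[-pi, pi)\<close>. A periodic function factors
  through it, so translation invariance becomes an equality of image measures and passes from
  nonnegative to arbitrary integrands.
\<close>

definition wrap :: "real \<Rightarrow> real" where
  "wrap x = x - 2 * pi * of_int \<lfloor>(x + pi) / (2*pi)\<rfloor>"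

lemma wrap_measurable [measurable]: "wrap \<in> borel_measurable borel"
  unfolding wrap_def by measurable

lemma wrap_bounds: "-pi \<le> wrap x" "wrap x < pi"
proof -
  let ?k = "of_int \<lfloor>(x + pi) / (2*pi)\<rfloor> :: real"
  have "?k \<le> (x + pi) / (2*pi)" "(x + pi) / (2*pi) < ?k + 1" by linarith+
  then have "?k * (2*pi) \<le> x + pi" "x + pi < (?k + 1) * (2*pi)"
    by (simp_all only: pos_le_divide_eq pos_divide_less_eq mult_pos_pos pi_gt_zero zero_less_numeral)
  then show "-pi \<le> wrap x" "wrap x < pi"
    by (simp_all add: wrap_def algebra_simps)
qed

lemma wrap_id: "-pi \<le> x \<Longrightarrow> x < pi \<Longrightarrow> wrap x = x"
proof -
  assume "-pi \<le> x" "x < pi"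
  then have "\<lfloor>(x + pi) / (2*pi)\<rfloor> = 0"
    by (intro floor_unique) (auto simp: pos_divide_less_eq)
  then show ?thesis by (simp add: wrap_def)
qed

lemma periodic_wrap: "periodic wrap"
proof -
  have "(x + 2 * pi + pi) / (2*pi) = (x + pi) / (2*pi) + 1" for x :: real by (simp add: field_simps)
  then show ?thesis unfolding periodic_def wrap_def
    by (simp add: algebra_simps)
qed

lemma periodic_eq_wrap: "periodic f \<Longrightarrow> f (wrap x) = f x"
  unfolding wrap_def using periodic_int[of f x "- \<lfloor>(x + pi) / (2*pi)\<rfloor>"] by simp

lemma distr_circle_reflect: "distr circle borel (\<lambda>t. wrap (x - t)) = distr circle borel wrap"
proof (rule measure_eqI)
  fix A assume "A \<in> sets (distr circle borel (\<lambda>t. wrap (x - t)))"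
  then have [measurable]: "A \<in> sets borel" by simp
  have per: "periodic (\<lambda>t. indicator A (wrap t) :: ennreal)"
    using periodic_wrap by (auto simp: periodic_def)
  have "emeasure (distr circle borel (\<lambda>t. wrap (x - t))) A
      = (\<integral>\<^sup>+y. indicator A y \<partial>distr circle borel (\<lambda>t. wrap (x - t)))" by simp
  also have "\<dots> = (\<integral>\<^sup>+t. indicator A (wrap (x - t)) \<partial>circle)"
    by (subst nn_integral_distr) auto
  also have "\<dots> = (\<integral>\<^sup>+t. indicator A (wrap t) \<partial>circle)"
    by (rule nn_integral_circle_reflect[OF _ per]) auto
  also have "\<dots> = (\<integral>\<^sup>+y. indicator A y \<partial>distr circle borel wrap)"
    by (subst nn_integral_distr) auto
  also have "\<dots> = emeasure (distr circle borel wrap) A" by simp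
  finally show "emeasure (distr circle borel (\<lambda>t. wrap (x - t))) A = emeasure (distr circle borel wrap) A" .
qed simp

lemma
  fixes f :: "real \<Rightarrow> 'a::{banach,second_countable_topology}"
  assumes [measurable]: "f \<in> borel_measurable borel" and per: "periodic f"
  shows integrable_circle_reflect: "integrable circle (\<lambda>t. f (x - t)) \<longleftrightarrow> integrable circle f"
    and integral_circle_reflect: "(\<integral>t. f (x - t) \<partial>circle) = (\<integral>t. f t \<partial>circle)"
proof -
  have "integrable circle (\<lambda>t. f (wrap (x - t))) \<longleftrightarrow> integrable (distr circle borel (\<lambda>t. wrap (x - t))) f"
    by (subst integrable_distr_eq) auto
  also have "\<dots> \<longleftrightarrow> integrable circle (\<lambda>t. f (wrap t))"
    unfolding distr_circle_reflect by (subst integrable_distr_eq) auto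
  finally show "integrable circle (\<lambda>t. f (x - t)) \<longleftrightarrow> integrable circle f"
    by (simp add: periodic_eq_wrap[OF per])
  have "(\<integral>t. f (wrap (x - t)) \<partial>circle) = integral\<^sup>L (distr circle borel (\<lambda>t. wrap (x - t))) f"
    by (subst integral_distr) auto
  also have "\<dots> = (\<integral>t. f (wrap t) \<partial>circle)"
    unfolding distr_circle_reflect by (subst integral_distr) auto
  finally show "(\<integral>t. f (x - t) \<partial>circle) = (\<integral>t. f t \<partial>circle)"
    by (simp add: periodic_eq_wrap[OF per])
qed

lemma integral_circle_convolution_commute:
  fixes f k :: "real \<Rightarrow> complex"
  assumes [measurable]: "f \<in> borel_measurable borel" "k \<in> borel_measurable borel"
    and "periodic f" "periodic k"
  shows "(\<integral>t. k t * f (x - t) \<partial>circle) = (\<integral>t. k (x - t) * f t \<partial>circle)"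
proof -
  have "periodic (\<lambda>t. k (x - t) * f t)"
    using periodic_minus[of k x] assms by (auto simp: periodic_def)
  from integral_circle_reflect[OF _ this, of x] show ?thesis by simp
qed

lemma AE_lborel_shift:
  assumes "AE x in lborel. P x"
  shows "AE x in lborel. P (c + x :: real)"
proof -
  obtain N where N: "\<And>x. x \<notin> N \<Longrightarrow> P x" "N \<in> null_sets lborel"
    by (rule AE_E3[OF assms]) auto
  then have [measurable]: "N \<in> sets borel" by auto
  have "emeasure lborel {x. c + x \<in> N} = (\<integral>\<^sup>+x. indicator {x. c + x \<in> N} x \<partial>lborel)"
    by (rule nn_integral_indicator[symmetric]) measurable
  also have "\<dots> = (\<integral>\<^sup>+x. indicator N (x + c) \<partial>lborel)"
    by (intro nn_integral_cong) (auto simp: indicator_def add.commute)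
  also have "\<dots> = 0" using nn_integral_shift[of "indicator N" c] N(2) by (simp add: null_setsD1)
  finally have "{x. c + x \<in> N} \<in> null_sets lborel" by (auto simp: null_sets_def)
  then show ?thesis by (rule AE_I'[OF _ subsetI]) (use N(1) in auto)
qed

lemma AE_lborel_reflect:
  assumes "AE x in lborel. P x"
  shows "AE x in lborel. P (c - x :: real)"
proof -
  have "AE x in lborel. P (- x)"
  proof -
    obtain N where N: "\<And>x. x \<notin> N \<Longrightarrow> P x" "N \<in> null_sets lborel"
      by (rule AE_E3[OF assms]) auto
    then have [measurable]: "N \<in> sets borel" by auto
    have "emeasure lborel {x. - x \<in> N} = (\<integral>\<^sup>+x. indicator {x. - x \<in> N} x \<partial>lborel)"
      by (rule nn_integral_indicator[symmetric]) measurable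
    also have "\<dots> = (\<integral>\<^sup>+x. indicator N (- x) \<partial>lborel)"
      by (intro nn_integral_cong) (auto simp: indicator_def)
    also have "\<dots> = 0"
      using nn_integral_real_affine[of "indicator N" "-1" 0] N(2) by (simp add: null_setsD1)
    finally have "{x. - x \<in> N} \<in> null_sets lborel" by (auto simp: null_sets_def)
    then show ?thesis by (rule AE_I'[OF _ subsetI]) (use N(1) in auto)
  qed
  from AE_lborel_shift[OF this, of "- c"] show ?thesis by simp
qed

text \<open>
  A property that holds almost everywhere on one period holds almost everywhere on each of
  its countably many translates.
\<close>

lemma AE_periodic:
  assumes ae: "AE x in lborel. \<bar>x\<bar> \<le> pi \<longrightarrow> P x" and per: "periodic P"
  shows "AE x in lborel. P x"
proof -
  have "AE x in lborel. \<forall>k::int. \<bar>2 * pi * of_int k + x\<bar> \<le> pi \<longrightarrow> P (2 * pi * of_int k + x)"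
    using AE_lborel_shift[OF ae] by (simp add: AE_all_countable)
  then show ?thesis
  proof eventually_elim
    case (elim x)
    \<comment> \<open>The translate of \<open>x\<close> into one period.\<close>
    define k where "k = - \<lfloor>(x + pi) / (2*pi)\<rfloor>"
    have w: "wrap x = 2 * pi * of_int k + x" by (simp add: wrap_def k_def)
    then have "P (wrap x)" using elim[rule_format, of k] wrap_bounds[of x] by (simp add: abs_le_iff)
    then show ?case using periodic_eq_wrap[OF per, of x] by simp
  qed
qed

lemma integrable_circle_mult_bounded:
  fixes k :: "real \<Rightarrow> real" and F :: "real \<Rightarrow> complex"
  assumes [measurable]: "k \<in> borel_measurable borel" and b: "\<And>t. \<bar>k t\<bar> \<le> B" and F: "integrable circle F"
  shows "integrable circle (\<lambda>t. of_real (k t) * F t)"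
    "(\<integral>t. norm (of_real (k t) * F t) \<partial>circle) \<le> B * (\<integral>t. norm (F t) \<partial>circle)"
proof -
  have [measurable]: "F \<in> borel_measurable borel" using F by auto
  have le: "norm (of_real (k t) * F t) \<le> norm (B *\<^sub>R F t)" for t
    using mult_right_mono[OF b[of t], of "norm (F t)"] b[of t] by (simp add: norm_mult)
  show int: "integrable circle (\<lambda>t. of_real (k t) * F t)"
  proof (rule Bochner_Integration.integrable_bound)
    show "integrable circle (\<lambda>t. B *\<^sub>R F t)" using F by simp
    show "(\<lambda>t. of_real (k t) * F t) \<in> borel_measurable circle" by measurable
  qed (use le in simp)
  have B: "0 \<le> B" using b[of 0] by linarith
  have "(\<integral>t. norm (of_real (k t) * F t) \<partial>circle) \<le> (\<integral>t. B * norm (F t) \<partial>circle)"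
    using int F le B by (intro integral_mono) auto
  then show "(\<integral>t. norm (of_real (k t) * F t) \<partial>circle) \<le> B * (\<integral>t. norm (F t) \<partial>circle)" by simp
qed

lemma AE_circle_interval: "AE t in circle. \<bar>t\<bar> \<le> pi"
  unfolding circle_def by (subst AE_density) (auto simp: indicator_def)

lemma integral_circle_bound:
  fixes f :: "real \<Rightarrow> 'a::{banach,second_countable_topology}" and g :: "real \<Rightarrow> real"
  assumes "integrable circle g" "f \<in> borel_measurable borel" "\<And>x. \<bar>x\<bar> \<le> pi \<Longrightarrow> norm (f x) \<le> g x"
  shows "norm (\<integral>x. f x \<partial>circle) \<le> (\<integral>x. g x \<partial>circle)"
proof -
  have ae: "AE x in circle. norm (f x) \<le> g x"
    using AE_circle_interval by eventually_elim (use assms in auto)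
  have "integrable circle f"
  proof (rule Bochner_Integration.integrable_bound[OF assms(1)])
    show "AE x in circle. norm (f x) \<le> norm (g x)" using ae by eventually_elim auto
  qed (use assms in simp)
  have "norm (\<integral>x. f x \<partial>circle) \<le> (\<integral>x. norm (f x) \<partial>circle)" by simp
  also have "\<dots> \<le> (\<integral>x. g x \<partial>circle)"
    using \<open>integrable circle f\<close> assms ae by (intro integral_mono_AE) auto
  finally show ?thesis .
qed

lemma integral_circle_uminus:
  fixes f :: "real \<Rightarrow> complex"
  assumes [measurable]: "f \<in> borel_measurable borel"
  shows "(\<integral>x. f (- x) \<partial>circle) = (\<integral>x. f x \<partial>circle)"
proof -
  have "(LINT x:{-pi..pi}|lborel. f x) = (LINT x:{-pi..pi}|lborel. f (- x))"
    by (subst set_integral_reflect) (simp add: atLeastAtMost_def atLeast_def atMost_def Int_def conj_commute minus_le_iff)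
  then show ?thesis by (simp add: integral_circle)
qed

lemma
  fixes f :: "real \<Rightarrow> complex" and k :: "real \<Rightarrow> real"
  assumes k: "k \<in> borel_measurable borel" "\<And>t. \<bar>k t\<bar> \<le> B"
    and f: "f \<in> borel_measurable borel" "periodic f" "integrable circle f"
  shows conv_integrable: "integrable circle (\<lambda>t. of_real (k t) * f (x - t))"
    and norm_conv_le: "norm (conv k f x) \<le> B * (\<integral>t. norm (f t) \<partial>circle)"
proof -
  have fi: "integrable circle (\<lambda>t. f (x - t))" using integrable_circle_reflect[OF f(1,2)] f(3) by simp
  show "integrable circle (\<lambda>t. of_real (k t) * f (x - t))" by (rule integrable_circle_mult_bounded(1)[OF k fi])
  have "norm (conv k f x) \<le> (\<integral>t. norm (of_real (k t) * f (x - t)) \<partial>circle)" by (rule integral_norm_bound)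
  also have "\<dots> \<le> B * (\<integral>t. norm (f (x - t)) \<partial>circle)" by (rule integrable_circle_mult_bounded(2)[OF k fi])
  also have "(\<integral>t. norm (f (x - t)) \<partial>circle) = (\<integral>t. norm (f t) \<partial>circle)"
    by (rule integral_circle_reflect) (use f in \<open>auto simp: periodic_def\<close>)
  finally show "norm (conv k f x) \<le> B * (\<integral>t. norm (f t) \<partial>circle)" .
qed

lemma conv_diff_kernel:
  assumes "integrable circle (\<lambda>t. of_real (k t) * f (x - t))" "integrable circle (\<lambda>t. of_real (k' t) * f (x - t))"
  shows "conv (\<lambda>t. k t - k' t) f x = conv k f x - conv k' f x"
  using Bochner_Integration.integral_diff[OF assms] by (simp add: left_diff_distrib)

lemma conv_diff:
  assumes "integrable circle (\<lambda>t. of_real (k t) * f (x - t))" "integrable circle (\<lambda>t. of_real (k t) * g (x - t))"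
  shows "conv k (\<lambda>t. f t - g t) x = conv k f x - conv k g x"
  using Bochner_Integration.integral_diff[OF assms] by (simp add: right_diff_distrib)

section \<open>The Poisson kernel and its conjugate\<close>

lemma eventually_at_right_unit: "\<forall>\<^sub>F \<epsilon> in at_right (0::real). 0 < \<epsilon> \<and> \<epsilon> < 1"
  by (auto simp: eventually_at_right_field intro!: exI[of _ 1])

definition poisson_den :: "real \<Rightarrow> real \<Rightarrow> real" where
  "poisson_den r t = 1 - 2 * r * cos t + r\<^sup>2"

definition poisson :: "real \<Rightarrow> real \<Rightarrow> real" where
  "poisson r t = (1 - r\<^sup>2) / poisson_den r t"

definition conj_poisson :: "real \<Rightarrow> real \<Rightarrow> real" where
  "conj_poisson r t = 2 * r * sin t / poisson_den r t"

lemma poisson_den_alt: "poisson_den r t = (1 - r)\<^sup>2 + 2 * r * (1 - cos t)"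
  by (simp add: poisson_den_def power2_eq_square algebra_simps)

lemma poisson_den_ge: "0 < r \<Longrightarrow> (1 - r)\<^sup>2 \<le> poisson_den r t"
  by (simp add: poisson_den_alt)

lemma poisson_den_pos: "0 < r \<Longrightarrow> r < 1 \<Longrightarrow> 0 < poisson_den r t"
  using poisson_den_ge[of r t] by (smt (verit) zero_less_power2)

lemma poisson_nonneg: "0 < r \<Longrightarrow> r < 1 \<Longrightarrow> 0 \<le> poisson r t"
  using poisson_den_pos[of r t] by (simp add: poisson_def power_le_one)

lemma poisson_measurable [measurable]: "poisson r \<in> borel_measurable borel"
  and conj_poisson_measurable [measurable]: "conj_poisson r \<in> borel_measurable borel"
  unfolding poisson_def conj_poisson_def poisson_den_def by measurable

lemma periodic_poisson: "periodic (poisson r)"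
  unfolding periodic_def poisson_def poisson_den_def by simp

lemma poisson_uminus [simp]: "poisson r (- t) = poisson r t"
  and conj_poisson_uminus [simp]: "conj_poisson r (- t) = - conj_poisson r t"
  unfolding poisson_def conj_poisson_def poisson_den_def by simp_all

lemma poisson_bounded:
  assumes "0 < r" "r < 1"
  shows "\<bar>poisson r t\<bar> \<le> 1 / (1 - r)\<^sup>2" "\<bar>conj_poisson r t\<bar> \<le> 2 / (1 - r)\<^sup>2"
proof -
  have d: "(1-r)\<^sup>2 > 0" "(1-r)\<^sup>2 \<le> poisson_den r t" "0 < poisson_den r t"
    using assms poisson_den_ge[of r t] poisson_den_pos[of r t] by auto
  have "\<bar>1 - r\<^sup>2\<bar> \<le> 1" using assms by (simp add: power_le_one abs_le_iff)
  then show "\<bar>poisson r t\<bar> \<le> 1 / (1 - r)\<^sup>2"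
    unfolding poisson_def abs_divide using d by (intro frac_le) auto
  have "\<bar>2 * r * sin t\<bar> \<le> 2"
    using assms mult_mono[of r 1 "\<bar>sin t\<bar>" 1] by (simp add: abs_mult)
  then show "\<bar>conj_poisson r t\<bar> \<le> 2 / (1 - r)\<^sup>2"
    unfolding conj_poisson_def abs_divide using d by (intro frac_le) auto
qed

text \<open>
  Minus the derivative of the Poisson kernel. It is nonnegative on \<open>[0, pi]\<close>, which makes the
  kernel there a superposition of indicators of \<open>[0, u]\<close> with positive weights.
\<close>

definition poisson_slope :: "real \<Rightarrow> real \<Rightarrow> real" where
  "poisson_slope r t = (1 - r\<^sup>2) * (2 * r * sin t) / (poisson_den r t)\<^sup>2"

lemma poisson_deriv:
  assumes "0 < r" "r < 1"
  shows "((\<lambda>t. - poisson r t) has_real_derivative poisson_slope r t) (at t)"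
proof -
  have "poisson_den r t \<noteq> 0" using poisson_den_pos[OF assms, of t] by simp
  then show ?thesis
    unfolding poisson_def poisson_slope_def poisson_den_def
    by (auto intro!: derivative_eq_intros simp: power2_eq_square)
qed

lemma poisson_slope_nonneg:
  assumes "0 < r" "r < 1" "0 \<le> t" "t \<le> pi"
  shows "0 \<le> poisson_slope r t"
  using assms by (auto simp: poisson_slope_def power_le_one sin_ge_zero)

lemma poisson_slope_measurable [measurable]: "poisson_slope r \<in> borel_measurable borel"
  unfolding poisson_slope_def poisson_den_def by measurable

lemma isCont_poisson_slope: "0 < r \<Longrightarrow> r < 1 \<Longrightarrow> isCont (poisson_slope r) t"
  unfolding poisson_slope_def poisson_den_def
  using poisson_den_pos[of r t] by (intro continuous_intros) (simp add: poisson_den_def)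

lemma integral_poisson_slope:
  assumes "0 < r" "r < 1" "a \<le> b"
  shows "(\<integral>u. poisson_slope r u * indicator {a..b} u \<partial>lborel) = poisson r a - poisson r b"
  by (subst integral_FTC_Icc_real[where F = "\<lambda>t. - poisson r t"])
     (use assms poisson_deriv isCont_poisson_slope in auto)

lemma integrable_poisson_slope:
  assumes "0 < r" "r < 1" "a \<le> b"
  shows "integrable lborel (\<lambda>u. poisson_slope r u * indicator {a..b} u)"
  using has_bochner_integral_FTC_Icc_real[OF \<open>a \<le> b\<close> poisson_deriv isCont_poisson_slope] assms
  by (auto intro: integrable.intros)

text \<open>
  Integration by parts, with \<open>k\<close> merely integrable: write \<open>poisson r t - poisson r pi\<close> as the
  integral of the slope over \<open>[t, pi]\<close> and exchange the integrals. It reduces convolution with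
  the Poisson kernel to averages over intervals, which Lebesgue's differentiation theorem
  controls.
\<close>

lemma poisson_layer_cake:
  fixes k :: "real \<Rightarrow> complex"
  assumes r: "0 < r" "r < 1" and k: "set_integrable lborel {0..pi} k"
    and [measurable]: "k \<in> borel_measurable borel"
  shows "(LINT t:{0..pi}|lborel. poisson r t *\<^sub>R k t)
       = poisson r pi *\<^sub>R (LINT t:{0..pi}|lborel. k t)
         + (LINT u:{0..pi}|lborel. poisson_slope r u *\<^sub>R (LINT t:{0..u}|lborel. k t))"
    (is "?lhs = ?bd + ?rhs")
    and "set_integrable lborel {0..pi} (\<lambda>u. poisson_slope r u *\<^sub>R (LINT t:{0..u}|lborel. k t))"
    (is ?int)
proof -
  let ?s = "\<lambda>u. poisson_slope r u * indicator {0..pi} u"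
  let ?k = "\<lambda>t. indicator {0..pi} t *\<^sub>R k t"
  let ?T = "\<lambda>t u. (?s u * of_bool (t \<le> u)) *\<^sub>R ?k t"
  have kint: "integrable lborel ?k" using k by (simp add: set_integrable_def)
  have sint: "integrable lborel ?s" by (rule integrable_poisson_slope) (use r in auto)
  have s0: "0 \<le> ?s u" for u using poisson_slope_nonneg[OF r] by (auto simp: indicator_def)
  have prod: "integrable (lborel \<Otimes>\<^sub>M lborel) (\<lambda>(t, u). ?s u *\<^sub>R ?k t)"
  proof (rule lborel_pair.Fubini_integrable)
    have eq: "(\<lambda>t. \<integral>u. norm (case (t, u) of (t, u) \<Rightarrow> ?s u *\<^sub>R ?k t) \<partial>lborel)
        = (\<lambda>t. (\<integral>u. ?s u \<partial>lborel) * norm (?k t))"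
      unfolding prod.case norm_scaleR real_norm_def abs_of_nonneg[OF s0] by simp
    show "integrable lborel (\<lambda>t. \<integral>u. norm (case (t, u) of (t, u) \<Rightarrow> ?s u *\<^sub>R ?k t) \<partial>lborel)"
      unfolding eq by (intro integrable_mult_right integrable_norm kint)
    show "AE t in lborel. integrable lborel (\<lambda>u. case (t, u) of (t, u) \<Rightarrow> ?s u *\<^sub>R ?k t)"
      using sint by simp
  qed measurable
  have T: "integrable (lborel \<Otimes>\<^sub>M lborel) (case_prod ?T)"
    by (rule Bochner_Integration.integrable_bound[OF prod]) (auto simp: mult_le_one)
  have in1: "(\<integral>u. ?T t u \<partial>lborel) = indicator {0..pi} t *\<^sub>R ((poisson r t - poisson r pi) *\<^sub>R k t)" for t
  proof (cases "t \<in> {0..pi}")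
    case True
    have "(\<lambda>u. ?T t u) = (\<lambda>u. (poisson_slope r u * indicator {t..pi} u) *\<^sub>R ?k t)"
      using True by (auto simp: indicator_def)
    then have "(\<integral>u. ?T t u \<partial>lborel) = (\<integral>u. poisson_slope r u * indicator {t..pi} u \<partial>lborel) *\<^sub>R ?k t"
      using integrable_poisson_slope[OF r, of t pi] True by simp
    then show ?thesis using integral_poisson_slope[OF r, of t pi] True by simp
  qed simp
  have in2: "(\<integral>t. ?T t u \<partial>lborel) = indicator {0..pi} u *\<^sub>R (poisson_slope r u *\<^sub>R (LINT t:{0..u}|lborel. k t))" for u
  proof (cases "u \<in> {0..pi}")
    case True
    have eq: "(\<lambda>t. ?T t u) = (\<lambda>t. poisson_slope r u *\<^sub>R (indicator {0..u} t *\<^sub>R k t))"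
      using True by (auto simp: indicator_def)
    show ?thesis unfolding eq integral_scaleR_right set_lebesgue_integral_def using True by simp
  qed simp
  have "(\<integral>u. (\<integral>t. ?T t u \<partial>lborel) \<partial>lborel) = (\<integral>t. (\<integral>u. ?T t u \<partial>lborel) \<partial>lborel)"
    by (rule lborel_pair.Fubini_integral[OF T])
  then have "?rhs = (LINT t:{0..pi}|lborel. (poisson r t - poisson r pi) *\<^sub>R k t)"
    unfolding in1 in2 set_lebesgue_integral_def .
  also have "\<dots> = (LINT t:{0..pi}|lborel. poisson r t *\<^sub>R k t - poisson r pi *\<^sub>R k t)"
    by (simp add: scaleR_diff_left)
  also have "\<dots> = ?lhs - ?bd"
  proof (subst set_integral_diff)
    show "set_integrable lborel {0..pi} (\<lambda>t. poisson r t *\<^sub>R k t)"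
      unfolding set_integrable_def
    proof (rule Bochner_Integration.integrable_bound[where f = "\<lambda>t. (1 / (1-r)\<^sup>2) *\<^sub>R ?k t"])
      show "integrable lborel (\<lambda>t. (1 / (1-r)\<^sup>2) *\<^sub>R ?k t)" using kint by (rule integrable_scaleR_right)
      show "AE t in lborel. norm (indicator {0..pi} t *\<^sub>R poisson r t *\<^sub>R k t) \<le> norm ((1 / (1-r)\<^sup>2) *\<^sub>R ?k t)"
      proof (rule AE_I2)
        fix t
        show "norm (indicator {0..pi} t *\<^sub>R poisson r t *\<^sub>R k t) \<le> norm ((1 / (1-r)\<^sup>2) *\<^sub>R ?k t)"
          using mult_right_mono[OF poisson_bounded(1)[OF r, of t], of "norm (k t)"]
          by (auto simp: indicator_def)
      qed
    qed measurable
    show "set_integrable lborel {0..pi} (\<lambda>t. poisson r pi *\<^sub>R k t)" using k by simp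
  qed simp
  finally show "?lhs = ?bd + ?rhs" by simp
  have "integrable lborel (\<lambda>u. \<integral>t. ?T t u \<partial>lborel)"
    using lborel_pair.integrable_snd[OF T] .
  then show ?int unfolding in2 set_integrable_def .
qed


section \<open>Fourier coefficients of the Poisson kernels\<close>

definition fexp :: "int \<Rightarrow> real \<Rightarrow> complex" where
  "fexp k x = exp (\<i> * of_int k * of_real x)"

lemma fexp_cis: "fexp k x = cis (of_int k * x)"
  by (simp add: fexp_def cis_conv_exp mult.assoc)

lemma fexp_0 [simp]: "fexp 0 x = 1" "fexp k 0 = 1"
  by (simp_all add: fexp_def)

lemma norm_fexp [simp]: "norm (fexp k x) = 1"
  by (simp add: fexp_cis)

lemma fexp_add: "fexp (j + k) x = fexp j x * fexp k x"
  and fexp_add_arg: "fexp k (x + y) = fexp k x * fexp k y"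
  and fexp_diff_arg: "fexp k (x - y) = fexp k x * fexp (- k) y"
  by (simp_all add: fexp_cis cis_mult algebra_simps)

lemma cnj_fexp: "cnj (fexp k x) = fexp (- k) x"
  by (simp add: fexp_cis cis_cnj)

lemma fexp_uminus_arg: "fexp k (- x) = fexp (- k) x"
  by (simp add: fexp_cis)

lemma fexp_power: "fexp 1 x ^ n = fexp (int n) x"
  by (simp add: fexp_cis Complex.DeMoivre)

lemma fexp_2pi: "fexp k (2 * pi) = 1"
  using cis_multiple_2pi[of "of_int k"] by (simp add: fexp_cis mult.commute)

lemma periodic_fexp: "periodic (fexp k)"
  by (simp add: periodic_def fexp_add_arg fexp_2pi)

lemma continuous_fexp [continuous_intros]: "continuous_on S (fexp k)"
  unfolding fexp_def by (intro continuous_intros)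

lemma fexp_measurable [measurable]: "fexp k \<in> borel_measurable borel"
  by (intro borel_measurable_continuous_onI continuous_fexp)

text \<open>
  Translating by \<open>pi / k\<close> changes the sign of \<open>fexp k\<close> and leaves its mean unchanged.
\<close>

lemma integral_fexp: "(\<integral>t. fexp k t \<partial>circle) = (if k = 0 then 1 else 0)"
proof (cases "k = 0")
  case False
  define I where "I = (\<integral>t. fexp k t \<partial>circle)"
  have refl: "I = fexp k x * (\<integral>t. fexp (-k) t \<partial>circle)" for x
    using integral_circle_reflect[OF _ periodic_fexp[of k], of x]
    by (simp add: I_def fexp_diff_arg)
  \<comment> \<open>Comparing the shifts 0 and \<open>pi / k\<close> gives \<open>I = - I\<close>.\<close>
  have "fexp k (pi / k) = -1" using False by (simp add: fexp_cis)
  with refl[of "pi / k"] refl[of 0] have "I = 0" by simp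
  then show ?thesis using False by (simp add: I_def)
qed simp

lemma integrable_fexp: "integrable circle (fexp k)"
  by (rule integrable_circle_bounded[where B=1]) auto

text \<open>
  The function \<open>(1 + z) / (1 - z)\<close> on the circle of radius \<open>r\<close>, whose real and imaginary
  parts are the two kernels. Its geometric expansion gives the Fourier coefficients of both
  and the approximation of the Poisson kernel by trigonometric polynomials.
\<close>

definition poisson_analytic :: "real \<Rightarrow> real \<Rightarrow> complex" where
  "poisson_analytic r t = (1 + of_real r * fexp 1 t) / (1 - of_real r * fexp 1 t)"

lemma norm_r_fexp: "0 < r \<Longrightarrow> norm (of_real r * fexp 1 t) = r"
  by (simp add: norm_mult)

lemma one_minus_r_fexp:
  assumes "0 < r" "r < 1"
  shows "1 - of_real r * fexp 1 t \<noteq> 0" "1 - r \<le> norm (1 - of_real r * fexp 1 t)"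
proof -
  show "1 - r \<le> norm (1 - of_real r * fexp 1 t)"
    using norm_triangle_ineq2[of 1 "of_real r * fexp 1 t"] assms by (simp add: norm_mult)
  then show "1 - of_real r * fexp 1 t \<noteq> 0" using assms by auto
qed

lemma poisson_analytic_eq:
  assumes "0 < r" "r < 1"
  shows "poisson_analytic r t = of_real (poisson r t) + \<i> * of_real (conj_poisson r t)"
proof -
  let ?P = "poisson r t" and ?Q = "conj_poisson r t" and ?D = "poisson_den r t"
  have D: "?D \<noteq> 0" using poisson_den_pos[OF assms, of t] by simp
  have PD: "?P * ?D = 1 - r\<^sup>2" "?Q * ?D = 2 * r * sin t"
    using D by (simp_all add: poisson_def conj_poisson_def)
  have sc: "(sin t)\<^sup>2 = 1 - (cos t)\<^sup>2" by (simp add: sin_squared_eq)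
  have "(?P * (1 - r * cos t) + ?Q * (r * sin t)) * ?D = (?P * ?D) * (1 - r * cos t) + (?Q * ?D) * (r * sin t)"
    by (simp add: algebra_simps)
  also have "\<dots> = 1 - r * cos t - r\<^sup>2 * (1 - r * cos t) + 2 * r\<^sup>2 * (sin t)\<^sup>2"
    by (simp add: PD algebra_simps power2_eq_square)
  also have "\<dots> = (1 + r * cos t) * ?D"
    unfolding sc by (simp add: poisson_den_def algebra_simps power2_eq_square)
  finally have re: "?P * (1 - r * cos t) + ?Q * (r * sin t) = 1 + r * cos t" using D by simp
  have "(?Q * (1 - r * cos t) - ?P * (r * sin t)) * ?D = (?Q * ?D) * (1 - r * cos t) - (?P * ?D) * (r * sin t)"
    by (simp add: algebra_simps)
  also have "\<dots> = (2 * r * sin t) * (1 - r * cos t) - (1 - r\<^sup>2) * (r * sin t)"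
    by (simp only: PD)
  also have "\<dots> = (r * sin t) * ?D"
    by (simp add: poisson_den_def algebra_simps power2_eq_square)
  finally have im: "?Q * (1 - r * cos t) - ?P * (r * sin t) = r * sin t" using D by simp
  have eq: "(of_real ?P + \<i> * of_real ?Q) * (1 - of_real r * fexp 1 t) = 1 + of_real r * fexp 1 t"
    using re im by (simp add: complex_eq_iff fexp_cis algebra_simps)
  show ?thesis unfolding poisson_analytic_def
    by (subst nonzero_divide_eq_eq[OF one_minus_r_fexp(1)[OF assms, of t]]) (rule eq[symmetric])
qed

lemma poisson_analytic_approx:
  assumes "0 < r" "r < 1"
  shows "norm (poisson_analytic r t - (1 + 2 * (\<Sum>m<M. of_real r ^ Suc m * fexp (int (Suc m)) t)))
    \<le> 2 * r ^ Suc M / (1 - r)"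
proof -
  define z where "z = of_real r * fexp 1 t"
  have z: "1 - z \<noteq> 0" "1 - r \<le> norm (1 - z)" "norm z = r"
    using one_minus_r_fexp[OF assms, of t] norm_r_fexp[of r t] assms by (auto simp: z_def)
  have pw: "of_real r ^ Suc m * fexp (int (Suc m)) t = z ^ Suc m" for m
    by (simp only: z_def power_mult_distrib fexp_power)
  have "(1 - z) * (\<Sum>m<M. z ^ m) = 1 - z ^ M"
    by (rule one_diff_power_eq[symmetric])
  then have "(\<Sum>m<M. z ^ Suc m) * (1 - z) = z * (1 - z ^ M)"
    by (simp add: sum_distrib_left[symmetric] mult_ac)
  then have sm: "(\<Sum>m<M. z ^ Suc m) = z * (1 - z ^ M) / (1 - z)"
    using z(1) by (simp only: eq_divide_eq) simp
  have comb: "(1 + z) / w - (1 + 2 * (A / w)) = (1 + z - w - 2 * A) / w" if "w \<noteq> 0" for w A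
    using that by (simp add: field_simps)
  have "poisson_analytic r t - (1 + 2 * (\<Sum>m<M. z ^ Suc m)) = 2 * z ^ Suc M / (1 - z)"
    unfolding poisson_analytic_def z_def[symmetric] sm comb[OF z(1)]
    by (simp add: algebra_simps)
  then have "norm (poisson_analytic r t - (1 + 2 * (\<Sum>m<M. z ^ Suc m))) = 2 * r ^ Suc M / norm (1 - z)"
    by (simp add: norm_divide norm_mult norm_power z(3) del: power_Suc)
  also have "\<dots> \<le> 2 * r ^ Suc M / (1 - r)"
    using z(2) assms by (intro divide_left_mono mult_pos_pos) auto
  finally show ?thesis unfolding pw .
qed

lemma poisson_analytic_measurable [measurable]: "poisson_analytic r \<in> borel_measurable borel"
  unfolding poisson_analytic_def by measurable

lemma poisson_analytic_bounded:
  assumes "0 < r" "r < 1"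
  shows "norm (poisson_analytic r t) \<le> 1 + 2 * r / (1 - r)"
  using poisson_analytic_approx[OF assms, of t 0] norm_triangle_ineq2[of "poisson_analytic r t" 1] by simp

lemma integral_poisson_analytic:
  assumes r: "0 < r" "r < 1"
  shows "(\<integral>t. poisson_analytic r t * fexp j t \<partial>circle)
    = (if j = 0 then 1 else if j < 0 then 2 * of_real r ^ nat (- j) else 0)" (is "?I = ?v")
proof -
  let ?S = "\<lambda>M t. 1 + 2 * (\<Sum>m<M. of_real r ^ Suc m * fexp (int (Suc m)) t)"
  have intS: "(\<integral>t. ?S M t * fexp j t \<partial>circle) = ?v" if M: "nat \<bar>j\<bar> \<le> M" for M
  proof -
    have "(\<integral>t. ?S M t * fexp j t \<partial>circle)
        = (\<integral>t. fexp j t + 2 * (\<Sum>m<M. of_real r ^ Suc m * fexp (int (Suc m) + j) t) \<partial>circle)"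
      by (simp add: distrib_right sum_distrib_right fexp_add mult.assoc)
    also have "\<dots> = (if j = 0 then 1 else 0)
        + 2 * (\<Sum>m<M. of_real r ^ Suc m * (if int (Suc m) + j = 0 then 1 else 0))"
      using integrable_fexp by (simp add: integral_fexp del: of_nat_Suc power_Suc)
    also have "(\<Sum>m<M. of_real r ^ Suc m * (if int (Suc m) + j = 0 then 1 else (0::complex)))
        = (\<Sum>m<M. if m = nat (-j) - 1 \<and> j < 0 then of_real r ^ nat (-j) else 0)"
      by (intro sum.cong) (auto, (simp add: nat_diff_distrib' flip: power_Suc)+)
    also have "\<dots> = (if j < 0 then of_real r ^ nat (-j) else 0)"
      using M by (cases "j < 0") auto
    finally show ?thesis by simp
  qed
  have bound: "norm (?I - ?v) \<le> 2 * r ^ Suc M / (1 - r)" if "nat \<bar>j\<bar> \<le> M" for M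
  proof -
    have int: "integrable circle (\<lambda>t. poisson_analytic r t * fexp j t)"
      by (rule integrable_circle_bounded[where B="1 + 2 * r / (1-r)"])
        (use poisson_analytic_bounded[OF r] in \<open>auto simp: norm_mult\<close>)
    have int2: "integrable circle (\<lambda>t. ?S M t * fexp j t)"
    proof (rule integrable_circle_bounded[where B="1 + 2 * real M"])
      fix t
      have "norm (\<Sum>m<M. of_real r ^ Suc m * fexp (int (Suc m)) t) \<le> (\<Sum>m<M. 1)"
        using r by (intro norm_sum[THEN order_trans] sum_mono)
          (auto simp: norm_mult norm_power power_le_one simp del: power_Suc)
      then have "norm (?S M t) \<le> 1 + 2 * real M"
        by (intro norm_triangle_ineq[THEN order_trans]) (simp add: norm_mult)
      then show "norm (?S M t * fexp j t) \<le> 1 + 2 * real M" by (simp add: norm_mult)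
    qed measurable
    have "?I - ?v = ?I - (\<integral>t. ?S M t * fexp j t \<partial>circle)" by (simp only: intS[OF that])
    also have "\<dots> = (\<integral>t. (poisson_analytic r t - ?S M t) * fexp j t \<partial>circle)"
      unfolding left_diff_distrib by (rule Bochner_Integration.integral_diff[OF int int2, symmetric])
    also have "norm \<dots> \<le> (\<integral>t. 2 * r ^ Suc M / (1 - r) \<partial>circle)"
      by (rule integral_circle_bound) (use poisson_analytic_approx[OF r] in \<open>auto simp: norm_mult simp del: power_Suc\<close>)
    finally show ?thesis by simp
  qed
  have "(\<lambda>M. 2 * r ^ Suc M / (1 - r)) \<longlonglongrightarrow> 2 * 0 / (1 - r)"
    using r by (intro tendsto_intros LIMSEQ_Suc LIMSEQ_realpow_zero) auto
  then have "norm (?I - ?v) \<le> 0"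
    using bound by (intro tendsto_lowerbound[where F=sequentially])
      (auto simp: eventually_sequentially intro!: exI[of _ "nat \<bar>j\<bar>"])
  then show ?thesis by simp
qed

lemma
  assumes r: "0 < r" "r < 1"
  shows poisson_coeff: "(\<integral>t. of_real (poisson r t) * fexp (- k) t \<partial>circle) = of_real r ^ nat \<bar>k\<bar>"
    and conj_poisson_coeff:
      "(\<integral>t. of_real (conj_poisson r t) * fexp (- k) t \<partial>circle) = - \<i> * of_int (sgn k) * of_real r ^ nat \<bar>k\<bar>"
proof -
  let ?A = "\<lambda>j. \<integral>t. poisson_analytic r t * fexp j t \<partial>circle"
  have int: "integrable circle (\<lambda>t. poisson_analytic r t * fexp j t)" for j
    by (rule integrable_circle_bounded[where B="1 + 2 * r / (1-r)"])
      (use poisson_analytic_bounded[OF r] in \<open>auto simp: norm_mult\<close>)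
  have cnj_int: "(\<integral>t. cnj (poisson_analytic r t) * fexp (-k) t \<partial>circle) = cnj (?A k)" for k
    using Bochner_Integration.integral_cnj[of circle "\<lambda>t. poisson_analytic r t * fexp k t"]
    by (simp add: cnj_fexp)
  have int': "integrable circle (\<lambda>t. cnj (poisson_analytic r t) * fexp (-k) t)" for k
    using Bochner_Integration.integrable_cnj[of circle "\<lambda>t. poisson_analytic r t * fexp k t"] int
    by (simp add: cnj_fexp)
  have "(\<integral>t. of_real (poisson r t) * fexp (- k) t \<partial>circle)
      = (\<integral>t. (poisson_analytic r t * fexp (-k) t + cnj (poisson_analytic r t) * fexp (-k) t) / 2 \<partial>circle)"
    by (intro Bochner_Integration.integral_cong) (auto simp: poisson_analytic_eq[OF r] algebra_simps)
  also have "\<dots> = (?A (-k) + cnj (?A k)) / 2"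
    using int int' by (simp add: cnj_int)
  also have "\<dots> = of_real r ^ nat \<bar>k\<bar>"
    unfolding integral_poisson_analytic[OF r] by simp
  finally show "(\<integral>t. of_real (poisson r t) * fexp (- k) t \<partial>circle) = of_real r ^ nat \<bar>k\<bar>" .
  have "(\<integral>t. of_real (conj_poisson r t) * fexp (- k) t \<partial>circle)
      = (\<integral>t. (poisson_analytic r t * fexp (-k) t - cnj (poisson_analytic r t) * fexp (-k) t) / (2 * \<i>) \<partial>circle)"
    by (intro Bochner_Integration.integral_cong) (auto simp: poisson_analytic_eq[OF r] algebra_simps)
  also have "\<dots> = (?A (-k) - cnj (?A k)) / (2 * \<i>)"
    using int int' by (simp add: cnj_int)
  also have "\<dots> = - \<i> * of_int (sgn k) * of_real r ^ nat \<bar>k\<bar>"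
    unfolding integral_poisson_analytic[OF r] by (simp add: sgn_if field_simps)
  finally show "(\<integral>t. of_real (conj_poisson r t) * fexp (- k) t \<partial>circle)
      = - \<i> * of_int (sgn k) * of_real r ^ nat \<bar>k\<bar>" .
qed

lemma integral_poisson: 
  assumes "0 < r" "r < 1" shows "(\<integral>t. poisson r t \<partial>circle) = 1"
  using poisson_coeff[OF assms, of 0] by simp

section \<open>Radial limits almost everywhere\<close>

lemma integral_circle_fold:
  fixes F :: "real \<Rightarrow> complex"
  assumes [measurable]: "F \<in> borel_measurable borel" and int: "integrable circle F"
  shows "set_integrable lborel {0..pi} (\<lambda>t. F t)" "set_integrable lborel {0..pi} (\<lambda>t. F (- t))"
    and "(\<integral>t. F t \<partial>circle) = (1 / (2*pi)) *\<^sub>R (LINT t:{0..pi}|lborel. F t + F (- t))"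
proof -
  have i: "set_integrable lborel {-pi..pi} F" using int by (simp add: integrable_circle)
  have neg: "set_integrable lborel {-pi..0} F" 
    by (rule set_integrable_subset[OF i]) auto
  have "integrable lborel (\<lambda>x. indicator {-pi..0} (0 + (-1) * x) *\<^sub>R F (0 + (-1) * x))"
    using neg unfolding set_integrable_def by (subst lborel_integrable_real_affine_iff) auto
  also have "(\<lambda>x. indicator {-pi..0} (0 + (-1) * x) *\<^sub>R F (0 + (-1) * x)) = (\<lambda>x. indicator {0..pi} x *\<^sub>R F (-x))"
    by (auto simp: indicator_def)
  finally show n: "set_integrable lborel {0..pi} (\<lambda>t. F (- t))" by (simp add: set_integrable_def)
  show p: "set_integrable lborel {0..pi} (\<lambda>t. F t)" 
    by (rule set_integrable_subset[OF i]) auto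
  have "(LINT t:{-pi..pi}|lborel. F t) = (LINT t:{-pi..0} \<union> {0..pi}|lborel. F t)"
    by (simp add: ivl_disj_un_two_touch)
  also have "\<dots> = (LINT t:{-pi..0}|lborel. F t) + (LINT t:{0..pi}|lborel. F t)"
    by (rule set_integral_Un_AE[OF _ _ _ neg p]) (auto intro: AE_mp[OF AE_lborel_singleton[of 0]])
  also have "(LINT t:{-pi..0}|lborel. F t) = (LINT t:{0..pi}|lborel. F (- t))"
  proof (subst set_integral_reflect)
    have "{x. -x \<in> {-pi..0}} = {0..pi}" by auto
    then show "(LINT x:{x. -x \<in> {-pi..0}}|lborel. F (-x)) = (LINT t:{0..pi}|lborel. F (- t))" by simp
  qed
  finally have "(LINT t:{-pi..pi}|lborel. F t) = (LINT t:{0..pi}|lborel. F t + F (-t))"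
    using n p by (simp add: set_integral_add)
  then show "(\<integral>t. F t \<partial>circle) = (1 / (2*pi)) *\<^sub>R (LINT t:{0..pi}|lborel. F t + F (- t))"
    by (simp add: integral_circle)
qed


lemma poisson_tendsto_0:
  assumes "0 < d" "d \<le> pi"
  shows "((\<lambda>\<epsilon>. poisson (1 - \<epsilon>) d) \<longlongrightarrow> 0) (at_right 0)"
proof -
  have "cos d < cos 0" using assms by (intro cos_monotone_0_pi) auto
  then have "((\<lambda>\<epsilon>::real. (1 - (1 - \<epsilon>)\<^sup>2) / (1 - 2 * (1 - \<epsilon>) * cos d + (1 - \<epsilon>)\<^sup>2)) \<longlongrightarrow>
      (1 - (1 - 0)\<^sup>2) / (1 - 2 * (1 - 0) * cos d + (1 - 0)\<^sup>2)) (at_right 0)"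
    by (intro tendsto_intros) auto
  then show ?thesis by (simp add: poisson_def poisson_den_def)
qed

lemma half_mean_poisson:
  assumes "0 < r" "r < 1"
  shows "set_integrable lborel {0..pi} (\<lambda>t. complex_of_real (poisson r t))"
    "(LINT t:{0..pi}|lborel. complex_of_real (poisson r t)) = of_real pi"
proof -
  have int: "integrable circle (\<lambda>t. complex_of_real (poisson r t))"
    by (rule integrable_circle_bounded[where B="1/(1-r)\<^sup>2"]) (use poisson_bounded[OF assms] in auto)
  note fold = integral_circle_fold[OF _ int, simplified]
  show "set_integrable lborel {0..pi} (\<lambda>t. complex_of_real (poisson r t))" by (rule fold(1)) measurable
  have "(1 / (2*pi)) *\<^sub>R (2 * (LINT t:{0..pi}|lborel. complex_of_real (poisson r t))) = 1"
    using fold(3) integral_poisson[OF assms] by simp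
  then show "(LINT t:{0..pi}|lborel. complex_of_real (poisson r t)) = of_real pi"
    by (simp add: scaleR_conv_of_real field_simps)
qed

lemma integral_poisson_slope_weight:
  assumes r: "0 < r" "r < 1"
  shows "set_integrable lborel {0..pi} (\<lambda>u. poisson_slope r u * u)"
    "(LINT u:{0..pi}|lborel. poisson_slope r u * u) \<le> pi"
proof -
  have one: "(LINT t:{0..u}|lborel. (1::complex)) = of_real u" if "u \<in> {0..pi}" for u
    using that by (simp add: set_integral_const scaleR_conv_of_real)
  note cake = poisson_layer_cake[OF r, where k="\<lambda>_. 1"]
  have kint: "set_integrable lborel {0..pi} (\<lambda>_. 1 :: complex)"
    by (simp add: set_integrable_def)
  have ind: "indicator {0..pi} u *\<^sub>R poisson_slope r u *\<^sub>R (LINT t:{0..u}|lborel. (1::complex))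
      = of_real (indicator {0..pi} u *\<^sub>R (poisson_slope r u * u))" for u
    by (cases "u \<in> {0..pi}") (auto simp: one scaleR_conv_of_real)
  have "set_integrable lborel {0..pi} (\<lambda>u. poisson_slope r u *\<^sub>R (LINT t:{0..u}|lborel. (1::complex)))"
    by (rule cake(2)[OF kint]) simp
  then show si: "set_integrable lborel {0..pi} (\<lambda>u. poisson_slope r u * u)"
    unfolding set_integrable_def ind complex_of_real_integrable_eq .
  have "(LINT t:{0..pi}|lborel. poisson r t *\<^sub>R (1::complex)) = poisson r pi *\<^sub>R (LINT t:{0..pi}|lborel. 1)
    + (LINT u:{0..pi}|lborel. poisson_slope r u *\<^sub>R (LINT t:{0..u}|lborel. (1::complex)))"
    by (rule cake(1)[OF kint]) simp
  moreover have "(LINT u:{0..pi}|lborel. poisson_slope r u *\<^sub>R (LINT t:{0..u}|lborel. (1::complex)))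
      = of_real (LINT u:{0..pi}|lborel. poisson_slope r u * u)"
    unfolding set_lebesgue_integral_def[of _ "{0..pi}"] ind by (rule integral_complex_of_real)
  moreover have "(LINT t:{0..pi}|lborel. poisson r t *\<^sub>R (1::complex)) = of_real pi"
    using half_mean_poisson(2)[OF r] by (simp add: scaleR_conv_of_real)
  ultimately have "complex_of_real pi = of_real (poisson r pi * pi + (LINT u:{0..pi}|lborel. poisson_slope r u * u))"
    by (simp add: one scaleR_conv_of_real)
  then have "pi = poisson r pi * pi + (LINT u:{0..pi}|lborel. poisson_slope r u * u)"
    by (simp only: of_real_eq_iff)
  moreover have "0 \<le> poisson r pi * pi" using poisson_nonneg[OF r] by simp
  ultimately show "(LINT u:{0..pi}|lborel. poisson_slope r u * u) \<le> pi" by linarith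
qed

text \<open>
  Only the primitive of \<open>k\<close> is assumed to be small, not that of \<open>\<bar>k\<bar>\<close>, because the layer-cake
  formula sees nothing else. Near 0 the primitive is at most \<open>\<eta> * u\<close> and the slope has first
  moment at most \<open>pi\<close>; away from 0 the kernel tends to 0.
\<close>

lemma poisson_integral_tendsto_0:
  fixes k :: "real \<Rightarrow> complex"
  assumes k: "set_integrable lborel {0..pi} k" and [measurable]: "k \<in> borel_measurable borel"
    and small: "\<And>e. 0 < e \<Longrightarrow> \<exists>d>0. \<forall>u. 0 < u \<and> u < d \<longrightarrow> norm (LINT t:{0..u}|lborel. k t) \<le> e * u"
  shows "((\<lambda>\<epsilon>. LINT t:{0..pi}|lborel. poisson (1 - \<epsilon>) t *\<^sub>R k t) \<longlongrightarrow> 0) (at_right 0)"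
proof (rule tendstoI)
  fix e :: real assume "0 < e"
  let ?G = "\<lambda>u. LINT t:{0..u}|lborel. k t"
  define c where "c = (LINT t:{0..pi}|lborel. norm (k t))"
  have c0: "0 \<le> c" unfolding c_def set_lebesgue_integral_def by (intro Bochner_Integration.integral_nonneg) simp
  have Gc: "norm (?G u) \<le> c" if "u \<le> pi" for u
  proof -
    have "norm (?G u) \<le> (LINT t:{0..u}|lborel. norm (k t))"
      by (rule set_integral_norm_bound) (rule set_integrable_subset[OF k], use that in auto)
    also have "\<dots> \<le> c" unfolding c_def set_lebesgue_integral_def
    proof (rule integral_mono)
      have kn: "set_integrable lborel {0..pi} (\<lambda>t. norm (k t))" using k by (rule set_integrable_norm)
      then show "integrable lborel (\<lambda>t. indicator {0..pi} t *\<^sub>R norm (k t))"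
        by (simp add: set_integrable_def)
      have "set_integrable lborel {0..u} (\<lambda>t. norm (k t))"
        by (rule set_integrable_subset[OF kn]) (use that in auto)
      then show "integrable lborel (\<lambda>t. indicator {0..u} t *\<^sub>R norm (k t))"
        by (simp add: set_integrable_def)
    qed (use that in \<open>auto simp: indicator_def\<close>)
    finally show ?thesis .
  qed
  define \<eta> where "\<eta> = e / (2 * pi)"
  have "\<eta> > 0" using \<open>0 < e\<close> by (simp add: \<eta>_def)
  from small[OF this] obtain d0 where d0: "0 < d0" "\<And>u. 0 < u \<Longrightarrow> u < d0 \<Longrightarrow> norm (?G u) \<le> \<eta> * u" by blast
  \<comment> \<open>The bound \<open>poisson r d\<close> for the part of the integral beyond \<open>d\<close> requires \<open>d \<le> pi\<close>.\<close>
  define d where "d = min d0 pi"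
  have d: "0 < d" "d \<le> pi" using d0 by (auto simp: d_def)
  have Gb: "norm (?G u) \<le> \<eta> * u + c * indicator {d..pi} u" if "0 \<le> u" "u \<le> pi" for u
  proof -
    consider "u = 0" | "0 < u" "u < d" | "d \<le> u" using \<open>0 \<le> u\<close> by linarith
    then show ?thesis
    proof cases
      case 1
      have "AE t in lborel. indicator {0..0::real} t *\<^sub>R k t = 0"
        using AE_lborel_singleton[of 0] by eventually_elim (simp add: indicator_def)
      then have "?G 0 = 0" unfolding set_lebesgue_integral_def by (rule integral_eq_zero_AE)
      then show ?thesis using 1 d by simp
    next
      case 2
      then have "norm (?G u) \<le> \<eta> * u" by (intro d0(2)) (auto simp: d_def)
      then show ?thesis using c0 2 by (simp add: indicator_def)
    next
      case 3
      have "0 \<le> \<eta> * u" using \<open>\<eta> > 0\<close> \<open>0 \<le> u\<close> by simp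
      moreover have "indicator {d..pi} u = (1::real)" using 3 that by simp
      ultimately show ?thesis using Gc[OF that(2)] by simp
    qed
  qed
  have bound: "norm (LINT t:{0..pi}|lborel. poisson r t *\<^sub>R k t) \<le> c * poisson r pi + e / 2 + c * poisson r d"
    if r: "0 < r" "r < 1" for r
  proof -
    note cake = poisson_layer_cake[OF r k]
    have s0: "u \<in> {0..pi} \<Longrightarrow> 0 \<le> poisson_slope r u" for u using poisson_slope_nonneg[OF r] by auto
    have sd: "(\<lambda>u. indicator {0..pi} u *\<^sub>R (poisson_slope r u * indicator {d..pi} u))
        = (\<lambda>u. poisson_slope r u * indicator {d..pi} u)"
      using d by (auto simp: indicator_def)
    have sdi: "set_integrable lborel {0..pi} (\<lambda>u. poisson_slope r u * indicator {d..pi} u)"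
      unfolding set_integrable_def sd by (rule integrable_poisson_slope) (use r d in auto)
    have "norm (LINT u:{0..pi}|lborel. poisson_slope r u *\<^sub>R ?G u)
       \<le> (LINT u:{0..pi}|lborel. norm (poisson_slope r u *\<^sub>R ?G u))"
      by (rule set_integral_norm_bound, rule cake(2)) simp
    also have "\<dots> \<le> (LINT u:{0..pi}|lborel. \<eta> * (poisson_slope r u * u) + c * (poisson_slope r u * indicator {d..pi} u))"
    proof (rule set_integral_mono)
      show "set_integrable lborel {0..pi} (\<lambda>u. norm (poisson_slope r u *\<^sub>R ?G u))"
        by (rule set_integrable_norm, rule cake(2)) simp
      show "set_integrable lborel {0..pi} (\<lambda>u. \<eta> * (poisson_slope r u * u) + c * (poisson_slope r u * indicator {d..pi} u))"
        using integral_poisson_slope_weight(1)[OF r] sdi by (intro set_integral_add(1) set_integrable_mult_right) auto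
      fix u assume u: "u \<in> {0..pi}"
      have "norm (poisson_slope r u *\<^sub>R ?G u) = poisson_slope r u * norm (?G u)" using s0[OF u] by simp
      also have "\<dots> \<le> poisson_slope r u * (\<eta> * u + c * indicator {d..pi} u)"
        using s0[OF u] Gb[of u] u by (intro mult_left_mono) auto
      finally show "norm (poisson_slope r u *\<^sub>R ?G u) \<le> \<eta> * (poisson_slope r u * u) + c * (poisson_slope r u * indicator {d..pi} u)"
        by (simp add: algebra_simps)
    qed
    also have "\<dots> = \<eta> * (LINT u:{0..pi}|lborel. poisson_slope r u * u) + c * (LINT u:{0..pi}|lborel. poisson_slope r u * indicator {d..pi} u)"
      using integral_poisson_slope_weight(1)[OF r] sdi
      by (subst set_integral_add(2)) (auto intro!: set_integrable_mult_right)
    also have "(LINT u:{0..pi}|lborel. poisson_slope r u * indicator {d..pi} u) = poisson r d - poisson r pi"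
      unfolding set_lebesgue_integral_def sd by (rule integral_poisson_slope) (use r d in auto)
    also have "\<eta> * (LINT u:{0..pi}|lborel. poisson_slope r u * u) + c * (poisson r d - poisson r pi) \<le> \<eta> * pi + c * poisson r d"
      using integral_poisson_slope_weight(2)[OF r] \<open>\<eta> > 0\<close> c0 poisson_nonneg[OF r]
      by (intro add_mono mult_left_mono) auto
    also have "\<eta> * pi = e / 2" by (simp add: \<eta>_def)
    finally have 1: "norm (LINT u:{0..pi}|lborel. poisson_slope r u *\<^sub>R ?G u) \<le> e / 2 + c * poisson r d" .
    have 2: "norm (poisson r pi *\<^sub>R ?G pi) \<le> c * poisson r pi"
      using mult_right_mono[OF Gc[of pi] poisson_nonneg[OF r, of pi]] poisson_nonneg[OF r, of pi]
      by (simp add: mult.commute)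
    have eq: "(LINT t:{0..pi}|lborel. poisson r t *\<^sub>R k t)
        = poisson r pi *\<^sub>R ?G pi + (LINT u:{0..pi}|lborel. poisson_slope r u *\<^sub>R ?G u)"
      by (rule cake(1)) simp
    show ?thesis unfolding eq using 1 2 norm_triangle_ineq[of "poisson r pi *\<^sub>R ?G pi" "LINT u:{0..pi}|lborel. poisson_slope r u *\<^sub>R ?G u"]
      by linarith
  qed
  have "((\<lambda>\<epsilon>. c * poisson (1-\<epsilon>) pi + c * poisson (1-\<epsilon>) d) \<longlongrightarrow> c * 0 + c * 0) (at_right 0)"
    using d by (intro tendsto_intros poisson_tendsto_0) auto
  then have ev: "\<forall>\<^sub>F \<epsilon> in at_right 0. c * poisson (1-\<epsilon>) pi + c * poisson (1-\<epsilon>) d < e / 2"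
    by (rule order_tendstoD) (use \<open>0 < e\<close> in simp)
  have ev1: "\<forall>\<^sub>F \<epsilon> in at_right (0::real). 0 < \<epsilon> \<and> \<epsilon> < 1"
    by (auto simp: eventually_at_right_field intro!: exI[of _ 1])
  from ev ev1 show "\<forall>\<^sub>F \<epsilon> in at_right 0. dist (LINT t:{0..pi}|lborel. poisson (1 - \<epsilon>) t *\<^sub>R k t) 0 < e"
  proof eventually_elim
    case (elim \<epsilon>)
    then show ?case using bound[of "1 - \<epsilon>"] by simp
  qed
qed


lemma set_integrable_periodic:
  fixes h :: "real \<Rightarrow> complex"
  assumes [measurable]: "h \<in> borel_measurable borel" and per: "periodic h" and int: "integrable circle h"
  shows "set_integrable lborel {a..b} h"
proof -
  have one: "set_integrable lborel {c-pi..c+pi} h" for c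
  proof -
    have "integrable circle (\<lambda>t. h (c - t))" using int by (simp add: integrable_circle_reflect per)
    then have "set_integrable lborel {-pi..pi} (\<lambda>t. h (c - t))" by (simp add: integrable_circle)
    moreover have "(\<lambda>t. indicator {-pi..pi} t *\<^sub>R h (c - t))
        = (\<lambda>t. indicator {c-pi..c+pi} (c + (-1) * t) *\<^sub>R h (c + (-1) * t))"
      by (auto simp: indicator_def minus_le_iff)
    ultimately have "integrable lborel (\<lambda>t. indicator {c-pi..c+pi} (c + (-1) * t) *\<^sub>R h (c + (-1) * t))"
      by (simp only: set_integrable_def)
    then show ?thesis
      unfolding set_integrable_def by (subst (asm) lborel_integrable_real_affine_iff) auto
  qed
  have many: "set_integrable lborel {c..c + 2 * pi * real n} h" for c n
  proof (induction n)
    case 0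
    show ?case by (rule set_integrable_subset[OF one[of c]]) auto
  next
    case (Suc n)
    let ?d = "c + 2 * pi * real n + pi"
    have "set_integrable lborel ({c..c + 2 * pi * real n} \<union> {?d-pi..?d+pi}) h"
      by (rule set_integrable_Un[OF Suc one]) auto
    then show ?case by (rule set_integrable_subset) (auto simp: algebra_simps)
  qed
  obtain n where "b - a \<le> real n" using real_arch_simple by blast
  also have "real n \<le> 2 * pi * real n" using pi_gt3 by (simp add: mult_le_cancel_right1)
  finally show ?thesis by (intro set_integrable_subset[OF many[of a n]]) auto
qed

text \<open>
  The one-sided differentiation theorem for primitives, in terms of Lebesgue integrals. The
  left-hand derivatives come from applying it to the reflected function.
\<close>

lemma lebesgue_differentiation_right:
  fixes h :: "real \<Rightarrow> complex"
  assumes [measurable]: "h \<in> borel_measurable borel" and h: "\<And>a b. set_integrable lborel {a..b} h"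
  obtains N where "N \<in> null_sets lebesgue"
    "\<And>x e. x \<notin> N \<Longrightarrow> 0 < e \<Longrightarrow> \<exists>d>0. \<forall>u. 0 < u \<and> u < d \<longrightarrow>
       norm (LINT t:{0..u}|lborel. h (x + t) - h x) \<le> e * u"
proof -
  have "h integrable_on cbox a b" for a b :: real
    using set_borel_integral_eq_integral(1)[OF h[of a b]] by simp
  then obtain N where N: "negligible N" "\<And>x e. x \<notin> N \<Longrightarrow> 0 < e \<Longrightarrow>
      \<exists>d>0. \<forall>u. 0 < u \<and> u < d \<longrightarrow>
        norm (integral (cbox x (x + u *\<^sub>R One)) h /\<^sub>R u ^ DIM(real) - h x) < e"
    using integrable_ccontinuous_explicit by metis
  have main: "norm (LINT t:{0..u}|lborel. h (x + t) - h x) \<le> e * u"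
    if "0 < u" and le: "norm (integral (cbox x (x + u *\<^sub>R One)) h /\<^sub>R u ^ DIM(real) - h x) < e" for x u e
  proof -
    have "set_integrable lborel {x..x+u} h" by (rule h)
    then have int: "integrable lborel (\<lambda>t. indicator {x..x+u} (x + 1 * t) *\<^sub>R h (x + 1 * t))"
      unfolding set_integrable_def by (subst lborel_integrable_real_affine_iff) auto
    have ind: "indicator {x..x+u} (x + 1 * t) *\<^sub>R h (x + 1 * t) = indicator {0..u} t *\<^sub>R h (x + t)" for t
      by (auto simp: indicator_def)
    have si: "set_integrable lborel {0..u} (\<lambda>t. h (x + t))"
      using int unfolding ind set_integrable_def .
    have "integral {x..x+u} h = (LINT t:{x..x+u}|lborel. h t)"
      by (rule set_borel_integral_eq_integral(2)[OF h, symmetric])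
    also have "\<dots> = (\<integral>t. indicator {x..x+u} (x + 1 * t) *\<^sub>R h (x + 1 * t) \<partial>lborel)"
      unfolding set_lebesgue_integral_def by (subst lborel_integral_real_affine[where c=1 and t=x]) auto
    also have "\<dots> = (LINT t:{0..u}|lborel. h (x + t))"
      unfolding ind set_lebesgue_integral_def ..
    finally have I: "integral {x..x+u} h = (LINT t:{0..u}|lborel. h (x + t))" .
    have "(LINT t:{0..u}|lborel. h (x + t) - h x) = (LINT t:{0..u}|lborel. h (x + t)) - (LINT t:{0..u}|lborel. h x)"
    proof (rule set_integral_diff(2)[OF si])
      show "set_integrable lborel {0..u} (\<lambda>t. h x)"
        unfolding set_integrable_def by (intro integrable_scaleR_left integrable_real_indicator)
          (use \<open>0 < u\<close> in auto)
    qed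
    also have "\<dots> = integral {x..x+u} h - of_real u * h x"
      using \<open>0 < u\<close> by (simp add: I set_integral_const scaleR_conv_of_real)
    also have "\<dots> = u *\<^sub>R (integral {x..x+u} h /\<^sub>R u - h x)"
      using \<open>0 < u\<close> by (simp add: scaleR_conv_of_real algebra_simps)
    finally show ?thesis using le \<open>0 < u\<close> by (simp add: mult.commute)
  qed
  show thesis
  proof (rule that)
    show "N \<in> null_sets lebesgue" using N(1) by (simp add: negligible_iff_null_sets)
    fix x e :: real assume "x \<notin> N" "0 < e"
    from N(2)[OF this] main show "\<exists>d>0. \<forall>u. 0 < u \<and> u < d \<longrightarrow>
       norm (LINT t:{0..u}|lborel. h (x + t) - h x) \<le> e * u" by meson
  qed
qed

lemma AE_lborelI_null:
  assumes "N \<in> null_sets lebesgue" "\<And>x. x \<notin> N \<Longrightarrow> P x"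
  shows "AE x in lborel. P x"
proof -
  have "AE x in lebesgue. P x" using assms(1) by (rule AE_I') (use assms(2) in auto)
  then show ?thesis by (simp add: AE_completion_iff)
qed

text \<open>
  Fatou's theorem. As the kernel is even, the error is, up to the factor \<open>1 / (2 * pi)\<close>, the
  integral over \<open>[0, pi]\<close> of the kernel times \<open>h (x + t) + h (x - t) - 2 * h x\<close>. For almost
  every \<open>x\<close> the primitive of this function of \<open>t\<close> has derivative 0 at \<open>t = 0\<close>.
\<close>

lemma poisson_AE_tendsto:
  fixes h :: "real \<Rightarrow> complex"
  assumes [measurable]: "h \<in> borel_measurable borel" and per: "periodic h" and int: "integrable circle h"
  shows "AE x in lborel. ((\<lambda>\<epsilon>. conv (poisson (1 - \<epsilon>)) h x) \<longlongrightarrow> h x) (at_right 0)"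
proof -
  note loc = set_integrable_periodic[OF assms(1) per int]
  obtain N1 where N1: "N1 \<in> null_sets lebesgue"
    "\<And>x e. x \<notin> N1 \<Longrightarrow> 0 < e \<Longrightarrow> \<exists>d>0. \<forall>u. 0 < u \<and> u < d \<longrightarrow>
       norm (LINT t:{0..u}|lborel. h (x + t) - h x) \<le> e * u"
    by (rule lebesgue_differentiation_right[OF assms(1) loc]) blast
  define h' where "h' = (\<lambda>t. h (- t))"
  have h'[measurable]: "h' \<in> borel_measurable borel" unfolding h'_def by measurable
  have per': "periodic h'" using periodic_minus[OF per, of 0] by (simp add: h'_def)
  have int': "integrable circle h'" using integrable_circle_reflect[OF assms(1) per, of 0] int by (simp add: h'_def)
  note loc' = set_integrable_periodic[OF h' per' int']
  obtain N2 where N2: "N2 \<in> null_sets lebesgue"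
    "\<And>x e. x \<notin> N2 \<Longrightarrow> 0 < e \<Longrightarrow> \<exists>d>0. \<forall>u. 0 < u \<and> u < d \<longrightarrow>
       norm (LINT t:{0..u}|lborel. h' (x + t) - h' x) \<le> e * u"
    by (rule lebesgue_differentiation_right[OF h' loc']) blast
  have neg: "uminus ` N2 \<in> null_sets lebesgue"
    using N2(1) negligible_differentiable_image_negligible[of N2 uminus]
    by (simp add: negligible_iff_null_sets differentiable_on_def)
  show ?thesis
  proof (rule AE_lborelI_null[of "N1 \<union> uminus ` N2"])
    show "N1 \<union> uminus ` N2 \<in> null_sets lebesgue" using N1(1) neg by (rule null_sets.Un)
    fix x assume "x \<notin> N1 \<union> uminus ` N2"
    then have x: "x \<notin> N1" "- x \<notin> N2" by force+
    \<comment> \<open>\<open>h (x + t) + h (x - t) - 2 * h x\<close>, as two increments to which the one-sided theorem applies.\<close>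
    define k where "k = (\<lambda>t. (h (x + t) - h x) + (h' (- x + t) - h' (-x)))"
    have k[measurable]: "k \<in> borel_measurable borel" unfolding k_def by measurable
    have hx: "set_integrable lborel {0..u} (\<lambda>t. h (x + t) - h x)" "set_integrable lborel {0..u} (\<lambda>t. h' (- x + t) - h' (- x))" for u
    proof -
      have "periodic (\<lambda>t. h (x + t) - h x)" "integrable circle (\<lambda>t. h (x + t) - h x)"
        using periodic_plus[OF per, of x] int integrable_circle_reflect[OF h' per', of "-x"] int'
        by (auto simp: periodic_def add_ac h'_def)
      then show "set_integrable lborel {0..u} (\<lambda>t. h (x + t) - h x)" by (intro set_integrable_periodic) auto
      have "periodic (\<lambda>t. h' (- x + t) - h' (- x))" "integrable circle (\<lambda>t. h' (- x + t) - h' (- x))"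
        using periodic_plus[OF per', of "-x"] int integrable_circle_reflect[OF assms(1) per, of "x"]
        by (auto simp: periodic_def add_ac h'_def)
      then show "set_integrable lborel {0..u} (\<lambda>t. h' (- x + t) - h' (- x))" by (intro set_integrable_periodic) auto
    qed
    have lim: "((\<lambda>\<epsilon>. LINT t:{0..pi}|lborel. poisson (1 - \<epsilon>) t *\<^sub>R k t) \<longlongrightarrow> 0) (at_right 0)"
    proof (rule poisson_integral_tendsto_0[OF _ k])
      show "set_integrable lborel {0..pi} k" unfolding k_def using hx by (rule set_integral_add(1))
      fix e :: real assume "0 < e"
      then obtain d1 d2 where d: "d1 > 0" "d2 > 0"
        "\<And>u. 0 < u \<Longrightarrow> u < d1 \<Longrightarrow> norm (LINT t:{0..u}|lborel. h (x + t) - h x) \<le> (e/2) * u"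
        "\<And>u. 0 < u \<Longrightarrow> u < d2 \<Longrightarrow> norm (LINT t:{0..u}|lborel. h' (- x + t) - h' (-x)) \<le> (e/2) * u"
        using N1(2)[OF x(1), of "e/2"] N2(2)[OF x(2), of "e/2"] by (metis half_gt_zero)
      have "norm (LINT t:{0..u}|lborel. k t) \<le> e * u" if "0 < u" "u < min d1 d2" for u
      proof -
        have "(LINT t:{0..u}|lborel. k t) = (LINT t:{0..u}|lborel. h (x + t) - h x) + (LINT t:{0..u}|lborel. h' (- x + t) - h' (-x))"
          unfolding k_def using hx by (rule set_integral_add(2))
        also have "norm \<dots> \<le> (e/2) * u + (e/2) * u"
          by (intro norm_triangle_mono d) (use that in auto)
        finally show ?thesis by simp
      qed
      then show "\<exists>d>0. \<forall>u. 0 < u \<and> u < d \<longrightarrow> norm (LINT t:{0..u}|lborel. k t) \<le> e * u"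
        using d(1,2) by (intro exI[of _ "min d1 d2"]) auto
    qed
    have eq: "conv (poisson r) h x
        = h x + (1/(2*pi)) *\<^sub>R (LINT t:{0..pi}|lborel. poisson r t *\<^sub>R k t)" if r: "0 < r" "r < 1" for r
    proof -
      have Pb: "norm (complex_of_real (poisson r t)) \<le> 1 / (1-r)\<^sup>2" for t using poisson_bounded(1)[OF r] by simp
      have Pi: "integrable circle (\<lambda>t. complex_of_real (poisson r t))"
        by (rule integrable_circle_bounded[OF _ Pb]) measurable
      let ?F = "\<lambda>t. of_real (poisson r t) * (h (x - t) - h x)"
      have Phi: "integrable circle (\<lambda>t. of_real (poisson r t) * h (x - t))"
        by (rule conv_integrable[OF poisson_measurable poisson_bounded(1)[OF r] assms(1) per int])
      have Fi: "integrable circle ?F" using Phi Pi by (simp add: right_diff_distrib)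
      have F1: "conv (poisson r) h x = h x + (\<integral>t. ?F t \<partial>circle)"
        using Phi Pi by (simp add: right_diff_distrib integral_poisson[OF r])
      have "(\<integral>t. ?F t \<partial>circle) = (1/(2*pi)) *\<^sub>R (LINT t:{0..pi}|lborel. ?F t + ?F (-t))"
        by (rule integral_circle_fold(3)[OF _ Fi]) measurable
      also have "(\<lambda>t. ?F t + ?F (-t)) = (\<lambda>t. poisson r t *\<^sub>R k t)"
        by (auto simp: k_def h'_def algebra_simps scaleR_conv_of_real)
      finally show ?thesis using F1 by simp
    qed
    have "((\<lambda>\<epsilon>. h x + (1/(2*pi)) *\<^sub>R (LINT t:{0..pi}|lborel. poisson (1 - \<epsilon>) t *\<^sub>R k t)) \<longlongrightarrow> h x + (1/(2*pi)) *\<^sub>R 0) (at_right 0)"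
      by (intro tendsto_intros lim)
    moreover note eventually_at_right_unit
    then have "\<forall>\<^sub>F \<epsilon> in at_right 0. h x + (1/(2*pi)) *\<^sub>R (LINT t:{0..pi}|lborel. poisson (1 - \<epsilon>) t *\<^sub>R k t)
        = conv (poisson (1 - \<epsilon>)) h x"
      by eventually_elim (simp add: eq)
    ultimately show "((\<lambda>\<epsilon>. conv (poisson (1 - \<epsilon>)) h x) \<longlongrightarrow> h x) (at_right 0)"
      by (simp add: tendsto_cong)
  qed
qed


section \<open>The principal value of the conjugate function\<close>

definition trunc_cot :: "real \<Rightarrow> real \<Rightarrow> real" where
  "trunc_cot \<epsilon> t = (if \<epsilon> \<le> \<bar>t\<bar> \<and> \<bar>t\<bar> \<le> pi then cot (t / 2) else 0)"

lemma trunc_cot_measurable [measurable]: "trunc_cot \<epsilon> \<in> borel_measurable borel"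
proof -
  have "trunc_cot \<epsilon> = (\<lambda>t. if \<epsilon> \<le> \<bar>t\<bar> \<and> \<bar>t\<bar> \<le> pi then cos (t / 2) / sin (t / 2) else 0)"
    by (simp add: trunc_cot_def cot_def fun_eq_iff)
  then show ?thesis by simp
qed

lemma trunc_cot_uminus [simp]: "trunc_cot \<epsilon> (- t) = - trunc_cot \<epsilon> t"
  by (simp add: trunc_cot_def cot_def)

lemma abs_cot_half_le:
  assumes "0 < \<bar>t\<bar>" "\<bar>t\<bar> \<le> pi"
  shows "\<bar>cot (t / 2)\<bar> \<le> 2 / \<bar>t\<bar>"
proof (cases "\<bar>t\<bar> = pi")
  case True
  then have "cot (t / 2) = 0" by (auto simp: cot_def abs_if split: if_splits)
      (metis cos_minus cos_pi_half minus_divide_left)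
  then show ?thesis by simp
next
  case False
  have "\<bar>t / 2\<bar> \<le> \<bar>tan (t / 2)\<bar>" using assms False by (intro abs_tan_ge) auto
  then have "inverse \<bar>tan (t / 2)\<bar> \<le> inverse \<bar>t / 2\<bar>" using assms by (intro le_imp_inverse_le) auto
  then show ?thesis by (simp add: cot_def tan_def divide_simps split: if_splits)
qed

lemma trunc_cot_bounded:
  assumes "0 < \<epsilon>"
  shows "\<bar>trunc_cot \<epsilon> t\<bar> \<le> 2 / \<epsilon>"
proof (cases "\<epsilon> \<le> \<bar>t\<bar> \<and> \<bar>t\<bar> \<le> pi")
  case True
  have "\<bar>cot (t / 2)\<bar> \<le> 2 / \<bar>t\<bar>" using True assms by (intro abs_cot_half_le) auto
  also have "\<dots> \<le> 2 / \<epsilon>" using True assms by (intro divide_left_mono) auto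
  finally show ?thesis using True by (simp add: trunc_cot_def)
qed (use assms in \<open>auto simp: trunc_cot_def\<close>)

text \<open>
  For \<open>\<epsilon> \<le> \<bar>t\<bar>\<close> the difference is exactly \<open>\<epsilon>\<^sup>2 * cot (t / 2) / poisson_den r t\<close> up to sign,
  and \<open>\<bar>cot (t / 2)\<bar> \<le> 2 / \<epsilon>\<close>; for \<open>\<bar>t\<bar> < \<epsilon>\<close> the numerator of the conjugate kernel is small
  because \<open>\<bar>sin t\<bar> \<le> \<bar>t\<bar>\<close>.
\<close>

lemma conj_poisson_minus_trunc_cot:
  assumes \<epsilon>: "0 < \<epsilon>" "\<epsilon> < 1" and t: "\<bar>t\<bar> \<le> pi"
  shows "\<bar>conj_poisson (1 - \<epsilon>) t - trunc_cot \<epsilon> t\<bar> \<le> 2 * poisson (1 - \<epsilon>) t"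
proof -
  define r where "r = 1 - \<epsilon>"
  have r: "0 < r" "r < 1" and \<epsilon>r: "\<epsilon> = 1 - r" using \<epsilon> by (auto simp: r_def)
  let ?D = "poisson_den r t"
  have D: "0 < ?D" using poisson_den_pos[OF r] .
  show ?thesis
  proof (cases "\<epsilon> \<le> \<bar>t\<bar>")
    case True
    then have t0: "\<bar>t\<bar> > 0" using \<epsilon> by linarith
    have s0: "sin (t / 2) \<noteq> 0"
    proof
      assume "sin (t / 2) = 0"
      moreover have "\<bar>t / 2\<bar> = \<bar>t\<bar> / 2" by simp
      then have "\<bar>t / 2\<bar> < pi" using t pi_gt_zero by linarith
      ultimately show False using t0 sin_eq_0_pi[of "t/2"] by (simp add: abs_less_iff)
    qed
    define S C where "S = sin (t / 2)" and "C = cos (t / 2)"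
    have SC: "S\<^sup>2 + C\<^sup>2 = 1" by (simp add: S_def C_def)
    have st: "sin t = 2 * S * C" using sin_double[of "t/2"] by (simp add: S_def C_def)
    have ct: "cos t = 1 - 2 * S\<^sup>2" using cos_double_sin[of "t/2"] by (simp add: S_def)
    have Dd: "?D = (1 - r)\<^sup>2 + 4 * r * S\<^sup>2" by (simp add: poisson_den_alt ct)
    have "conj_poisson r t - cot (t / 2) = - (1 - r)\<^sup>2 * cot (t / 2) / ?D"
    proof -
      have "(conj_poisson r t - cot (t / 2)) * ?D = 2 * r * sin t - cot (t / 2) * ?D"
        using D by (simp add: conj_poisson_def left_diff_distrib)
      also have "\<dots> = - (1 - r)\<^sup>2 * cot (t / 2)"
        using s0 unfolding cot_def S_def[symmetric] C_def[symmetric] st Dd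
        by (simp add: field_simps power2_eq_square)
      finally have "(conj_poisson r t - cot (t / 2)) * ?D = - (1 - r)\<^sup>2 * cot (t / 2)" .
      moreover have "?D \<noteq> 0" using D by simp
      ultimately show ?thesis by (subst nonzero_eq_divide_eq)
    qed
    then have "\<bar>conj_poisson r t - cot (t / 2)\<bar> = (1 - r)\<^sup>2 * \<bar>cot (t / 2)\<bar> / ?D"
      using D by (simp add: abs_mult abs_divide)
    also have "\<dots> \<le> (1 - r)\<^sup>2 * (2 / (1 - r)) / ?D"
    proof -
      have "\<bar>cot (t / 2)\<bar> \<le> 2 / \<bar>t\<bar>" using abs_cot_half_le t0 t by blast
      also have "\<dots> \<le> 2 / (1 - r)" using True r by (intro divide_left_mono) (auto simp: \<epsilon>r)
      finally show ?thesis using D by (intro divide_right_mono mult_left_mono) auto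
    qed
    also have "\<dots> = 2 * (1 - r) / ?D" using r by (simp add: power2_eq_square)
    also have "\<dots> \<le> 2 * ((1 - r\<^sup>2) / ?D)"
    proof -
      have "r\<^sup>2 \<le> r" using r by (simp add: power2_eq_square)
      then show ?thesis using D by (simp add: divide_right_mono)
    qed
    finally show ?thesis using True t by (simp add: trunc_cot_def poisson_def r_def)
  next
    case False
    have "\<bar>sin t\<bar> \<le> 1 - r" using abs_sin_x_le_abs_x[of t] False \<epsilon>r by linarith
    then have "\<bar>2 * r * sin t\<bar> \<le> 2 * 1 * (1 - r)" 
      unfolding abs_mult using r by (intro mult_mono) auto
    also have "\<dots> \<le> 2 * (1 - r\<^sup>2)" using r by (simp add: power2_eq_square)
    finally have "\<bar>conj_poisson r t\<bar> \<le> 2 * (1 - r\<^sup>2) / ?D"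
      unfolding conj_poisson_def abs_divide using D by (simp add: divide_right_mono)
    then show ?thesis using False by (simp add: trunc_cot_def poisson_def r_def)
  qed
qed

text \<open>
  Fatou's theorem for the functions \<open>norm (f - q)\<close>, with \<open>q\<close> in a countable dense set, yields
  one null set for all \<open>q\<close>. Outside it, choosing \<open>q\<close> close to \<open>f x\<close> gives the claim.
\<close>

lemma AE_poisson_lebesgue_point:
  fixes f :: "real \<Rightarrow> complex"
  assumes f[measurable]: "f \<in> borel_measurable borel" and per: "periodic f" and int: "integrable circle f"
  shows "AE x in lborel. ((\<lambda>\<epsilon>. \<integral>t. poisson (1 - \<epsilon>) t * norm (f (x - t) - f x) \<partial>circle) \<longlongrightarrow> 0) (at_right 0)"
proof -
  obtain S :: "complex set" where S: "countable S" "\<And>X. open X \<Longrightarrow> X \<noteq> {} \<Longrightarrow> \<exists>d\<in>S. d \<in> X"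
    using countable_dense_exists by metis
  have "AE x in lborel. \<forall>q\<in>S. ((\<lambda>\<epsilon>. \<integral>t. of_real (poisson (1 - \<epsilon>) t) * complex_of_real (norm (f (x - t) - q)) \<partial>circle)
      \<longlongrightarrow> complex_of_real (norm (f x - q))) (at_right 0)"
  proof (subst AE_ball_countable[OF S(1)], rule ballI, rule poisson_AE_tendsto)
    fix q
    show "periodic (\<lambda>t. complex_of_real (norm (f t - q)))" using per by (simp add: periodic_def)
    show "integrable circle (\<lambda>t. complex_of_real (norm (f t - q)))"
      using int by (simp add: complex_of_real_integrable_eq)
  qed measurable
  then show ?thesis
  proof eventually_elim
    case (elim x)
    show ?case
    proof (rule tendstoI)
      fix e :: real assume "0 < e"
      then obtain q where q: "q \<in> S" "q \<in> ball (f x) (e / 3)" using S(2)[of "ball (f x) (e/3)"] by auto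
      then have qx: "norm (f x - q) < e / 3" by (simp add: dist_norm)
      have "((\<lambda>\<epsilon>. complex_of_real (\<integral>t. poisson (1 - \<epsilon>) t * norm (f (x - t) - q) \<partial>circle))
          \<longlongrightarrow> complex_of_real (norm (f x - q))) (at_right 0)"
        using bspec[OF elim q(1)] by (simp flip: of_real_mult)
      then have "((\<lambda>\<epsilon>. \<integral>t. poisson (1 - \<epsilon>) t * norm (f (x - t) - q) \<partial>circle) \<longlongrightarrow> norm (f x - q)) (at_right 0)"
        by (simp only: tendsto_of_real_iff)
      then have ev: "\<forall>\<^sub>F \<epsilon> in at_right 0. (\<integral>t. poisson (1 - \<epsilon>) t * norm (f (x - t) - q) \<partial>circle) < e / 3"
        using qx by (rule order_tendstoD)
      have ev1: "\<forall>\<^sub>F \<epsilon> in at_right (0::real). 0 < \<epsilon> \<and> \<epsilon> < 1"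
        by (auto simp: eventually_at_right_field intro!: exI[of _ 1])
      from ev ev1 show "\<forall>\<^sub>F \<epsilon> in at_right 0. dist (\<integral>t. poisson (1 - \<epsilon>) t * norm (f (x - t) - f x) \<partial>circle) 0 < e"
      proof eventually_elim
        case (elim \<epsilon>)
        define r where "r = 1 - \<epsilon>"
        have r: "0 < r" "r < 1" using elim by (auto simp: r_def)
        have fi: "integrable circle (\<lambda>t. f (x - t))" using int integrable_circle_reflect[OF f per] by simp
        have Pb: "norm (poisson r t) \<le> 1 / (1-r)\<^sup>2" for t using poisson_bounded(1)[OF r] by simp
        have Pi: "integrable circle (poisson r)" by (rule integrable_circle_bounded[OF _ Pb]) measurable
        have Pfi: "integrable circle (\<lambda>t. poisson r t * norm (f (x - t) - q))" for q
        proof -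
          have "integrable circle (\<lambda>t. norm (of_real (poisson r t) * (f (x - t) - q)))"
            by (rule integrable_norm, rule integrable_circle_mult_bounded(1)[OF poisson_measurable poisson_bounded(1)[OF r]])
              (use fi in simp)
          then show ?thesis using poisson_nonneg[OF r] by (simp add: norm_mult)
        qed
        have "(\<integral>t. poisson r t * norm (f (x - t) - f x) \<partial>circle)
            \<le> (\<integral>t. poisson r t * norm (f (x - t) - q) + poisson r t * norm (f x - q) \<partial>circle)"
        proof (rule integral_mono)
          show "integrable circle (\<lambda>t. poisson r t * norm (f (x - t) - q) + poisson r t * norm (f x - q))"
            using Pfi Pi by simp
          fix t
          have "norm (f (x - t) - f x) \<le> norm (f (x - t) - q) + norm (f x - q)"
            by (metis dist_commute dist_norm dist_triangle)
          then have "poisson r t * norm (f (x - t) - f x) \<le> poisson r t * (norm (f (x - t) - q) + norm (f x - q))"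
            by (rule mult_left_mono) (rule poisson_nonneg[OF r])
          then show "poisson r t * norm (f (x - t) - f x)
              \<le> poisson r t * norm (f (x - t) - q) + poisson r t * norm (f x - q)" by (simp add: distrib_left)
        qed (rule Pfi)
        also have "\<dots> = (\<integral>t. poisson r t * norm (f (x - t) - q) \<partial>circle) + norm (f x - q)"
          using Pfi Pi integral_poisson[OF r] by simp
        also have "\<dots> < e" using elim qx \<open>0 < e\<close> by (simp add: r_def)
        finally show ?case
          using poisson_nonneg[OF r] by (simp add: r_def Bochner_Integration.integral_nonneg)
      qed
    qed
  qed
qed

text \<open>
  Stated through harmonic extensions instead of Fourier coefficients: the two sides are the
  conjugate of the extension of \<open>f\<close> and the extension of \<open>g\<close>. In this form the relation passes
  to \<open>L\<^sup>1\<close> limits pointwise in \<open>r\<close> and \<open>x\<close>.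
\<close>

definition conjugate_function :: "(real \<Rightarrow> complex) \<Rightarrow> (real \<Rightarrow> complex) \<Rightarrow> bool" where
  "conjugate_function f g \<longleftrightarrow>
     (\<forall>r x. 0 < r \<longrightarrow> r < 1 \<longrightarrow> conv (conj_poisson r) f x = conv (poisson r) g x)"

text \<open>
  The truncated cotangent and the conjugate Poisson kernel differ by an odd function
  dominated by twice the Poisson kernel. Oddness allows \<open>f x\<close> to be subtracted from \<open>f (x -
  t)\<close>, and the rest tends to 0 at almost every \<open>x\<close>.
\<close>

lemma principal_value_AE_eq:
  fixes f g :: "real \<Rightarrow> complex"
  assumes f[measurable]: "f \<in> borel_measurable borel" and perf: "periodic f" and intf: "integrable circle f"
    and g[measurable]: "g \<in> borel_measurable borel" and perg: "periodic g" and intg: "integrable circle g"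
    and conj: "conjugate_function f g"
  shows "AE x in lborel. ((\<lambda>\<epsilon>. conv (trunc_cot \<epsilon>) f x) \<longlongrightarrow> g x) (at_right 0)"
  using AE_poisson_lebesgue_point[OF f perf intf] poisson_AE_tendsto[OF g perg intg]
proof eventually_elim
  case (elim x)
  have fi: "integrable circle (\<lambda>t. f (x - t))" using intf integrable_circle_reflect[OF f perf] by simp
  let ?L = "\<lambda>\<epsilon>. 2 * (\<integral>t. poisson (1 - \<epsilon>) t * norm (f (x - t) - f x) \<partial>circle)"
  have bound: "norm (conv (trunc_cot \<epsilon>) f x
      - conv (poisson (1 - \<epsilon>)) g x) \<le> ?L \<epsilon>" if \<epsilon>: "0 < \<epsilon>" "\<epsilon> < 1" for \<epsilon>
  proof -
    define r where "r = 1 - \<epsilon>"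
    have r: "0 < r" "r < 1" using \<epsilon> by (auto simp: r_def)
    note mult_int = integrable_circle_mult_bounded(1)
    define k where "k = (\<lambda>t. trunc_cot \<epsilon> t - conj_poisson r t)"
    have k[measurable]: "k \<in> borel_measurable borel" unfolding k_def by measurable
    have kb: "\<bar>k t\<bar> \<le> 2 / \<epsilon> + 2 / (1 - r)\<^sup>2" for t
      using trunc_cot_bounded[OF \<epsilon>(1), of t] poisson_bounded(2)[OF r, of t] unfolding k_def by linarith
    have "(\<integral>t. complex_of_real (k (- t)) \<partial>circle) = (\<integral>t. complex_of_real (k t) \<partial>circle)"
      by (rule integral_circle_uminus) measurable
    moreover have "k (- t) = - k t" for t by (simp add: k_def)
    ultimately have k0: "(\<integral>t. complex_of_real (k t) \<partial>circle) = 0" by simp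
    have "conv (trunc_cot \<epsilon>) f x
      - conv (poisson r) g x
      = conv (trunc_cot \<epsilon>) f x - conv (conj_poisson r) f x"
      by (simp only: conj[unfolded conjugate_function_def, rule_format, OF r])
    also have "\<dots> = conv k f x"
      unfolding k_def
      by (rule conv_diff_kernel[symmetric])
        (rule conv_integrable[OF trunc_cot_measurable trunc_cot_bounded[OF \<epsilon>(1)] f perf intf]
          conv_integrable[OF conj_poisson_measurable poisson_bounded(2)[OF r] f perf intf])+
    also have "\<dots> = (\<integral>t. of_real (k t) * f (x - t) \<partial>circle) - (\<integral>t. of_real (k t) * f x \<partial>circle)"
      using k0 by simp
    also have "\<dots> = (\<integral>t. of_real (k t) * f (x - t) - of_real (k t) * f x \<partial>circle)"
      by (rule Bochner_Integration.integral_diff[symmetric]) (rule mult_int[OF k kb], simp add: fi)+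
    also have "\<dots> = (\<integral>t. of_real (k t) * (f (x - t) - f x) \<partial>circle)" by (simp add: right_diff_distrib)
    also have "norm \<dots> \<le> (\<integral>t. 2 * (poisson r t * norm (f (x - t) - f x)) \<partial>circle)"
    proof (rule integral_circle_bound)
      have "integrable circle (\<lambda>t. norm (of_real (poisson r t) * (f (x - t) - f x)))"
        by (rule integrable_norm, rule mult_int[OF _ poisson_bounded(1)[OF r]]) (auto simp: fi)
      then show "integrable circle (\<lambda>t. 2 * (poisson r t * norm (f (x - t) - f x)))"
        using poisson_nonneg[OF r] by (simp add: norm_mult)
      fix t assume "\<bar>t\<bar> \<le> pi"
      then have "\<bar>k t\<bar> \<le> 2 * poisson r t"
        using conj_poisson_minus_trunc_cot[OF \<epsilon>, of t] unfolding k_def r_def by linarith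
      then show "norm (of_real (k t) * (f (x - t) - f x)) \<le> 2 * (poisson r t * norm (f (x - t) - f x))"
        using mult_right_mono[of "\<bar>k t\<bar>" "2 * poisson r t" "norm (f (x - t) - f x)"] by (simp add: norm_mult)
    qed measurable
    finally show ?thesis by (simp add: r_def)
  qed
  have "(?L \<longlongrightarrow> 2 * 0) (at_right 0)" by (intro tendsto_intros elim(1))
  moreover have ev1: "\<forall>\<^sub>F \<epsilon> in at_right (0::real). 0 < \<epsilon> \<and> \<epsilon> < 1"
    by (auto simp: eventually_at_right_field intro!: exI[of _ 1])
  then have "\<forall>\<^sub>F \<epsilon> in at_right 0. norm (conv (trunc_cot \<epsilon>) f x
      - conv (poisson (1 - \<epsilon>)) g x) \<le> ?L \<epsilon>"
    by eventually_elim (rule bound; blast)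
  ultimately have "((\<lambda>\<epsilon>. conv (trunc_cot \<epsilon>) f x
      - conv (poisson (1 - \<epsilon>)) g x) \<longlongrightarrow> 0) (at_right 0)"
    using Lim_null_comparison[where g = ?L] by auto
  from tendsto_add[OF this elim(2)] show ?case by simp
qed

section \<open>Young functions and their modulars\<close>

definition modular :: "(real \<Rightarrow> real) \<Rightarrow> real \<Rightarrow> (real \<Rightarrow> complex) \<Rightarrow> ennreal" where
  "modular \<phi> s f = (\<integral>\<^sup>+x. ennreal (\<phi> (s * norm (f x))) \<partial>circle)"

text \<open>
  The part of the definition of an \<open>N\<close>-function on which convexity rests, with the density as
  a parameter because it provides the subgradients of \<open>\<phi>\<close>. The values of \<open>\<phi>\<close> at negative
  arguments are arbitrary.
\<close>

locale young_function =
  fixes \<phi> p :: "real \<Rightarrow> real"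
  assumes p_nonneg: "0 \<le> x \<Longrightarrow> 0 \<le> p x"
    and p_mono: "mono_on {0..} p"
    and p_pos: "0 < x \<Longrightarrow> 0 < p x"
    and phi_eq: "0 \<le> t \<Longrightarrow> \<phi> t = integral {0..t} p"
begin

lemma p_integrable: "0 \<le> a \<Longrightarrow> p integrable_on {a..b}"
  by (rule integrable_on_lebesgue_on[OF integrable_mono_on[OF mono_on_subset[OF p_mono]]]) auto

lemma phi_zero [simp]: "\<phi> 0 = 0"
  using phi_eq[of 0] by simp

lemma phi_diff: "0 \<le> a \<Longrightarrow> a \<le> b \<Longrightarrow> \<phi> b - \<phi> a = integral {a..b} p"
  using Henstock_Kurzweil_Integration.integral_combine[of 0 a b p] p_integrable[of 0 b] phi_eq by simp

lemma phi_diff_bounds: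
  assumes "0 \<le> a" "a \<le> b"
  shows "p a * (b - a) \<le> \<phi> b - \<phi> a" "\<phi> b - \<phi> a \<le> p b * (b - a)"
proof -
  have m: "p a \<le> p x" "p x \<le> p b" if "x \<in> {a..b}" for x
    using p_mono that assms by (auto simp: mono_on_def)
  have "integral {a..b} (\<lambda>_. p a) \<le> integral {a..b} p" "integral {a..b} p \<le> integral {a..b} (\<lambda>_. p b)"
    using m p_integrable[OF assms(1)] by (intro integral_le; force)+
  then show "p a * (b - a) \<le> \<phi> b - \<phi> a" "\<phi> b - \<phi> a \<le> p b * (b - a)"
    using assms by (simp_all add: phi_diff mult.commute)
qed

lemma phi_subgradient:
  assumes "0 \<le> s" "0 \<le> t"
  shows "\<phi> t + p t * (s - t) \<le> \<phi> s"
  using phi_diff_bounds(1)[of t s] phi_diff_bounds(2)[of s t] assms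
  by (cases "t \<le> s") (auto simp: algebra_simps)

lemma phi_mono: "0 \<le> s \<Longrightarrow> s \<le> t \<Longrightarrow> \<phi> s \<le> \<phi> t"
  using phi_diff_bounds(1)[of s t] p_nonneg[of s] by (smt (verit) mult_nonneg_nonneg)

lemma phi_nonneg: "0 \<le> s \<Longrightarrow> 0 \<le> \<phi> s"
  using phi_mono[of 0 s] by simp

lemma phi_le_p: "0 \<le> t \<Longrightarrow> \<phi> t \<le> p t * t"
  using phi_diff_bounds(2)[of 0 t] by simp

lemma phi_continuous: "continuous_on UNIV (\<lambda>t. \<phi> \<bar>t\<bar>)"
proof -
  have "isCont (\<lambda>t. \<phi> \<bar>t\<bar>) t" for t
  proof -
    define K where "K = p (\<bar>t\<bar> + 1)"
    have lip: "\<bar>\<phi> a - \<phi> b\<bar> \<le> K * \<bar>a - b\<bar>" if "0 \<le> a" "0 \<le> b" "a \<le> \<bar>t\<bar> + 1" "b \<le> \<bar>t\<bar> + 1" for a b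
    proof -
      have *: "\<bar>\<phi> a - \<phi> b\<bar> \<le> K * \<bar>a - b\<bar>" if "0 \<le> a" "a \<le> b" "b \<le> \<bar>t\<bar> + 1" for a b
      proof -
        have "p b \<le> K" using p_mono that by (auto simp: K_def mono_on_def)
        then have "p b * (b - a) \<le> K * (b - a)" using that by (intro mult_right_mono) auto
        then show ?thesis using phi_diff_bounds(2)[of a b] phi_mono[of a b] that by simp
      qed
      then show ?thesis using that *[of a b] *[of b a] by (cases "a \<le> b") (auto simp: abs_minus_commute)
    qed
    have "((\<lambda>s. \<phi> \<bar>s\<bar> - \<phi> \<bar>t\<bar>) \<longlongrightarrow> 0) (at t)"
    proof (rule Lim_null_comparison)
      have "\<forall>\<^sub>F s in at t. dist s t < 1" by (auto simp: eventually_at intro!: exI[of _ 1])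
      then show "\<forall>\<^sub>F s in at t. norm (\<phi> \<bar>s\<bar> - \<phi> \<bar>t\<bar>) \<le> K * \<bar>\<bar>s\<bar> - \<bar>t\<bar>\<bar>"
        by eventually_elim (use lip in \<open>auto simp: dist_real_def\<close>)
      have "((\<lambda>s. K * \<bar>\<bar>s\<bar> - \<bar>t\<bar>\<bar>) \<longlongrightarrow> K * \<bar>\<bar>t\<bar> - \<bar>t\<bar>\<bar>) (at t)" by (intro tendsto_intros)
      then show "((\<lambda>s. K * \<bar>\<bar>s\<bar> - \<bar>t\<bar>\<bar>) \<longlongrightarrow> 0) (at t)" by simp
    qed
    then show ?thesis unfolding isCont_def by (simp add: LIM_zero_iff)
  qed
  then show ?thesis by (simp add: continuous_on_eq_continuous_at)
qed

lemma phi_norm_measurable [measurable (raw)]: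
  fixes f :: "'b \<Rightarrow> 'c::real_normed_vector"
  assumes [measurable]: "f \<in> borel_measurable M" and "0 \<le> s"
  shows "(\<lambda>x. \<phi> (s * norm (f x))) \<in> borel_measurable M"
proof -
  have [measurable]: "(\<lambda>t. \<phi> \<bar>t\<bar>) \<in> borel_measurable borel"
    by (rule borel_measurable_continuous_onI) (rule phi_continuous)
  have "(\<lambda>x. \<phi> \<bar>s * norm (f x)\<bar>) \<in> borel_measurable M" by measurable
  then show ?thesis using assms(2) by simp
qed

lemma phi_tendsto:
  assumes "(u \<longlongrightarrow> v) F" "\<And>i. 0 \<le> u i" "0 \<le> v"
  shows "((\<lambda>i. \<phi> (u i)) \<longlongrightarrow> \<phi> v) F"
proof -
  have "((\<lambda>i. \<phi> \<bar>u i\<bar>) \<longlongrightarrow> \<phi> \<bar>v\<bar>) F"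
    using continuous_on_tendsto_compose[OF phi_continuous assms(1)] by simp
  then show ?thesis using assms by simp
qed

lemma phi_midpoint:
  assumes "0 \<le> a" "0 \<le> b"
  shows "\<phi> ((a + b) / 2) \<le> \<phi> a / 2 + \<phi> b / 2"
  using phi_subgradient[of a "(a+b)/2"] phi_subgradient[of b "(a+b)/2"] assms
  by (simp add: field_simps)

lemma phi_half: "0 \<le> a \<Longrightarrow> \<phi> (a / 2) \<le> \<phi> a / 2"
  using phi_midpoint[of a 0] by simp

text \<open>
  The missing weight can be placed at 0, where \<open>\<phi>\<close> vanishes, so this is Jensen's inequality
  for a finite convex combination.
\<close>

lemma phi_sum_le:
  assumes "finite K" and w: "\<And>k. k \<in> K \<Longrightarrow> 0 \<le> w k" "(\<Sum>k\<in>K. w k) \<le> 1"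
    and s: "\<And>k. k \<in> K \<Longrightarrow> 0 \<le> s k"
  shows "\<phi> (\<Sum>k\<in>K. w k * s k) \<le> (\<Sum>k\<in>K. w k * \<phi> (s k))"
proof -
  define T where "T = (\<Sum>k\<in>K. w k * s k)"
  define W where "W = (\<Sum>k\<in>K. w k)"
  have T0: "0 \<le> T" unfolding T_def using w s by (intro sum_nonneg) auto
  have le: "(\<Sum>k\<in>K. w k * (\<phi> T + p T * (s k - T))) \<le> (\<Sum>k\<in>K. w k * \<phi> (s k))"
    using w s T0 by (intro sum_mono mult_left_mono phi_subgradient) auto
  have sm: "(\<Sum>k\<in>K. w k * (A + B * (s k - X))) = W * A + B * (T - W * X)" for A B X
    unfolding W_def T_def by (simp add: algebra_simps sum.distrib sum_subtractf sum_distrib_right sum_distrib_left)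
  have "(\<Sum>k\<in>K. w k * (\<phi> T + p T * (s k - T))) = W * \<phi> T + (1 - W) * (p T * T)"
    unfolding sm by (simp add: algebra_simps)
  with le have "W * \<phi> T + (1 - W) * (p T * T) \<le> (\<Sum>k\<in>K. w k * \<phi> (s k))" by simp
  moreover have "(1 - W) * \<phi> T \<le> (1 - W) * (p T * T)"
    using w phi_le_p[OF T0] by (intro mult_left_mono) (auto simp: W_def)
  ultimately show ?thesis unfolding T_def[symmetric] by (simp add: algebra_simps)
qed

lemma le_one_plus_phi: "0 \<le> s \<Longrightarrow> s \<le> 1 + \<phi> s / p 1"
  using phi_subgradient[of s 1] phi_nonneg[of 1] p_pos[of 1] by (simp add: field_simps)

lemma modular_mono:
  assumes "0 \<le> s" "0 \<le> s'" "\<And>x. s * norm (f x) \<le> s' * norm (g x)"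
  shows "modular \<phi> s f \<le> modular \<phi> s' g"
  unfolding modular_def using assms
  by (intro nn_integral_mono ennreal_leI phi_mono) auto

lemma modular_mono_scale: "0 \<le> s \<Longrightarrow> s \<le> s' \<Longrightarrow> modular \<phi> s f \<le> modular \<phi> s' f"
  by (rule modular_mono) (auto intro: mult_right_mono)

text \<open>
  This takes the place of the triangle inequality for the Luxemburg norm.
\<close>

lemma modular_midpoint:
  assumes [measurable]: "f \<in> borel_measurable borel" "g \<in> borel_measurable borel" and s: "0 \<le> s"
    and h: "\<And>x. norm (h x) \<le> norm (f x) + norm (g x)"
  shows "modular \<phi> (s / 2) h \<le> (modular \<phi> s f + modular \<phi> s g) / 2"
proof -
  have "modular \<phi> (s / 2) h \<le> (\<integral>\<^sup>+x. (ennreal (\<phi> (s * norm (f x))) + ennreal (\<phi> (s * norm (g x)))) / 2 \<partial>circle)"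
    unfolding modular_def
  proof (intro nn_integral_mono)
    fix x
    have "s / 2 * norm (h x) \<le> (s * norm (f x) + s * norm (g x)) / 2"
      using mult_left_mono[OF h[of x] s] by (simp add: algebra_simps)
    then have "\<phi> (s / 2 * norm (h x)) \<le> \<phi> ((s * norm (f x) + s * norm (g x)) / 2)"
      using s by (intro phi_mono) auto
    also have "\<dots> \<le> \<phi> (s * norm (f x)) / 2 + \<phi> (s * norm (g x)) / 2" using s by (intro phi_midpoint) auto
    finally have "ennreal (\<phi> (s / 2 * norm (h x))) \<le> ennreal ((\<phi> (s * norm (f x)) + \<phi> (s * norm (g x))) / 2)"
      by (intro ennreal_leI) (simp add: add_divide_distrib)
    also have "\<dots> = (ennreal (\<phi> (s * norm (f x))) + ennreal (\<phi> (s * norm (g x)))) / 2"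
      using s phi_nonneg by (subst divide_ennreal[symmetric]) (auto simp: ennreal_plus)
    finally show "ennreal (\<phi> (s / 2 * norm (h x))) \<le> (ennreal (\<phi> (s * norm (f x))) + ennreal (\<phi> (s * norm (g x)))) / 2" .
  qed
  also have "\<dots> = (modular \<phi> s f + modular \<phi> s g) / 2"
    using s unfolding modular_def by (subst nn_integral_divide) (auto simp: nn_integral_add)
  finally show ?thesis .
qed

lemma modular_add_le_1:
  assumes "f \<in> borel_measurable borel" "g \<in> borel_measurable borel" and s: "0 \<le> s"
    and "\<And>x. norm (h x) \<le> norm (f x) + norm (g x)"
    and "modular \<phi> s f \<le> 1" "modular \<phi> s g \<le> 1"
  shows "modular \<phi> (s / 2) h \<le> 1"
proof -
  have "modular \<phi> (s / 2) h \<le> (modular \<phi> s f + modular \<phi> s g) / 2" by (rule modular_midpoint) (use assms in auto)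
  also have "\<dots> \<le> (1 + 1) / 2" using assms by (intro divide_right_mono_ennreal add_mono) auto
  also have "\<dots> = 1" by (simp add: one_add_one)
  finally show ?thesis .
qed

lemma modular_shift:
  assumes [measurable]: "f \<in> borel_measurable borel" and "periodic f" and "0 \<le> s"
  shows "modular \<phi> s (\<lambda>x. f (x + c)) = modular \<phi> s f"
  unfolding modular_def using assms nn_integral_circle_shift[of "\<lambda>x. ennreal (\<phi> (s * norm (f x)))" c]
  by (auto simp: periodic_def)

lemma modular_uminus:
  assumes [measurable]: "f \<in> borel_measurable borel" and "0 \<le> s"
  shows "modular \<phi> s (\<lambda>x. f (- x)) = modular \<phi> s f"
  unfolding modular_def using assms nn_integral_circle_uminus[of "\<lambda>x. ennreal (\<phi> (s * norm (f x)))"] by auto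

text \<open>
  The subgradient at 1 bounds \<open>s\<close> by an affine function of \<open>\<phi> s\<close>, so small norm in the Orlicz
  space forces small norm in \<open>L\<^sup>1\<close>.
\<close>

lemma modular_L1:
  assumes [measurable]: "f \<in> borel_measurable borel" and s: "0 < s" and M: "modular \<phi> s f \<le> 1"
  shows "integrable circle f" "(\<integral>x. norm (f x) \<partial>circle) \<le> (1 + 1 / p 1) / s"
proof -
  have p1: "0 < p 1" by (rule p_pos) simp
  have enn: "ennreal (1 / s) * (1 + ennreal (1 / p 1) * ennreal X) = ennreal ((1 / s) * (1 + (1 / p 1) * X))"
    if "0 \<le> X" for X
  proof -
    have "ennreal (1 / p 1) * ennreal X = ennreal ((1 / p 1) * X)"
      by (rule ennreal_mult[symmetric]) (use p1 that in auto)
    moreover have "1 + ennreal ((1 / p 1) * X) = ennreal (1 + (1 / p 1) * X)"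
      by (subst ennreal_plus) (use p1 that in auto)
    moreover have "ennreal (1 / s) * ennreal (1 + (1 / p 1) * X) = ennreal ((1 / s) * (1 + (1 / p 1) * X))"
      by (rule ennreal_mult[symmetric]) (use p1 s that in auto)
    ultimately show ?thesis by (simp only:)
  qed
  have "(\<integral>\<^sup>+x. ennreal (norm (f x)) \<partial>circle)
      \<le> (\<integral>\<^sup>+x. ennreal (1 / s) * (1 + ennreal (1 / p 1) * ennreal (\<phi> (s * norm (f x)))) \<partial>circle)"
  proof (intro nn_integral_mono)
    fix x
    have "s * norm (f x) \<le> 1 + \<phi> (s * norm (f x)) / p 1" using s by (intro le_one_plus_phi) auto
    then have "norm (f x) \<le> (1 / s) * (1 + (1 / p 1) * \<phi> (s * norm (f x)))" using s by (simp add: field_simps)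
    then have "ennreal (norm (f x)) \<le> ennreal ((1 / s) * (1 + (1 / p 1) * \<phi> (s * norm (f x))))" by (rule ennreal_leI)
    also have "\<dots> = ennreal (1 / s) * (1 + ennreal (1 / p 1) * ennreal (\<phi> (s * norm (f x))))"
      by (rule enn[symmetric]) (use s phi_nonneg in simp)
    finally show "ennreal (norm (f x)) \<le> \<dots>" .
  qed
  also have "\<dots> = ennreal (1 / s) * (1 + ennreal (1 / p 1) * modular \<phi> s f)"
    unfolding modular_def using s
    by (simp add: nn_integral_cmult nn_integral_add emeasure_circle_UNIV)
  also have "\<dots> \<le> ennreal (1 / s) * (1 + ennreal (1 / p 1) * 1)"
    using M by (intro mult_left_mono add_left_mono) auto
  also have "\<dots> = ennreal ((1 + 1 / p 1) / s)"
    using enn[of 1] by simp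
  finally have *: "(\<integral>\<^sup>+x. ennreal (norm (f x)) \<partial>circle) \<le> ennreal ((1 + 1 / p 1) / s)" .
  then show int: "integrable circle f" by (intro integrableI_bounded) (auto simp: less_top[symmetric] top_unique)
  show "(\<integral>x. norm (f x) \<partial>circle) \<le> (1 + 1 / p 1) / s"
    using * int s p1 by (subst (asm) nn_integral_eq_integral) (auto simp: ennreal_le_iff)
qed

lemma Lphi_constraint_eq_modular:
  assumes [measurable]: "g \<in> borel_measurable borel" and ae: "AE x in lborel. f x = g x" and "0 < l"
  shows "ennreal (1 / (2 * pi)) * (\<integral>\<^sup>+ x \<in> {-pi..pi}. ennreal (\<phi> (cmod (f x) / l)) \<partial>lebesgue) = modular \<phi> (1 / l) g"
proof -
  have "(\<integral>\<^sup>+ x \<in> {-pi..pi}. ennreal (\<phi> (cmod (f x) / l)) \<partial>lebesgue)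
      = (\<integral>\<^sup>+ x. ennreal (\<phi> (cmod (f x) / l)) * indicator {-pi..pi} x \<partial>lborel)"
    by (rule nn_integral_completion)
  also have "\<dots> = (\<integral>\<^sup>+ x. ennreal (\<phi> ((1 / l) * cmod (g x))) * indicator {-pi..pi} x \<partial>lborel)"
    by (rule nn_integral_cong_AE) (use ae in eventually_elim, simp)
  finally show ?thesis unfolding modular_def
    using phi_norm_measurable[OF assms(1), of "1 / l"] \<open>0 < l\<close> by (subst nn_integral_circle) auto
qed

text \<open>
  This lemma and the next one translate between norm and modular. Strictness in the second
  one avoids the question whether the infimum is attained.
\<close>

lemma Lphi_norm_leI:
  assumes "g \<in> borel_measurable borel" "AE x in lborel. f x = g x" "0 < l" "modular \<phi> (1 / l) g \<le> 1"
  shows "Lphi_norm \<phi> f \<le> ennreal l"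
  unfolding Lphi_norm_def by (rule INF_lower) (use assms in \<open>auto simp: Lphi_constraint_eq_modular\<close>)

lemma modular_le_1I:
  assumes g: "g \<in> borel_measurable borel" and ae: "AE x in lborel. f x = g x"
    and l: "0 < l" "Lphi_norm \<phi> f < ennreal l"
  shows "modular \<phi> (1 / l) g \<le> 1"
proof -
  from l(2) obtain l' where l': "0 < l'" "modular \<phi> (1 / l') g \<le> 1" "ennreal l' < ennreal l"
    unfolding Lphi_norm_def INF_less_iff using Lphi_constraint_eq_modular[OF g ae] by auto
  then have "l' < l" by (simp add: ennreal_less_iff)
  have "modular \<phi> (1 / l) g \<le> modular \<phi> (1 / l') g"
    using l' \<open>l' < l\<close> by (intro modular_mono_scale) (auto simp: frac_le)
  then show ?thesis using l' by simp
qed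

end

section \<open>Borel representatives and the Hilbert transform\<close>

lemma INF_le_mult_INF:
  fixes A B :: "real set"
  assumes C: "0 < C" and AB: "\<And>l. l \<in> A \<Longrightarrow> C * l \<in> B" and pos: "\<And>l. l \<in> A \<Longrightarrow> 0 < l"
  shows "(INF l\<in>B. ennreal l) \<le> ennreal C * (INF l\<in>A. ennreal l)"
proof -
  let ?b = "INF l\<in>B. ennreal l"
  have "ennreal (1 / C) * ?b \<le> (INF l\<in>A. ennreal l)"
  proof (rule INF_greatest)
    fix l assume l: "l \<in> A"
    have "?b \<le> ennreal (C * l)" by (rule INF_lower) (rule AB[OF l])
    then have "ennreal (1 / C) * ?b \<le> ennreal (1 / C) * ennreal (C * l)" by (rule mult_left_mono) simp
    also have "\<dots> = ennreal l" using C pos[OF l] by (subst ennreal_mult[symmetric]) auto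
    finally show "ennreal (1 / C) * ?b \<le> ennreal l" .
  qed
  then have "ennreal C * (ennreal (1 / C) * ?b) \<le> ennreal C * (INF l\<in>A. ennreal l)" by (rule mult_left_mono) simp
  moreover have "ennreal C * (ennreal (1 / C) * ?b) = ?b"
    using C by (subst mult.assoc[symmetric], subst ennreal_mult[symmetric]) auto
  ultimately show ?thesis by simp
qed

lemma young_function_of_N_function:
  assumes "N_function \<phi>"
  obtains p where "young_function \<phi> p"
  using assms unfolding N_function_def young_function_def by metis

text \<open>
  Tonelli's theorem and convolutions need Borel functions, while elements of \<open>L1_circle\<close> are
  only Lebesgue measurable. The Borel representative is extended periodically from one period,
  so that the two functions agree almost everywhere on the whole line.
\<close>

lemma L1_circle_borel_representative:
  assumes "f \<in> L1_circle"
  obtains g where "g \<in> borel_measurable borel" "periodic g" "integrable circle g" "AE x in lborel. f x = g x"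
proof -
  let ?F = "\<lambda>x. indicator {-pi..pi} x *\<^sub>R f x"
  have per: "periodic f" and int: "integrable lebesgue ?F"
    using assms by (auto simp: L1_circle_def periodic_def set_integrable_def)
  have m: "(\<lambda>x. Re (?F x)) \<in> borel_measurable (completion lborel)" "(\<lambda>x. Im (?F x)) \<in> borel_measurable (completion lborel)"
    by (rule measurable_compose[OF borel_measurable_integrable[OF int]]; measurable)+
  obtain a b where [measurable]: "a \<in> borel_measurable borel" "b \<in> borel_measurable borel"
    and ab: "AE x in lborel. Re (?F x) = a x" "AE x in lborel. Im (?F x) = b x"
    using completion_ex_borel_measurable_real[OF m(1)] completion_ex_borel_measurable_real[OF m(2)] by auto
  define g where "g = (\<lambda>x. Complex (a (wrap x)) (b (wrap x)))"
  have gb[measurable]: "g \<in> borel_measurable borel"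
    unfolding g_def Complex_eq by measurable
  have perg: "periodic g" using periodic_wrap by (simp add: g_def periodic_def)
  have eq: "AE x in lborel. f x = g x"
  proof (rule AE_periodic)
    show "periodic (\<lambda>x. f x = g x)" using per perg by (simp add: periodic_def)
    show "AE x in lborel. \<bar>x\<bar> \<le> pi \<longrightarrow> f x = g x"
      using ab AE_lborel_singleton[of pi]
    proof eventually_elim
      case (elim x)
      show ?case
      proof
        assume x: "\<bar>x\<bar> \<le> pi"
        then have "wrap x = x" using elim(3) by (intro wrap_id) auto
        moreover have "indicator {-pi..pi} x = (1::real)" using x by (auto simp: indicator_def)
        ultimately show "f x = g x" using elim by (simp add: g_def complex_eq_iff)
      qed
    qed
  qed
  have "integrable circle g"
  proof -
    have "integrable lebesgue (\<lambda>x. indicator {-pi..pi} x *\<^sub>R g x)"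
    proof (rule integrable_cong_AE_imp[OF int])
      show "(\<lambda>x. indicator {-pi..pi} x *\<^sub>R g x) \<in> borel_measurable lebesgue"
        by (rule measurable_completion) simp
      show "AE x in lebesgue. ?F x = indicator {-pi..pi} x *\<^sub>R g x"
        unfolding AE_completion_iff using eq by eventually_elim simp
    qed
    then have "integrable lborel (\<lambda>x. indicator {-pi..pi} x *\<^sub>R g x)" by (subst (asm) integrable_completion) auto
    then show ?thesis by (simp add: integrable_circle set_integrable_def)
  qed
  then show thesis using that gb perg eq by blast
qed

lemma L1_circleI:
  assumes [measurable]: "g \<in> borel_measurable borel" and int: "integrable circle g"
    and per: "periodic f" and eq: "AE x in lborel. f x = g x"
  shows "f \<in> L1_circle"
proof -
  have i: "integrable lebesgue (\<lambda>x. indicator {-pi..pi} x *\<^sub>R g x)"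
    using int by (subst integrable_completion) (auto simp: integrable_circle set_integrable_def)
  have ae: "AE x in lebesgue. indicator {-pi..pi} x *\<^sub>R g x = indicator {-pi..pi} x *\<^sub>R f x"
    unfolding AE_completion_iff using eq by eventually_elim simp
  have "(\<lambda>x. indicator {-pi..pi} x *\<^sub>R f x) \<in> borel_measurable lebesgue"
    by (rule borel_measurable_AE[OF borel_measurable_integrable[OF i] ae])
  from integrable_cong_AE_imp[OF i this ae] show ?thesis
    using per by (simp add: L1_circle_def periodic_def set_integrable_def)
qed

text \<open>
  The equality holds at every \<open>x\<close>, including those where the limit does not exist: for each
  truncation the two integrals agree.
\<close>

lemma hilbert_transform_eq:
  assumes [measurable]: "g \<in> borel_measurable borel" and eq: "AE x in lborel. f x = g x"
  shows "hilbert_transform f x = Lim (at_right 0) (\<lambda>\<epsilon>. conv (trunc_cot \<epsilon>) g x)"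
proof -
  have "of_real (1 / (2 * pi)) * (LINT t : {t. \<epsilon> \<le> \<bar>t\<bar> \<and> \<bar>t\<bar> \<le> pi} | lebesgue. f (x - t) * of_real (cot (t / 2)))
      = conv (trunc_cot \<epsilon>) g x" for \<epsilon>
  proof -
    let ?L = "\<lambda>t. indicator {-pi..pi} t *\<^sub>R (of_real (trunc_cot \<epsilon> t) * g (x - t))"
    let ?R = "\<lambda>t. indicator {t. \<epsilon> \<le> \<bar>t\<bar> \<and> \<bar>t\<bar> \<le> pi} t *\<^sub>R (f (x - t) * of_real (cot (t / 2)))"
    have ae: "AE t in lebesgue. ?L t = ?R t"
      unfolding AE_completion_iff using AE_lborel_reflect[OF eq, of x]
      by eventually_elim (auto simp: indicator_def trunc_cot_def)
    have mL: "?L \<in> borel_measurable lebesgue" by (rule measurable_completion) simp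
    have mR: "?R \<in> borel_measurable lebesgue" by (rule borel_measurable_AE[OF mL ae])
    have "(LINT t : {t. \<epsilon> \<le> \<bar>t\<bar> \<and> \<bar>t\<bar> \<le> pi} | lebesgue. f (x - t) * of_real (cot (t / 2))) = integral\<^sup>L lebesgue ?L"
      unfolding set_lebesgue_integral_def using ae by (intro integral_cong_AE mR mL) auto
    also have "\<dots> = integral\<^sup>L lborel ?L" by (rule integral_completion) simp
    finally show ?thesis
      by (subst integral_circle) (simp_all add: set_lebesgue_integral_def scaleR_conv_of_real)
  qed
  then show ?thesis unfolding hilbert_transform_def by simp
qed

lemma periodic_hilbert_transform: "periodic f \<Longrightarrow> periodic (hilbert_transform f)"
proof -
  assume "periodic f"
  then have "f ((x - t) + 2 * pi) = f (x - t)" for x t unfolding periodic_def by blast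
  then have *: "f (x + 2 * pi - t) = f (x - t)" for x t by (simp add: algebra_simps)
  show ?thesis unfolding periodic_def hilbert_transform_def by (intro allI) (simp only: *)
qed

lemma hilbert_transform_AE:
  assumes f0: "AE x in lborel. f x = f0 x"
    and f[measurable]: "f0 \<in> borel_measurable borel" and perf: "periodic f0" and intf: "integrable circle f0"
    and g[measurable]: "g \<in> borel_measurable borel" and perg: "periodic g" and intg: "integrable circle g"
    and conj: "conjugate_function f0 g"
  shows "AE x in lborel. hilbert_transform f x = g x"
proof -
  have "AE x in lborel. ((\<lambda>\<epsilon>. conv (trunc_cot \<epsilon>) f0 x) \<longlongrightarrow> g x) (at_right 0)"
    by (rule principal_value_AE_eq[OF f perf intf g perg intg conj])
  then show ?thesis by eventually_elim (simp add: hilbert_transform_eq[OF f f0] tendsto_Lim)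
qed

section \<open>Trigonometric sums and sampling\<close>

definition trig_sum :: "int set \<Rightarrow> (int \<Rightarrow> complex) \<Rightarrow> real \<Rightarrow> complex" where
  "trig_sum A a x = (\<Sum>k\<in>A. a k * fexp k x)"

definition conj_coeff :: "(int \<Rightarrow> complex) \<Rightarrow> int \<Rightarrow> complex" where
  "conj_coeff a k = - \<i> * of_int (sgn k) * a k"

text \<open>
  Boundedness of conjugation on trigonometric sums, normalised by the modular. The sums range
  over arbitrary finite sets of frequencies, because these are stable under modulation.
\<close>

definition conj_bound :: "(real \<Rightarrow> real) \<Rightarrow> real \<Rightarrow> bool" where
  "conj_bound \<phi> K \<longleftrightarrow> (\<forall>A a. finite A \<longrightarrow> modular \<phi> 1 (trig_sum A a) \<le> 1 \<longrightarrow>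
     modular \<phi> (1 / K) (trig_sum A (conj_coeff a)) \<le> 1)"

lemma trig_sum_measurable [measurable]: "trig_sum A a \<in> borel_measurable borel"
  unfolding trig_sum_def by measurable

lemma periodic_trig_sum: "periodic (trig_sum A a)"
  using periodic_fexp by (simp add: periodic_def trig_sum_def)

lemma norm_trig_sum_le: "norm (trig_sum A a x) \<le> (\<Sum>k\<in>A. norm (a k))"
  unfolding trig_sum_def by (rule norm_sum[THEN order_trans]) (simp add: norm_mult)

lemma integrable_trig_sum: "integrable circle (trig_sum A a)"
  by (rule integrable_circle_bounded[OF trig_sum_measurable norm_trig_sum_le])

lemma trig_sum_superset:
  assumes "finite B" "A \<subseteq> B"
  shows "trig_sum A a = trig_sum B (\<lambda>k. if k \<in> A then a k else 0)"
proof
  fix x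
  have "(\<Sum>k\<in>A. a k * fexp k x) = (\<Sum>k\<in>B. if k \<in> A then a k * fexp k x else 0)"
    using assms by (simp add: sum.inter_restrict[symmetric] Int_absorb1)
  then show "trig_sum A a x = trig_sum B (\<lambda>k. if k \<in> A then a k else 0) x"
    by (simp add: trig_sum_def if_distrib[of "\<lambda>c. c * _"] cong: if_cong)
qed

lemma trig_sum_diff:
  assumes "finite A" "finite B"
  obtains C c where "finite C" "\<And>x. trig_sum C c x = trig_sum A a x - trig_sum B b x"
    "\<And>x. trig_sum C (conj_coeff c) x = trig_sum A (conj_coeff a) x - trig_sum B (conj_coeff b) x"
proof
  let ?c = "\<lambda>k. (if k \<in> A then a k else 0) - (if k \<in> B then b k else 0)"
  show fin: "finite (A \<union> B)" using assms by simp
  note sup = trig_sum_superset[OF fin Un_upper1] trig_sum_superset[OF fin Un_upper2]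
  show "trig_sum (A \<union> B) ?c x = trig_sum A a x - trig_sum B b x" for x
    unfolding sup[of a] sup[of b] by (simp add: trig_sum_def left_diff_distrib sum_subtractf)
  have "conj_coeff ?c = (\<lambda>k. (if k \<in> A then conj_coeff a k else 0) - (if k \<in> B then conj_coeff b k else 0))"
    by (auto simp: conj_coeff_def algebra_simps)
  then show "trig_sum (A \<union> B) (conj_coeff ?c) x = trig_sum A (conj_coeff a) x - trig_sum B (conj_coeff b) x" for x
    unfolding sup[of "conj_coeff a"] sup[of "conj_coeff b"]
    by (simp add: trig_sum_def left_diff_distrib sum_subtractf)
qed

lemma trig_poly_iff: "trig_poly n f \<longleftrightarrow> (\<exists>a. f = trig_sum {- int n..int n} a)"
  by (simp add: trig_poly_def trig_sum_def fexp_def fun_eq_iff)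

lemma finite_int_bounded:
  assumes "finite (A :: int set)"
  obtains n :: nat where "n \<ge> 1" "A \<subseteq> {- int n..int n}"
proof
  show "1 + nat (\<Sum>k\<in>A. \<bar>k\<bar>) \<ge> 1" by simp
  show "A \<subseteq> {- int (1 + nat (\<Sum>k\<in>A. \<bar>k\<bar>))..int (1 + nat (\<Sum>k\<in>A. \<bar>k\<bar>))}"
  proof
    fix k assume "k \<in> A"
    then have "\<bar>k\<bar> \<le> (\<Sum>k\<in>A. \<bar>k\<bar>)" using assms by (intro member_le_sum) auto
    then show "k \<in> {- int (1 + nat (\<Sum>k\<in>A. \<bar>k\<bar>))..int (1 + nat (\<Sum>k\<in>A. \<bar>k\<bar>))}" by auto
  qed
qed

lemma trig_sum_shift_freq:
  "trig_sum A a x * fexp c x = trig_sum ((\<lambda>k. k + c) ` A) (\<lambda>k. a (k - c)) x"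
  unfolding trig_sum_def
  by (subst sum.reindex) (auto simp: inj_on_def sum_distrib_right fexp_add mult.assoc)

lemma trig_sum_uminus_arg: "trig_sum A a (- x) = trig_sum (uminus ` A) (\<lambda>k. a (- k)) x"
  unfolding trig_sum_def by (subst sum.reindex) (auto simp: fexp_uminus_arg)

lemma trig_sum_scale: "trig_sum A (\<lambda>k. c * a k) x = c * trig_sum A a x"
  by (simp add: trig_sum_def sum_distrib_left mult.assoc)

lemma trig_poly_fexp:
  assumes "\<bar>k\<bar> \<le> int n" shows "trig_poly n (\<lambda>x. c * fexp k x)"
  unfolding trig_poly_iff
proof (intro exI ext)
  fix x
  have "(\<lambda>x. c * fexp k x) = trig_sum {k} (\<lambda>_. c)" by (simp add: trig_sum_def fun_eq_iff)
  also have "\<dots> = trig_sum {- int n..int n} (\<lambda>j. if j \<in> {k} then c else 0)"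
    using assms by (intro trig_sum_superset) auto
  finally show "c * fexp k x = trig_sum {- int n..int n} (\<lambda>j. if j \<in> {k} then c else 0) x" by (rule fun_cong)
qed

lemma trig_poly_add: "trig_poly n f \<Longrightarrow> trig_poly n g \<Longrightarrow> trig_poly n (\<lambda>x. f x + g x)"
  unfolding trig_poly_iff
proof (elim exE)
  fix a b assume "f = trig_sum {- int n..int n} a" "g = trig_sum {- int n..int n} b"
  then show "\<exists>c. (\<lambda>x. f x + g x) = trig_sum {- int n..int n} c"
    by (intro exI[of _ "\<lambda>k. a k + b k"]) (simp add: trig_sum_def fun_eq_iff distrib_right sum.distrib)
qed

lemma trig_poly_sum:
  assumes "finite K" "\<And>k. k \<in> K \<Longrightarrow> trig_poly n (g k)"
  shows "trig_poly n (\<lambda>x. \<Sum>k\<in>K. g k x)"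
  using assms
proof (induction K rule: finite_induct)
  case empty
  have "trig_poly n (\<lambda>x. 0 * fexp 0 x)" by (rule trig_poly_fexp) simp
  then show ?case by simp
qed (simp add: trig_poly_add)

lemma trig_poly_cmult: "trig_poly n f \<Longrightarrow> trig_poly n (\<lambda>x. c * f x)"
  unfolding trig_poly_iff
  by (metis trig_sum_scale ext)

lemma sample_point_mult: "(2 * real n + 1) * sample_point n k = 2 * pi * (real n + of_int k)"
  by (simp add: sample_point_def)

lemma fexp_sample_period: "fexp (2 * int n + 1) (sample_point n k) = 1"
proof -
  have "fexp (2 * int n + 1) (sample_point n k) = cis (2 * pi * of_int (int n + k))"
    using sample_point_mult[of n k] by (simp add: fexp_cis)
  also have "\<dots> = 1" by (rule cis_multiple_2pi) simp
  finally show ?thesis .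
qed

text \<open>
  A geometric sum whose ratio is a root of unity of order dividing \<open>2n+1\<close>; it is nontrivial
  because \<open>2n+1\<close> does not divide \<open>m\<close>.
\<close>

lemma sum_fexp_sample:
  assumes "\<bar>m\<bar> \<le> 2 * int n"
  shows "(\<Sum>k = - int n..int n. fexp m (sample_point n k)) = (if m = 0 then 2 * of_nat n + 1 else 0)"
proof (cases "m = 0")
  case True
  then show ?thesis by simp
next
  case False
  let ?N = "2 * n + 1"
  define q where "q = fexp m (2 * pi / real ?N)"
  have "q ^ ?N = cis (of_nat ?N * (of_int m * (2 * pi / real ?N)))"
    unfolding q_def fexp_cis by (rule Complex.DeMoivre)
  also have "of_nat ?N * (of_int m * (2 * pi / real ?N)) = 2 * pi * of_int m" by (simp add: field_simps)
  also have "cis (2 * pi * of_int m) = 1" by (rule cis_multiple_2pi) simp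
  finally have qN: "q ^ ?N = 1" .
  have q1: "q \<noteq> 1"
  proof
    assume "q = 1"
    then obtain j :: int where "of_int m * (2 * pi / real ?N) = of_int (2 * j) * pi"
      unfolding q_def fexp_cis cis_conv_exp exp_eq_1 by auto
    then have "(of_int m :: real) * (2 * pi) = of_int (2 * j) * pi * real ?N" by (simp add: field_simps)
    then have "pi * (2 * of_int m) = pi * (of_int (2 * j) * real ?N)" by (simp add: mult_ac)
    then have "(2 * of_int m :: real) = of_int (2 * j) * real ?N" by (simp only: mult_left_cancel[OF pi_neq_zero])
    then have "real_of_int (2 * m) = real_of_int (2 * j * int ?N)" by simp
    then have "2 * m = 2 * j * int ?N" by (simp only: of_int_eq_iff)
    then have m: "m = j * int ?N" by simp
    with False have "1 \<le> \<bar>j\<bar>" by auto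
    then have "int ?N \<le> \<bar>j\<bar> * int ?N" using mult_right_mono[of 1 "\<bar>j\<bar>" "int ?N"] by simp
    also have "\<dots> = \<bar>m\<bar>" by (simp only: m abs_mult)
    finally show False using assms by simp
  qed
  have "(\<Sum>k = - int n..int n. fexp m (sample_point n k)) = (\<Sum>i<?N. q ^ i)"
  proof (rule sum.reindex_bij_witness[where i="\<lambda>i. int i - int n" and j="\<lambda>k. nat (k + int n)"])
    fix k assume k: "k \<in> {- int n..int n}"
    have "q ^ nat (k + int n) = cis (real (nat (k + int n)) * (of_int m * (2 * pi / real ?N)))"
      unfolding q_def fexp_cis by (rule Complex.DeMoivre)
    also have "real (nat (k + int n)) * (of_int m * (2 * pi / real ?N)) = of_int m * sample_point n k"
      using k by (simp add: sample_point_def field_simps)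
    finally show "q ^ nat (k + int n) = fexp m (sample_point n k)" by (simp add: fexp_cis)
  qed auto
  also have "\<dots> = (1 - q ^ ?N) / (1 - q)" using q1 by (simp only: sum_gp_strict if_False)
  also have "\<dots> = 0" unfolding qN by simp
  finally show ?thesis using False by simp
qed

abbreviation sample_mean :: "nat \<Rightarrow> (real \<Rightarrow> real) \<Rightarrow> real" where
  "sample_mean n F \<equiv> 1 / (2 * real n + 1) * (\<Sum>k = - int n..int n. F (sample_point n k))"

context young_function begin

lemma modular_scale_trig:
  assumes "0 \<le> c" "0 \<le> s"
  shows "modular \<phi> s (trig_sum A (\<lambda>k. of_real c * a k)) = modular \<phi> (s * c) (trig_sum A a)"
  using assms by (simp add: modular_def trig_sum_scale norm_mult mult.assoc)

lemma phi_quarter: "0 \<le> t \<Longrightarrow> \<phi> (t / 4) \<le> \<phi> t / 4"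
  using phi_half[of t] phi_half[of "t/2"] by simp

section \<open>From sampling to the Riesz projection\<close>

text \<open>
  Averaged over all offsets \<open>y\<close>, the sampled means \<open>S y\<close> and \<open>S (y + c)\<close> both equal the mean
  over the circle. Hence their sum is below 4 somewhere, as otherwise its average would be at
  least 4 and not at most 2.
\<close>

lemma exists_sampling_offset:
  fixes n :: nat and c :: real
  assumes F: "modular \<phi> 1 (trig_sum A a) \<le> 1"
  defines "S \<equiv> \<lambda>y. 1 / (2 * real n + 1) * (\<Sum>k = - int n..int n. \<phi> (norm (trig_sum A a (sample_point n k + y))))"
  obtains y where "S y \<le> 4" "S (y + c) \<le> 4"
proof -
  let ?F = "\<lambda>y. ennreal (\<phi> (norm (trig_sum A a y)))"
  let ?N = "2 * real n + 1"
  have [measurable]: "(\<lambda>y. \<phi> (norm (trig_sum A a (g y)))) \<in> borel_measurable borel"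
    if [measurable]: "g \<in> borel_measurable borel" for g
    using phi_norm_measurable[of "\<lambda>y. trig_sum A a (g y)" borel 1] by simp
  have per: "periodic ?F" using periodic_trig_sum[of A a] by (simp add: periodic_def)
  have S0: "0 \<le> S y" for y unfolding S_def by (intro mult_nonneg_nonneg sum_nonneg phi_nonneg) auto
  have Sint: "(\<integral>\<^sup>+y. ennreal (S (y + d)) \<partial>circle) = modular \<phi> 1 (trig_sum A a)" for d
  proof -
    have "(\<integral>\<^sup>+y. ennreal (S (y + d)) \<partial>circle)
        = (\<integral>\<^sup>+y. ennreal (1 / ?N) * (\<Sum>k = - int n..int n. ?F (y + (sample_point n k + d))) \<partial>circle)"
    proof (rule nn_integral_cong)
      fix y
      show "ennreal (S (y + d)) = ennreal (1 / ?N) * (\<Sum>k = - int n..int n. ?F (y + (sample_point n k + d)))"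
        unfolding S_def
        by (subst ennreal_mult) (auto intro!: sum_nonneg phi_nonneg simp: sum_ennreal phi_nonneg add_ac)
    qed
    also have "\<dots> = ennreal (1 / ?N) * (\<Sum>k = - int n..int n. \<integral>\<^sup>+y. ?F (y + (sample_point n k + d)) \<partial>circle)"
      by (subst nn_integral_cmult) (auto simp: nn_integral_sum)
    also have "(\<Sum>k = - int n..int n. \<integral>\<^sup>+y. ?F (y + (sample_point n k + d)) \<partial>circle)
        = (\<Sum>k = - int n..int n. modular \<phi> 1 (trig_sum A a))"
      using nn_integral_circle_shift[OF _ per] by (simp add: modular_def)
    also have "\<dots> = ennreal ?N * modular \<phi> 1 (trig_sum A a)"
      by (simp add: ennreal_of_nat_eq_real_of_nat nat_add_distrib nat_mult_distrib add.commute)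
    also have "ennreal (1 / ?N) * (ennreal ?N * modular \<phi> 1 (trig_sum A a)) = modular \<phi> 1 (trig_sum A a)"
      by (subst mult.assoc[symmetric], subst ennreal_mult[symmetric]) auto
    finally show ?thesis .
  qed
  have "\<exists>y. S y + S (y + c) < 4"
  proof (rule ccontr)
    assume "\<nexists>y. S y + S (y + c) < 4"
    then have ge: "4 \<le> S y + S (y + c)" for y by (meson not_less)
    have Sm: "(\<lambda>y. ennreal (S (y + d))) \<in> borel_measurable borel" for d unfolding S_def by measurable
    have "(4::ennreal) = (\<integral>\<^sup>+y. 4 \<partial>circle)" by (simp add: emeasure_circle_UNIV)
    also have "\<dots> \<le> (\<integral>\<^sup>+y. ennreal (S (y + 0)) + ennreal (S (y + c)) \<partial>circle)"
    proof (rule nn_integral_mono)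
      fix y
      have "ennreal 4 \<le> ennreal (S y + S (y + c))" using ge by (rule ennreal_leI)
      then show "4 \<le> ennreal (S (y + 0)) + ennreal (S (y + c))" using S0 by (simp add: ennreal_plus)
    qed
    also have "\<dots> = modular \<phi> 1 (trig_sum A a) + modular \<phi> 1 (trig_sum A a)"
      using Sm[of 0] Sm[of c] Sint[of 0] Sint[of c] by (simp add: nn_integral_add)
    also have "\<dots> \<le> 1 + 1" using F by (intro add_mono)
    finally have "ennreal 4 \<le> ennreal 2" by simp
    then show False by (subst (asm) ennreal_le_iff) auto
  qed
  then obtain y where "S y + S (y + c) < 4" by blast
  then show thesis using that[of y] S0[of y] S0[of "y + c"] by linarith
qed

text \<open>
  The interpolant at an offset \<open>z\<close> keeps the frequencies \<open>k \<ge> 0\<close> of \<open>f\<close> and sends a frequency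
  \<open>k < 0\<close> to \<open>k + 2n + 1\<close>, multiplied by \<open>fexp (- (2n+1)) z\<close>. At offsets that differ by \<open>pi /
  (2n+1)\<close> these factors are opposite, so the misplaced terms cancel in the sum of the two
  interpolants.
\<close>

lemma riesz_projection_bound:
  assumes C: "0 < C"
    and MZ: "\<And>n f. n \<ge> 1 \<Longrightarrow> trig_poly n f \<Longrightarrow>
      sample_mean n (\<lambda>x. \<phi> (norm (f x))) \<le> 1 \<Longrightarrow>
      modular \<phi> (1 / C) f \<le> 1"
    and A: "finite A" and M: "modular \<phi> 1 (trig_sum A a) \<le> 1"
  shows "modular \<phi> (1 / (4 * C)) (trig_sum {k \<in> A. 0 \<le> k} a) \<le> 1"
proof -
  obtain n where n: "n \<ge> 1" "A \<subseteq> {- int n..int n}" using finite_int_bounded[OF A] by blast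
  let ?f = "trig_sum A a" and ?A1 = "{k \<in> A. 0 \<le> k}" and ?A2 = "{k \<in> A. \<not> 0 \<le> k}"
  let ?N = "2 * int n + 1"
  \<comment> \<open>The interpolant of \<open>fexp (- n) * f\<close> translated by \<open>y\<close>: the frequencies \<open>k - n\<close> in \<open>[-2n, 0]\<close>
    are reduced modulo \<open>2n + 1\<close> to \<open>[-n, n]\<close>.\<close>
  define G where "G = (\<lambda>y x. (\<Sum>k\<in>?A1. a k * fexp (k - int n) y * fexp (k - int n) x)
     + (\<Sum>k\<in>?A2. a k * fexp (k - int n) y * fexp (k + int n + 1) x))"
  have split: "(\<Sum>k\<in>A. h k) = (\<Sum>k\<in>?A1. h k) + (\<Sum>k\<in>?A2. h k)" for h :: "int \<Rightarrow> complex"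
    using A by (subst sum.union_disjoint[symmetric]) (auto intro: sum.cong)
  have Gpoly: "trig_poly n (G y)" for y
    unfolding G_def using n A
    by (intro trig_poly_add trig_poly_sum trig_poly_fexp) auto
  have Gsample: "norm (G y (sample_point n j)) = norm (?f (sample_point n j + y))" for y j
  proof -
    let ?x = "sample_point n j"
    have "fexp (k + int n + 1) ?x = fexp (k - int n) ?x" for k
    proof -
      have "fexp (k + int n + 1) ?x = fexp ((k - int n) + (2 * int n + 1)) ?x" by (simp add: algebra_simps)
      also have "\<dots> = fexp (k - int n) ?x" by (simp only: fexp_add[of "k - int n"] fexp_sample_period mult_1_right)
      finally show ?thesis .
    qed
    then have "G y ?x = (\<Sum>k\<in>A. a k * fexp (k - int n) y * fexp (k - int n) ?x)"
      unfolding G_def split by simp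
    also have "\<dots> = fexp (- int n) (?x + y) * ?f (?x + y)"
      unfolding trig_sum_def sum_distrib_left
      by (intro sum.cong refl) (simp add: fexp_add_arg fexp_add[of _ "- int n", simplified] mult_ac)
    finally show ?thesis by (simp add: norm_mult)
  qed
  define c where "c = pi / (2 * real n + 1)"
  obtain y where y: "1 / (2 * real n + 1) * (\<Sum>k = - int n..int n. \<phi> (norm (?f (sample_point n k + y)))) \<le> 4"
    "1 / (2 * real n + 1) * (\<Sum>k = - int n..int n. \<phi> (norm (?f (sample_point n k + (y + c))))) \<le> 4"
    using exists_sampling_offset[OF M] by blast
  have GM: "modular \<phi> (1 / (4 * C)) (G z) \<le> 1"
    if z: "1 / (2 * real n + 1) * (\<Sum>k = - int n..int n. \<phi> (norm (?f (sample_point n k + z)))) \<le> 4" for z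
  proof -
    have "1 / (2 * real n + 1) * (\<Sum>k = - int n..int n. \<phi> (norm ((1/4) * G z (sample_point n k))))
      \<le> 1 / (2 * real n + 1) * (\<Sum>k = - int n..int n. \<phi> (norm (?f (sample_point n k + z))) / 4)"
    proof (intro mult_left_mono sum_mono)
      fix k
      show "\<phi> (norm ((1/4) * G z (sample_point n k))) \<le> \<phi> (norm (?f (sample_point n k + z))) / 4"
        using phi_quarter[of "norm (?f (sample_point n k + z))"] by (simp add: norm_mult norm_divide Gsample)
    qed simp
    also have "\<dots> = (1 / (2 * real n + 1) * (\<Sum>k = - int n..int n. \<phi> (norm (?f (sample_point n k + z))))) / 4"
      by (simp add: sum_divide_distrib[symmetric])
    also have "\<dots> \<le> 4 / 4" by (rule divide_right_mono[OF z]) simp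
    also have "4 / 4 = (1::real)" by simp
    finally have "modular \<phi> (1 / C) (\<lambda>x. (1/4) * G z x) \<le> 1"
      by (rule MZ[OF n(1) trig_poly_cmult[OF Gpoly]])
    then show ?thesis by (simp add: modular_def norm_mult norm_divide mult.commute)
  qed
  have Gm[measurable]: "G z \<in> borel_measurable borel" for z unfolding G_def by measurable
  have Gper: "periodic (G z)" for z using periodic_fexp by (simp add: G_def periodic_def)
  have Gshift: "G z (x - z) = fexp (- int n) x * trig_sum ?A1 a x
      + fexp (- ?N) z * (\<Sum>k\<in>?A2. a k * fexp (k + int n + 1) x)" for z x
  proof -
    have e: "fexp j z * fexp l (x - z) = fexp (j - l) z * fexp l x" for j l
      by (simp add: fexp_diff_arg fexp_add[of j "-l", simplified])
    have 1: "a k * fexp (k - int n) z * fexp (k - int n) (x - z) = fexp (- int n) x * (a k * fexp k x)" for k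
      using e[of "k - int n" "k - int n"] fexp_add[of k "- int n" x] by (simp add: mult_ac)
    have 2: "a k * fexp (k - int n) z * fexp (k + int n + 1) (x - z) = fexp (- ?N) z * (a k * fexp (k + int n + 1) x)" for k
    proof -
      have "(k - int n) - (k + int n + 1) = - ?N" by simp
      then show ?thesis using e[of "k - int n" "k + int n + 1"] by (simp add: mult_ac)
    qed
    show ?thesis unfolding G_def 1 2 trig_sum_def sum_distrib_left ..
  qed
  have anti: "fexp (- ?N) (y + c) = - fexp (- ?N) y"
  proof -
    have "real_of_int ?N = 2 * real n + 1" by simp
    then have "real_of_int ?N * c = pi" by (simp only: c_def) simp
    then have "real_of_int (- ?N) * c = - pi" by (simp only: of_int_minus mult_minus_left)
    then have "fexp (- ?N) c = cis (- pi)" by (simp only: fexp_cis)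
    then have "fexp (- ?N) c = - 1" by (simp add: complex_eq_iff)
    then show ?thesis by (simp only: fexp_add_arg) simp
  qed
  have GMs: "modular \<phi> (1 / (4 * C)) (\<lambda>x. G z (x - d)) \<le> 1"
    if "modular \<phi> (1 / (4 * C)) (G z) \<le> 1" for z d
    using modular_shift[OF Gm Gper, of "1 / (4 * C)" z "- d"] that C by simp
  let ?g1 = "\<lambda>x. G y (x - y)" and ?g2 = "\<lambda>x. G (y + c) (x - (y + c))"
  have eq: "?g1 x + ?g2 x = fexp (- int n) x * (2 * trig_sum ?A1 a x)" for x
    unfolding Gshift anti by (simp add: algebra_simps)
  have "modular \<phi> (1 / (4 * C) / 2) (\<lambda>x. 2 * trig_sum ?A1 a x) \<le> 1"
  proof (rule modular_add_le_1)
    show "?g1 \<in> borel_measurable borel" "?g2 \<in> borel_measurable borel" by measurable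
    show "0 \<le> 1 / (4 * C)" using C by simp
    fix x
    have "norm (2 * trig_sum ?A1 a x) = norm (?g1 x + ?g2 x)" unfolding eq by (simp add: norm_mult)
    then show "norm (2 * trig_sum ?A1 a x) \<le> norm (?g1 x) + norm (?g2 x)" using norm_triangle_ineq by simp
  next
    show "modular \<phi> (1 / (4 * C)) ?g1 \<le> 1" "modular \<phi> (1 / (4 * C)) ?g2 \<le> 1"
      by (rule GMs[OF GM[OF y(1)]], rule GMs[OF GM[OF y(2)]])
  qed
  then show ?thesis by (simp add: modular_def norm_mult)
qed

text \<open>
  The multiplier \<open>- \<i> * sgn k\<close> is the difference of the indicators of \<open>k \<ge> 0\<close> and \<open>k \<le> 0\<close>, up
  to a unimodular factor. The second one is the first one conjugated with the reflection of
  the circle.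
\<close>

lemma conj_bound_of_riesz:
  assumes R: "0 < R"
    and riesz: "\<And>A a. finite A \<Longrightarrow> modular \<phi> 1 (trig_sum A a) \<le> 1 \<Longrightarrow>
      modular \<phi> (1 / R) (trig_sum {k \<in> A. 0 \<le> k} a) \<le> 1"
  shows "conj_bound \<phi> (2 * R)"
  unfolding conj_bound_def
proof (intro allI impI)
  fix A a assume A: "finite A" and M: "modular \<phi> 1 (trig_sum A a) \<le> 1"
  let ?P = "trig_sum {k \<in> A. 0 \<le> k} a" and ?M = "trig_sum {k \<in> A. k \<le> 0} a"
  have P: "modular \<phi> (1 / R) ?P \<le> 1" by (rule riesz[OF A M])
  have refl: "trig_sum (uminus ` B) (\<lambda>k. a (- k)) = (\<lambda>x. trig_sum B a (- x))" for B
    by (simp add: trig_sum_uminus_arg)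
  have "modular \<phi> 1 (trig_sum (uminus ` A) (\<lambda>k. a (- k))) \<le> 1"
    using M by (simp add: refl modular_uminus)
  then have "modular \<phi> (1 / R) (trig_sum {k \<in> uminus ` A. 0 \<le> k} (\<lambda>k. a (- k))) \<le> 1"
    using A by (intro riesz) auto
  moreover have "{k \<in> uminus ` A. 0 \<le> k} = uminus ` {k \<in> A. k \<le> 0}" by auto
  ultimately have Mn: "modular \<phi> (1 / R) ?M \<le> 1"
    using modular_uminus[of ?M "1 / R"] R by (simp add: refl)
  have "trig_sum A (conj_coeff a) x = - \<i> * (?P x - ?M x)" for x
  proof -
    have "trig_sum A (conj_coeff a) x
        = (\<Sum>k\<in>A. - \<i> * ((if 0 \<le> k then a k * fexp k x else 0) - (if k \<le> 0 then a k * fexp k x else 0)))"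
      unfolding trig_sum_def conj_coeff_def by (intro sum.cong) (auto simp: sgn_if)
    also have "\<dots> = - \<i> * (?P x - ?M x)"
      using A unfolding sum_distrib_left[symmetric] sum_subtractf trig_sum_def
      by (simp add: sum.inter_filter)
    finally show ?thesis .
  qed
  then have "norm (trig_sum A (conj_coeff a) x) \<le> norm (?P x) + norm (?M x)" for x
    by (simp add: norm_mult norm_triangle_ineq4)
  from modular_add_le_1[OF _ _ _ this P Mn] have "modular \<phi> (1 / R / 2) (trig_sum A (conj_coeff a)) \<le> 1"
    using R by simp
  then show "modular \<phi> (1 / (2 * R)) (trig_sum A (conj_coeff a)) \<le> 1" by (simp add: mult.commute)
qed


section \<open>From conjugation to sampling\<close>

lemma conj_bound_scaled:
  assumes K: "0 < K"
    and H: "conj_bound \<phi> K"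
    and A: "finite A" and s: "0 \<le> s" and M: "modular \<phi> s (trig_sum A a) \<le> 1"
  shows "modular \<phi> (s / K) (trig_sum A (conj_coeff a)) \<le> 1"
proof -
  have "modular \<phi> 1 (trig_sum A (\<lambda>k. of_real s * a k)) \<le> 1" using M s by (simp add: modular_scale_trig)
  from H[unfolded conj_bound_def, rule_format, OF A this] have "modular \<phi> (1 / K) (trig_sum A (\<lambda>k. of_real s * conj_coeff a k)) \<le> 1"
    by (simp add: conj_coeff_def[abs_def] mult_ac)
  then show ?thesis using s K by (subst (asm) modular_scale_trig) auto
qed

text \<open>
  On the frequencies, \<open>2 * 1[k > 0] = sgn k + (sgn k)\<^sup>2\<close>: the square of conjugation takes
  care of the zero frequency. Other cuts follow by modulation, which leaves absolute values
  alone.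
\<close>

lemma frequency_cut_bound:
  assumes K: "1 \<le> K"
    and H: "conj_bound \<phi> K"
    and A: "finite A" and s: "0 \<le> s" and M: "modular \<phi> s (trig_sum A a) \<le> 1"
  shows "modular \<phi> (s / K\<^sup>2) (trig_sum {k \<in> A. c < k} a) \<le> 1"
proof -
  let ?A = "(\<lambda>k. k - c) ` A" and ?a = "\<lambda>k. a (k + c)"
  have fin: "finite ?A" using A by simp
  have K0: "0 < K" using K by simp
  have sc: "modular \<phi> (s' / K) (trig_sum ?A (conj_coeff c)) \<le> 1"
    if "0 \<le> s'" "modular \<phi> s' (trig_sum ?A c) \<le> 1" for s' c
    by (rule conj_bound_scaled[OF K0 H fin that])
  have shift: "norm (trig_sum ((\<lambda>k. k - c) ` B) ?a x) = norm (trig_sum B a x)" for B x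
  proof -
    have "trig_sum ((\<lambda>k. k - c) ` B) ?a x = trig_sum B a x * fexp (- c) x"
      using trig_sum_shift_freq[of B a x "- c"] by simp
    then show ?thesis by (simp add: norm_mult)
  qed
  have M0: "modular \<phi> s (trig_sum ?A ?a) \<le> 1" using M by (simp add: modular_def shift)
  have M1: "modular \<phi> (s / K) (trig_sum ?A (conj_coeff ?a)) \<le> 1" by (rule sc[OF s M0])
  have M2: "modular \<phi> (s / K / K) (trig_sum ?A (conj_coeff (conj_coeff ?a))) \<le> 1"
    by (rule sc[OF _ M1]) (use s K0 in auto)
  have "s / K / K \<le> s / K" using s K by (simp add: divide_le_eq mult_le_cancel_left1)
  then have M1': "modular \<phi> (s / K / K) (trig_sum ?A (conj_coeff ?a)) \<le> 1"
    using M1 modular_mono_scale[of "s / K / K" "s / K"] s K0 by (meson divide_nonneg_pos order_trans)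
  have pos: "{k \<in> ?A. 0 < k} = (\<lambda>k. k - c) ` {k \<in> A. c < k}" by auto
  have ii: "\<i> * (\<i> * z) = - z" for z by (simp add: mult.assoc[symmetric])
  have "2 * trig_sum {k \<in> ?A. 0 < k} ?a x
      = \<i> * trig_sum ?A (conj_coeff ?a) x - trig_sum ?A (conj_coeff (conj_coeff ?a)) x" for x
  proof -
    have "2 * trig_sum {k \<in> ?A. 0 < k} ?a x = (\<Sum>k\<in>?A. if 0 < k then 2 * (?a k * fexp k x) else 0)"
      using fin unfolding trig_sum_def sum_distrib_left by (simp only: sum.inter_filter)
    also have "\<dots> = (\<Sum>k\<in>?A. \<i> * (conj_coeff ?a k * fexp k x) - conj_coeff (conj_coeff ?a) k * fexp k x)"
      by (rule sum.cong) (auto simp: conj_coeff_def sgn_if ii mult_ac)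
    finally show ?thesis by (simp only: trig_sum_def sum_subtractf sum_distrib_left)
  qed
  then have "norm (2 * trig_sum {k \<in> ?A. 0 < k} ?a x)
      \<le> norm (\<i> * trig_sum ?A (conj_coeff ?a) x) + norm (trig_sum ?A (conj_coeff (conj_coeff ?a)) x)" for x
    by (simp only: norm_triangle_ineq4)
  then have "norm (2 * trig_sum {k \<in> ?A. 0 < k} ?a x)
      \<le> norm (trig_sum ?A (conj_coeff ?a) x) + norm (trig_sum ?A (conj_coeff (conj_coeff ?a)) x)" for x
    by (simp only: norm_mult norm_ii mult_1_left)
  from modular_add_le_1[OF _ _ _ this M1' M2]
  have "modular \<phi> (s / K / K / 2) (\<lambda>x. 2 * trig_sum {k \<in> ?A. 0 < k} ?a x) \<le> 1" using s K0 by simp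
  then show ?thesis unfolding pos by (simp add: modular_def shift norm_mult power2_eq_square)
qed

lemma partial_sum_bound:
  assumes K: "1 \<le> K"
    and H: "conj_bound \<phi> K"
    and A: "finite A" "{- int n..int n} \<subseteq> A" and s: "0 \<le> s" and M: "modular \<phi> s (trig_sum A a) \<le> 1"
  shows "modular \<phi> (s / (2 * K\<^sup>2)) (trig_sum {- int n..int n} a) \<le> 1"
proof -
  let ?P = "\<lambda>c. trig_sum {k \<in> A. c < k} a"
  have cut: "modular \<phi> (s / K\<^sup>2) (?P c) \<le> 1" for c
    by (rule frequency_cut_bound[OF K H A(1) s M])
  have "trig_sum {- int n..int n} a x = ?P (- int n - 1) x - ?P (int n) x" for x
  proof -
    have eq: "{k \<in> A. - int n - 1 < k} = {- int n..int n} \<union> {k \<in> A. int n < k}" using A(2) by auto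
    have "?P (- int n - 1) x = trig_sum {- int n..int n} a x + ?P (int n) x"
      unfolding trig_sum_def eq by (rule sum.union_disjoint) (use A(1) in auto)
    then show ?thesis by simp
  qed
  then have "norm (trig_sum {- int n..int n} a x) \<le> norm (?P (- int n - 1) x) + norm (?P (int n) x)" for x
    by (simp add: norm_triangle_ineq4)
  from modular_add_le_1[OF _ _ _ this cut cut]
  have "modular \<phi> (s / K\<^sup>2 / 2) (trig_sum {- int n..int n} a) \<le> 1" using s by simp
  then show ?thesis by (simp add: mult.commute)
qed

end

definition dirichlet :: "nat \<Rightarrow> real \<Rightarrow> complex" where
  "dirichlet n t = (\<Sum>j = - int n..int n. fexp j t)"

lemma dirichlet_measurable [measurable]: "dirichlet n \<in> borel_measurable borel"
  unfolding dirichlet_def by measurable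

lemma norm_dirichlet_sq:
  "complex_of_real ((norm (dirichlet n t))\<^sup>2) = (\<Sum>j = - int n..int n. \<Sum>l = - int n..int n. fexp (j - l) t)"
proof -
  have "complex_of_real ((norm (dirichlet n t))\<^sup>2) = dirichlet n t * cnj (dirichlet n t)"
    by (simp add: complex_norm_square[symmetric] del: of_real_power)
  then show ?thesis
    by (simp add: dirichlet_def sum_product cnj_fexp fexp_add[of _ "- _", simplified])
qed

lemma integral_dirichlet_sq: "(\<integral>t. (norm (dirichlet n (t + c)))\<^sup>2 \<partial>circle) = 2 * real n + 1"
proof -
  have "complex_of_real (\<integral>t. (norm (dirichlet n (t + c)))\<^sup>2 \<partial>circle)
      = (\<integral>t. complex_of_real ((norm (dirichlet n (t + c)))\<^sup>2) \<partial>circle)"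
    by (rule integral_complex_of_real[symmetric])
  also have "\<dots> = (\<integral>t. (\<Sum>j = - int n..int n. \<Sum>l = - int n..int n. fexp (j - l) c * fexp (j - l) t) \<partial>circle)"
    by (simp only: norm_dirichlet_sq fexp_add_arg mult.commute)
  also have "\<dots> = (\<Sum>j = - int n..int n. \<Sum>l = - int n..int n. fexp (j - l) c * (if j - l = 0 then 1 else 0))"
    using integrable_fexp by (simp add: integral_fexp)
  also have "\<dots> = (\<Sum>j = - int n..int n. \<Sum>l = - int n..int n. if j = l then 1 else 0)"
    by (intro sum.cong refl) auto
  also have "\<dots> = of_real (2 * real n + 1)" by simp
  finally show ?thesis by (simp only: of_real_eq_iff)
qed

lemma sum_dirichlet_sq:
  "(\<Sum>k = - int n..int n. (norm (dirichlet n (x - sample_point n k)))\<^sup>2) = (2 * real n + 1)\<^sup>2"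
proof -
  let ?R = "{- int n..int n}"
  have "complex_of_real (\<Sum>k\<in>?R. (norm (dirichlet n (x - sample_point n k)))\<^sup>2)
      = (\<Sum>k\<in>?R. \<Sum>j\<in>?R. \<Sum>l\<in>?R. fexp (j - l) x * fexp (l - j) (sample_point n k))"
    by (simp only: of_real_sum norm_dirichlet_sq fexp_diff_arg minus_diff_eq)
  also have "\<dots> = (\<Sum>j\<in>?R. \<Sum>l\<in>?R. fexp (j - l) x * (\<Sum>k\<in>?R. fexp (l - j) (sample_point n k)))"
    by (subst sum.swap, rule sum.cong[OF refl], subst sum.swap) (simp add: sum_distrib_left)
  also have "\<dots> = (\<Sum>j\<in>?R. \<Sum>l\<in>?R. if j = l then 2 * of_nat n + 1 else 0)"
    by (intro sum.cong refl, subst sum_fexp_sample) auto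
  also have "\<dots> = of_real ((2 * real n + 1)\<^sup>2)" by (simp add: power2_eq_square)
  finally show ?thesis by (simp only: of_real_eq_iff)
qed

context young_function begin

text \<open>
  The kernel \<open>V\<close> is the sum of two modulations of the Fejer kernel \<open>\<bar>dirichlet n\<bar>\<^sup>2 /
  (2n+1)\<close>. By the two orthogonality relations this Fejer kernel has mean 1 both over the
  circle and over every translate of the grid. The first fact bounds the mean of the function
  by the samples, the second one makes Jensen's inequality applicable at each point. The scale
  \<open>1/2\<close> accounts for the two modulations.
\<close>

lemma smoothed_samples_bound:
  fixes n :: nat and f :: "real \<Rightarrow> complex"
  assumes smp: "sample_mean n (\<lambda>x. \<phi> (norm (f x))) \<le> 1"
  defines "V \<equiv> \<lambda>t. (fexp (int n) t + fexp (- int n - 1) t) * (dirichlet n t)\<^sup>2 / (2 * of_nat n + 1)"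
  shows "modular \<phi> (1/2) (\<lambda>x. (\<Sum>k = - int n..int n. f (sample_point n k) * V (x - sample_point n k)) / (2 * of_nat n + 1)) \<le> 1"
proof -
  let ?N = "2 * real n + 1" and ?R = "{- int n..int n}"
  let ?h = "\<lambda>x. (\<Sum>k\<in>?R. f (sample_point n k) * V (x - sample_point n k)) / (2 * of_nat n + 1)"
  define w where "w = (\<lambda>k x. (norm (dirichlet n (x - sample_point n k)))\<^sup>2 / ?N\<^sup>2)"
  have w0: "0 \<le> w k x" for k x by (simp add: w_def)
  have N: "norm (2 * of_nat n + 1 :: complex) = ?N"
  proof -
    have "2 * of_nat n + 1 = (of_nat (2 * n + 1) :: complex)" by simp
    then show ?thesis by (simp only: norm_of_nat)
  qed
  have Vb: "norm (V t) \<le> 2 * (norm (dirichlet n t))\<^sup>2 / ?N" for t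
  proof -
    have "norm (fexp (int n) t + fexp (- int n - 1) t) \<le> 2"
      using norm_triangle_ineq[of "fexp (int n) t" "fexp (- int n - 1) t"] by simp
    then show ?thesis unfolding V_def norm_divide norm_mult norm_power N
      by (intro divide_right_mono mult_right_mono) auto
  qed
  have Vc: "norm (c * V t) \<le> norm c * (2 * (norm (dirichlet n t))\<^sup>2 / ?N)" for c t
    using mult_left_mono[OF Vb[of t], of "norm c"] by (simp only: norm_mult norm_ge_zero)
  have ptw: "\<phi> (1/2 * norm (?h x)) \<le> (\<Sum>k\<in>?R. w k x * \<phi> (norm (f (sample_point n k))))" for x
  proof -
    have "norm (?h x) \<le> (\<Sum>k\<in>?R. norm (f (sample_point n k)) * (2 * (norm (dirichlet n (x - sample_point n k)))\<^sup>2 / ?N)) / ?N"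
      unfolding norm_divide N
      by (intro divide_right_mono norm_sum[THEN order_trans] sum_mono Vc) simp
    also have "\<dots> = 2 * (\<Sum>k\<in>?R. w k x * norm (f (sample_point n k)))"
      unfolding sum_distrib_left sum_divide_distrib
      by (intro sum.cong refl) (simp add: w_def power2_eq_square)
    finally have "\<phi> (1/2 * norm (?h x)) \<le> \<phi> (\<Sum>k\<in>?R. w k x * norm (f (sample_point n k)))"
      by (intro phi_mono) auto
    also have "\<dots> \<le> (\<Sum>k\<in>?R. w k x * \<phi> (norm (f (sample_point n k))))"
    proof (rule phi_sum_le)
      have "(\<Sum>k\<in>?R. w k x) = 1"
        unfolding w_def sum_divide_distrib[symmetric] sum_dirichlet_sq by simp
      then show "(\<Sum>k\<in>?R. w k x) \<le> 1" by simp
    qed (auto simp: w0)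
    finally show ?thesis .
  qed
  have wint: "(\<integral>\<^sup>+x. ennreal (w k x) \<partial>circle) = ennreal (1 / ?N)" for k
  proof -
    have [measurable]: "w k \<in> borel_measurable borel" unfolding w_def by measurable
    have "norm (w k x) \<le> 1" for x
    proof -
      have "norm (dirichlet n t) \<le> ?N" for t
        unfolding dirichlet_def by (rule norm_sum[THEN order_trans]) simp
      then have "(norm (dirichlet n (x - sample_point n k)))\<^sup>2 \<le> ?N\<^sup>2" by (intro power_mono) auto
      then show ?thesis by (simp add: w_def)
    qed
    then have "integrable circle (w k)" by (intro integrable_circle_bounded) auto
    then have "(\<integral>\<^sup>+x. ennreal (w k x) \<partial>circle) = ennreal (\<integral>x. w k x \<partial>circle)"
      by (intro nn_integral_eq_integral) (auto simp: w0)
    also have "(\<integral>x. w k x \<partial>circle) = 1 / ?N"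
      using integral_dirichlet_sq[of n "- sample_point n k"] by (simp add: w_def power2_eq_square)
    finally show ?thesis .
  qed
  have [measurable]: "w k \<in> borel_measurable borel" for k unfolding w_def by measurable
  have "modular \<phi> (1/2) ?h \<le> (\<integral>\<^sup>+x. (\<Sum>k\<in>?R. ennreal (w k x) * ennreal (\<phi> (norm (f (sample_point n k))))) \<partial>circle)"
    unfolding modular_def
  proof (rule nn_integral_mono)
    fix x
    have "ennreal (\<phi> (1/2 * norm (?h x))) \<le> ennreal (\<Sum>k\<in>?R. w k x * \<phi> (norm (f (sample_point n k))))"
      by (rule ennreal_leI) (rule ptw)
    also have "\<dots> = (\<Sum>k\<in>?R. ennreal (w k x) * ennreal (\<phi> (norm (f (sample_point n k)))))"
      using w0 phi_nonneg by (simp add: sum_ennreal[symmetric] ennreal_mult)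
    finally show "ennreal (\<phi> (1/2 * norm (?h x))) \<le> \<dots>" .
  qed
  also have "\<dots> = (\<Sum>k\<in>?R. ennreal (1 / ?N) * ennreal (\<phi> (norm (f (sample_point n k)))))"
    by (subst nn_integral_sum) (auto simp: nn_integral_multc wint)
  also have "\<dots> = ennreal (1 / ?N * (\<Sum>k\<in>?R. \<phi> (norm (f (sample_point n k)))))"
  proof -
    have "(\<Sum>k\<in>?R. ennreal (1 / ?N) * ennreal (\<phi> (norm (f (sample_point n k)))))
        = (\<Sum>k\<in>?R. ennreal (1 / ?N * \<phi> (norm (f (sample_point n k)))))"
      by (intro sum.cong refl ennreal_mult[symmetric] phi_nonneg) auto
    also have "\<dots> = ennreal (\<Sum>k\<in>?R. 1 / ?N * \<phi> (norm (f (sample_point n k))))"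
      by (intro sum_ennreal mult_nonneg_nonneg phi_nonneg) auto
    finally show ?thesis by (simp only: sum_distrib_left)
  qed
  also have "\<dots> \<le> ennreal 1" using smp by (rule ennreal_leI)
  finally show ?thesis by simp
qed

text \<open>
  The two modulations carry the Fourier coefficients \<open>1 - \<bar>k\<bar> / (2n+1)\<close> of the Fejer kernel
  to tents centred at \<open>n\<close> and \<open>- n - 1\<close>; their distance is the half-width of the tents, so
  they add up to 1 on \<open>[-n, n]\<close>. There the discrete Fourier coefficients of a polynomial of
  degree \<open>n\<close> are its coefficients, so smoothing the samples changes nothing on these
  frequencies.
\<close>

lemma smoothed_samples_trig_sum:
  fixes n :: nat and a :: "int \<Rightarrow> complex"
  defines "f \<equiv> trig_sum {- int n..int n} a"
  defines "V \<equiv> \<lambda>t. (fexp (int n) t + fexp (- int n - 1) t) * (dirichlet n t)\<^sup>2 / (2 * of_nat n + 1)"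
  obtains b where "\<And>k. k \<in> {- int n..int n} \<Longrightarrow> b k = a k"
    "(\<lambda>x. (\<Sum>k = - int n..int n. f (sample_point n k) * V (x - sample_point n k)) / (2 * of_nat n + 1))
       = trig_sum {- 3 * int n - 1..3 * int n} b"
proof -
  let ?N = "2 * of_nat n + 1 :: complex" and ?R = "{- int n..int n}" and ?B = "{- 3 * int n - 1..3 * int n}"
  have N0: "?N \<noteq> 0"
  proof -
    have "?N = of_nat (2 * n + 1)" by simp
    then show ?thesis by (simp only: of_nat_eq_0_iff)
  qed
  define d where "d = (\<lambda>m. (\<Sum>k\<in>?R. f (sample_point n k) * fexp (- m) (sample_point n k)) / ?N)"
  \<comment> \<open>The Fourier coefficients of \<open>V\<close>: multiplying the modulations by one Dirichlet kernel gives the block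
    \<open>[-2n-1, 2n]\<close> of frequencies, and the second Dirichlet kernel averages its translates.\<close>
  define e where "e = (\<lambda>m. (\<Sum>j\<in>?R. if m \<in> {j - 2 * int n - 1..j + 2 * int n} then 1 else 0) / ?N)"
  define b where "b = (\<lambda>m. e m * d m)"
  have da: "d m = a m" if m: "m \<in> ?R" for m
  proof -
    have "(\<Sum>k\<in>?R. f (sample_point n k) * fexp (- m) (sample_point n k))
        = (\<Sum>k\<in>?R. \<Sum>j\<in>?R. a j * fexp (j - m) (sample_point n k))"
      by (simp add: f_def trig_sum_def sum_distrib_right fexp_add[of _ "- m", simplified] mult.assoc)
    also have "\<dots> = (\<Sum>j\<in>?R. a j * (\<Sum>k\<in>?R. fexp (j - m) (sample_point n k)))"
      by (subst sum.swap) (simp add: sum_distrib_left)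
    also have "\<dots> = (\<Sum>j\<in>?R. if j = m then a j * ?N else 0)"
      by (intro sum.cong refl, subst sum_fexp_sample) (use m in auto)
    also have "\<dots> = a m * ?N" using m by simp
    finally show ?thesis using N0 by (simp add: d_def)
  qed
  have e1: "e m = 1" if m: "m \<in> ?R" for m
  proof -
    have "(\<Sum>j\<in>?R. if m \<in> {j - 2 * int n - 1..j + 2 * int n} then 1 else 0) = (\<Sum>j\<in>?R. 1 :: complex)"
      by (rule sum.cong) (use m in auto)
    then show ?thesis using N0 by (simp add: e_def)
  qed
  have V: "V t = (\<Sum>m\<in>?B. e m * fexp m t)" for t
  proof -
    have block: "fexp c t * dirichlet n t = (\<Sum>m = c - int n..c + int n. fexp m t)" for c
      unfolding dirichlet_def sum_distrib_left fexp_add[symmetric]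
      by (rule sum.reindex_bij_witness[where i="\<lambda>m. m - c" and j="\<lambda>l. c + l"]) auto
    have both: "(\<Sum>m = j - 2 * int n - 1..j + 2 * int n. fexp m t)
        = fexp j t * ((fexp (int n) t + fexp (- int n - 1) t) * dirichlet n t)" for j
    proof -
      have "{j - 2 * int n - 1..j + 2 * int n}
          = {(j + int n) - int n..(j + int n) + int n} \<union> {(j - int n - 1) - int n..(j - int n - 1) + int n}" by auto
      then have "(\<Sum>m = j - 2 * int n - 1..j + 2 * int n. fexp m t)
          = (\<Sum>m \<in> {(j + int n) - int n..(j + int n) + int n} \<union> {(j - int n - 1) - int n..(j - int n - 1) + int n}. fexp m t)"
        by (rule arg_cong)
      also have "\<dots> = (\<Sum>m = (j + int n) - int n..(j + int n) + int n. fexp m t) + (\<Sum>m = (j - int n - 1) - int n..(j - int n - 1) + int n. fexp m t)"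
        by (rule sum.union_disjoint) auto
      also have "\<dots> = fexp (j + int n) t * dirichlet n t + fexp (j + (- int n - 1)) t * dirichlet n t"
        by (simp only: block) simp
      finally show ?thesis by (simp only: fexp_add[of j] distrib_left distrib_right mult.assoc)
    qed
    have "(\<Sum>m\<in>?B. e m * fexp m t) = (\<Sum>m\<in>?B. \<Sum>j\<in>?R. if m \<in> {j - 2 * int n - 1..j + 2 * int n} then fexp m t else 0) / ?N"
      by (simp add: e_def sum_distrib_right sum_divide_distrib if_distrib[of "\<lambda>c. c * _"] cong: if_cong)
    also have "(\<Sum>m\<in>?B. \<Sum>j\<in>?R. if m \<in> {j - 2 * int n - 1..j + 2 * int n} then fexp m t else 0)
        = (\<Sum>j\<in>?R. \<Sum>m\<in>?B. if m \<in> {j - 2 * int n - 1..j + 2 * int n} then fexp m t else 0)"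
      by (rule sum.swap)
    also have "\<dots> = (\<Sum>j\<in>?R. \<Sum>m = j - 2 * int n - 1..j + 2 * int n. fexp m t)"
    proof (rule sum.cong[OF refl])
      fix j assume "j \<in> ?R"
      then have "?B \<inter> {j - 2 * int n - 1..j + 2 * int n} = {j - 2 * int n - 1..j + 2 * int n}" by auto
      then show "(\<Sum>m\<in>?B. if m \<in> {j - 2 * int n - 1..j + 2 * int n} then fexp m t else 0)
          = (\<Sum>m = j - 2 * int n - 1..j + 2 * int n. fexp m t)"
        using sum.inter_restrict[of ?B "\<lambda>m. fexp m t" "{j - 2 * int n - 1..j + 2 * int n}"] by simp
    qed
    also have "\<dots> = dirichlet n t * ((fexp (int n) t + fexp (- int n - 1) t) * dirichlet n t)"
      unfolding both sum_distrib_right[symmetric] by (simp add: dirichlet_def)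
    finally show ?thesis unfolding V_def by (simp add: power2_eq_square mult_ac)
  qed
  show thesis
  proof (rule that)
    show "b k = a k" if "k \<in> ?R" for k using that by (simp add: b_def da e1)
    show "(\<lambda>x. (\<Sum>k\<in>?R. f (sample_point n k) * V (x - sample_point n k)) / ?N) = trig_sum ?B b"
    proof
      fix x
      have "(\<Sum>k\<in>?R. f (sample_point n k) * V (x - sample_point n k))
          = (\<Sum>k\<in>?R. \<Sum>m\<in>?B. e m * fexp m x * (f (sample_point n k) * fexp (- m) (sample_point n k)))"
        by (simp add: V fexp_diff_arg sum_distrib_left mult_ac)
      also have "\<dots> = (\<Sum>m\<in>?B. e m * fexp m x * (\<Sum>k\<in>?R. f (sample_point n k) * fexp (- m) (sample_point n k)))"
        by (subst sum.swap) (simp add: sum_distrib_left)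
      finally have "(\<Sum>k\<in>?R. f (sample_point n k) * V (x - sample_point n k)) / ?N
          = (\<Sum>m\<in>?B. e m * fexp m x * (\<Sum>k\<in>?R. f (sample_point n k) * fexp (- m) (sample_point n k)) / ?N)"
        by (simp only: sum_divide_distrib[of _ ?B])
      also have "\<dots> = trig_sum ?B b x"
        unfolding trig_sum_def b_def d_def by (intro sum.cong refl) (simp add: mult_ac)
      finally show "(\<Sum>k\<in>?R. f (sample_point n k) * V (x - sample_point n k)) / ?N = trig_sum ?B b x" .
    qed
  qed
qed

lemma sampling_bound_of_conj:
  assumes K: "1 \<le> K"
    and H: "conj_bound \<phi> K"
    and f: "trig_poly n f"
    and smp: "sample_mean n (\<lambda>x. \<phi> (norm (f x))) \<le> 1"
  shows "modular \<phi> (1 / (4 * K\<^sup>2)) f \<le> 1"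
proof -
  obtain a where a: "f = trig_sum {- int n..int n} a" using f by (auto simp: trig_poly_iff)
  obtain b where b: "\<And>k. k \<in> {- int n..int n} \<Longrightarrow> b k = a k"
    "(\<lambda>x. (\<Sum>k = - int n..int n. f (sample_point n k) * ((fexp (int n) (x - sample_point n k) + fexp (- int n - 1) (x - sample_point n k)) * (dirichlet n (x - sample_point n k))\<^sup>2 / (2 * of_nat n + 1))) / (2 * of_nat n + 1))
       = trig_sum {- 3 * int n - 1..3 * int n} b"
    unfolding a using smoothed_samples_trig_sum[of n a] by blast
  have "modular \<phi> (1/2) (trig_sum {- 3 * int n - 1..3 * int n} b) \<le> 1"
    using smoothed_samples_bound[OF smp] unfolding b(2) .
  then have "modular \<phi> (1/2 / (2 * K\<^sup>2)) (trig_sum {- int n..int n} b) \<le> 1"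
    by (intro partial_sum_bound[OF K H, where A = "{- 3 * int n - 1..3 * int n}"]) auto
  moreover have "trig_sum {- int n..int n} b = f" unfolding a trig_sum_def using b(1) by auto
  ultimately show ?thesis by simp
qed

end

section \<open>Approximation by trigonometric sums\<close>

lemma trig_sum_conv:
  assumes "\<And>k. (\<integral>t. of_real (K t) * fexp (- k) t \<partial>circle) = m k"
    and [measurable]: "K \<in> borel_measurable borel" and b: "\<And>t. \<bar>K t\<bar> \<le> B"
  shows "(conv K (trig_sum A a) x) = (\<Sum>k\<in>A. m k * a k * fexp k x)"
proof -
  have i: "integrable circle (\<lambda>t. of_real (K t) * fexp k t)" for k
    by (rule integrable_circle_mult_bounded(1)[OF _ b integrable_fexp]) measurable
  have "(conv K (trig_sum A a) x)
      = (\<integral>t. (\<Sum>k\<in>A. (a k * fexp k x) * (of_real (K t) * fexp (- k) t)) \<partial>circle)"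
    by (simp add: trig_sum_def fexp_diff_arg sum_distrib_left mult_ac)
  also have "\<dots> = (\<Sum>k\<in>A. (a k * fexp k x) * (\<integral>t. of_real (K t) * fexp (- k) t \<partial>circle))"
    using i by (subst Bochner_Integration.integral_sum) auto
  finally show ?thesis by (simp add: assms(1) mult_ac)
qed

lemma conj_poisson_trig_sum:
  assumes r: "0 < r" "r < 1"
  shows "conv (conj_poisson r) (trig_sum A a) x = conv (poisson r) (trig_sum A (conj_coeff a)) x"
  unfolding trig_sum_conv[OF poisson_coeff[OF r] poisson_measurable poisson_bounded(1)[OF r]]
    trig_sum_conv[OF conj_poisson_coeff[OF r] conj_poisson_measurable poisson_bounded(2)[OF r]]
  by (simp add: conj_coeff_def mult_ac)

lemma hilbert_transform_trig_sum:
  "AE x in lborel. hilbert_transform (trig_sum A a) x = trig_sum A (conj_coeff a) x"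
  by (rule hilbert_transform_AE[where ?f0.0 = "trig_sum A a"])
    (auto simp: periodic_trig_sum integrable_trig_sum conjugate_function_def conj_poisson_trig_sum)

definition poisson_mean :: "real \<Rightarrow> (real \<Rightarrow> complex) \<Rightarrow> real \<Rightarrow> complex" where
  "poisson_mean r f x = conv (poisson r) f x"

lemma poisson_mean_measurable [measurable]:
  assumes [measurable]: "f \<in> borel_measurable borel"
  shows "poisson_mean r f \<in> borel_measurable borel"
proof -
  have "(\<lambda>x. conv (poisson r) f x) \<in> borel_measurable borel"
    by (rule circle.borel_measurable_lebesgue_integral) measurable
  then show ?thesis by (simp add: poisson_mean_def[abs_def])
qed

lemma poisson_mean_trig_approx:
  fixes f :: "real \<Rightarrow> complex"
  assumes f[measurable]: "f \<in> borel_measurable borel" and per: "periodic f" and int: "integrable circle f"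
    and r: "0 < r" "r < 1" and d: "0 < d"
  obtains M a where "\<And>x. norm (poisson_mean r f x - trig_sum {- int M..int M} a x) \<le> d"
proof -
  let ?L = "\<integral>t. norm (f t) \<partial>circle"
  have "(\<lambda>M. 2 * r ^ Suc M / (1 - r) * ?L) \<longlonglongrightarrow> 2 * 0 / (1 - r) * ?L"
    using r by (intro tendsto_intros LIMSEQ_Suc LIMSEQ_realpow_zero) auto
  then have "\<forall>\<^sub>F M in sequentially. 2 * r ^ Suc M / (1 - r) * ?L < d"
    by (rule order_tendstoD) (use d in simp)
  then obtain M where M: "2 * r ^ Suc M / (1 - r) * ?L < d" by (auto simp: eventually_sequentially)
  \<comment> \<open>The real part of a partial sum of \<open>poisson_analytic\<close> approximates the Poisson kernel.\<close>
  define \<kappa> where "\<kappa> = (\<lambda>t. 1 + 2 * (\<Sum>m<M. of_real r ^ Suc m * fexp (int (Suc m)) t))"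
  define T where "T = (\<lambda>t. Re (\<kappa> t))"
  have T: "of_real (T t) = 1 + (\<Sum>m<M. of_real r ^ Suc m * fexp (int (Suc m)) t + of_real r ^ Suc m * fexp (- int (Suc m)) t)" for t
  proof -
    have "complex_of_real (T t) = (\<kappa> t + cnj (\<kappa> t)) / 2" by (simp add: T_def complex_add_cnj)
    then show ?thesis by (simp add: \<kappa>_def cnj_fexp sum.distrib add_divide_distrib del: power_Suc of_nat_Suc)
  qed
  have Tm[measurable]: "T \<in> borel_measurable borel" unfolding T_def \<kappa>_def by measurable
  have err: "\<bar>poisson r t - T t\<bar> \<le> 2 * r ^ Suc M / (1 - r)" for t
  proof -
    have "\<bar>poisson r t - T t\<bar> = \<bar>Re (poisson_analytic r t - \<kappa> t)\<bar>"
      by (simp add: T_def poisson_analytic_eq[OF r])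
    also have "\<dots> \<le> norm (poisson_analytic r t - \<kappa> t)" by (rule abs_Re_le_cmod)
    also have "\<dots> \<le> 2 * r ^ Suc M / (1 - r)"
      unfolding \<kappa>_def by (rule poisson_analytic_approx[OF r])
    finally show ?thesis .
  qed
  have Tb: "\<bar>T t\<bar> \<le> 1 / (1 - r)\<^sup>2 + 2 * r ^ Suc M / (1 - r)" for t
    using err[of t] poisson_bounded(1)[OF r, of t] by linarith
  have fexpi: "integrable circle (\<lambda>t. fexp k t * f (x - t))" for k x
  proof (rule Bochner_Integration.integrable_bound)
    show "integrable circle (\<lambda>t. f (x - t))" using int integrable_circle_reflect[OF f per] by simp
  qed (auto simp: norm_mult)
  have one: "(\<integral>t. fexp k t * f (x - t) \<partial>circle) = (\<integral>t. fexp (- k) t * f t \<partial>circle) * fexp k x" for k x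
  proof -
    have "(\<integral>t. fexp k t * f (x - t) \<partial>circle) = (\<integral>t. fexp k x * (fexp (- k) t * f t) \<partial>circle)"
      by (subst integral_circle_convolution_commute) (auto simp: per periodic_fexp fexp_diff_arg mult.assoc)
    also have "\<dots> = fexp k x * (\<integral>t. fexp (- k) t * f t \<partial>circle)" by (rule integral_mult_right_zero)
    finally show ?thesis by (simp only: mult.commute)
  qed
  have "conv T f x = (\<integral>t. fexp 0 t * f (x - t) \<partial>circle)
      + (\<Sum>m<M. of_real r ^ Suc m * (\<integral>t. fexp (int (Suc m)) t * f (x - t) \<partial>circle)
         + of_real r ^ Suc m * (\<integral>t. fexp (- int (Suc m)) t * f (x - t) \<partial>circle))" for x
    using fexpi[of 0 x] fexpi by (simp add: T distrib_right sum_distrib_right mult.assoc del: power_Suc of_nat_Suc)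
  then have "trig_poly M (conv T f)"
    unfolding one mult.assoc[symmetric] by (simp only:) (intro trig_poly_add trig_poly_sum trig_poly_fexp; simp)
  then obtain a where a: "conv T f = trig_sum {- int M..int M} a"
    by (auto simp: trig_poly_iff)
  have "norm (poisson_mean r f x - trig_sum {- int M..int M} a x) \<le> d" for x
  proof -
    have "poisson_mean r f x - trig_sum {- int M..int M} a x = conv (\<lambda>t. poisson r t - T t) f x"
      unfolding poisson_mean_def fun_cong[OF a, symmetric]
      by (rule conv_diff_kernel[symmetric])
        (rule conv_integrable[OF poisson_measurable poisson_bounded(1)[OF r] f per int] conv_integrable[OF Tm Tb f per int])+
    also have "norm \<dots> \<le> 2 * r ^ Suc M / (1 - r) * ?L"
      by (rule norm_conv_le[OF _ err f per int]) measurable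
    finally show ?thesis using M by simp
  qed
  then show thesis using that by blast
qed

context young_function begin

lemma modular_double_finite:
  assumes D: "0 < D" "\<And>x. 0 < x \<Longrightarrow> \<phi> (2 * x) \<le> D * \<phi> x"
    and f[measurable]: "f \<in> borel_measurable borel" and s: "0 \<le> s" and fin: "modular \<phi> s f < \<infinity>"
  shows "modular \<phi> (2 ^ n * s) f < \<infinity>"
proof (induction n)
  case (Suc n)
  have "modular \<phi> (2 ^ Suc n * s) f \<le> (\<integral>\<^sup>+x. ennreal D * ennreal (\<phi> (2 ^ n * s * norm (f x))) \<partial>circle)"
    unfolding modular_def
  proof (rule nn_integral_mono)
    fix x
    have "\<phi> (2 * y) \<le> D * \<phi> y" if "0 \<le> y" for y
      using D(2)[of y] that by (cases "y = 0") auto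
    from this[of "2 ^ n * s * norm (f x)"] have "\<phi> (2 ^ Suc n * s * norm (f x)) \<le> D * \<phi> (2 ^ n * s * norm (f x))"
      using s by (simp add: mult.assoc)
    then show "ennreal (\<phi> (2 ^ Suc n * s * norm (f x))) \<le> ennreal D * ennreal (\<phi> (2 ^ n * s * norm (f x)))"
      using D s phi_nonneg by (subst ennreal_mult[symmetric]) (auto intro: ennreal_leI)
  qed
  also have "\<dots> = ennreal D * modular \<phi> (2 ^ n * s) f"
    unfolding modular_def using s by (intro nn_integral_cmult) auto
  also have "\<dots> < \<infinity>" using Suc by (simp add: ennreal_mult_less_top)
  finally show ?case .
qed (use fin in simp)

text \<open>
  This is what the doubling condition is for: finiteness of one modular implies finiteness of
  all of them.
\<close>

lemma modular_finite_all:
  assumes D: "0 < D" "\<And>x. 0 < x \<Longrightarrow> \<phi> (2 * x) \<le> D * \<phi> x"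
    and f: "f \<in> borel_measurable borel" and s: "0 < s" and fin: "modular \<phi> s f < \<infinity>" and c: "0 \<le> c"
  shows "modular \<phi> c f < \<infinity>"
proof -
  obtain n where "c / s < 2 ^ n" using real_arch_pow[of 2 "c / s"] by auto
  then have "c \<le> 2 ^ n * s" using s by (simp add: field_simps)
  then have "modular \<phi> c f \<le> modular \<phi> (2 ^ n * s) f" using c by (intro modular_mono_scale) auto
  also have "\<dots> < \<infinity>" by (rule modular_double_finite[OF D f _ fin]) (use s in auto)
  finally show ?thesis .
qed

text \<open>
  Jensen's inequality for the probability density \<open>poisson r\<close>, from the subgradient of \<open>\<phi>\<close> at
  the value of the left-hand side. The right-hand side may be infinite.
\<close>

lemma poisson_jensen:
  assumes f[measurable]: "f \<in> borel_measurable borel" and per: "periodic f" and int: "integrable circle f"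
    and r: "0 < r" "r < 1" and s: "0 \<le> s"
  shows "ennreal (\<phi> (s * norm (poisson_mean r f x)))
    \<le> (\<integral>\<^sup>+t. ennreal (poisson r t) * ennreal (\<phi> (s * norm (f (x - t)))) \<partial>circle)"
proof (cases "(\<integral>\<^sup>+t. ennreal (poisson r t * \<phi> (s * norm (f (x - t)))) \<partial>circle) < \<infinity>")
  case False
  then show ?thesis using poisson_nonneg[OF r] phi_nonneg s by (simp add: ennreal_mult less_top[symmetric])
next
  case True
  let ?w = "\<lambda>t. poisson r t * \<phi> (s * norm (f (x - t)))"
  define T where "T = s * norm (poisson_mean r f x)"
  have T0: "0 \<le> T" using s by (simp add: T_def)
  have [measurable]: "(\<lambda>t. \<phi> (s * norm (f (x - t)))) \<in> borel_measurable borel"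
    by (rule phi_norm_measurable[OF _ s]) measurable
  have w0: "0 \<le> ?w t" for t using poisson_nonneg[OF r] phi_nonneg s by simp
  have wi: "integrable circle ?w"
    using True w0 by (intro integrableI_nonneg) auto
  have fi: "integrable circle (\<lambda>t. f (x - t))" using int integrable_circle_reflect[OF f per] by simp
  have Pfi: "integrable circle (\<lambda>t. norm (of_real (poisson r t) * f (x - t)))"
    by (rule integrable_norm, rule integrable_circle_mult_bounded(1)[OF _ poisson_bounded(1)[OF r] fi]) measurable
  have Pni: "integrable circle (\<lambda>t. poisson r t * norm (f (x - t)))"
    using Pfi poisson_nonneg[OF r] by (simp add: norm_mult)
  have Pi: "integrable circle (poisson r)"
    by (rule integrable_circle_bounded[where B="1 / (1-r)\<^sup>2"]) (use poisson_bounded[OF r] in auto)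
  have "norm (poisson_mean r f x) \<le> (\<integral>t. norm (of_real (poisson r t) * f (x - t)) \<partial>circle)"
    unfolding poisson_mean_def by (rule integral_norm_bound)
  also have "\<dots> = (\<integral>t. poisson r t * norm (f (x - t)) \<partial>circle)"
    using poisson_nonneg[OF r] by (simp add: norm_mult)
  finally have "T \<le> s * (\<integral>t. poisson r t * norm (f (x - t)) \<partial>circle)"
    unfolding T_def using s by (rule mult_left_mono)
  then have "0 \<le> p T * (s * (\<integral>t. poisson r t * norm (f (x - t)) \<partial>circle) - T)"
    using p_nonneg[OF T0] by simp
  then have "\<phi> T \<le> (\<phi> T - p T * T) * (\<integral>t. poisson r t \<partial>circle) + p T * s * (\<integral>t. poisson r t * norm (f (x - t)) \<partial>circle)"
    by (simp add: integral_poisson[OF r] algebra_simps)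
  also have "\<dots> = (\<integral>t. (\<phi> T - p T * T) * poisson r t + p T * s * (poisson r t * norm (f (x - t))) \<partial>circle)"
    using Pi Pni by simp
  also have "\<dots> \<le> (\<integral>t. ?w t \<partial>circle)"
  proof (rule integral_mono)
    show "integrable circle (\<lambda>t. (\<phi> T - p T * T) * poisson r t + p T * s * (poisson r t * norm (f (x - t))))"
      using Pi Pni by simp
    fix t
    have "poisson r t * (\<phi> T + p T * (s * norm (f (x - t)) - T)) \<le> ?w t"
      using s T0 by (intro mult_left_mono phi_subgradient poisson_nonneg[OF r]) auto
    then show "(\<phi> T - p T * T) * poisson r t + p T * s * (poisson r t * norm (f (x - t))) \<le> ?w t"
      by (simp add: algebra_simps)
  qed (rule wi)
  finally have "ennreal (\<phi> T) \<le> ennreal (\<integral>t. ?w t \<partial>circle)" by (rule ennreal_leI)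
  also have "\<dots> = (\<integral>\<^sup>+t. ennreal (?w t) \<partial>circle)"
    by (rule nn_integral_eq_integral[symmetric]) (use wi w0 in auto)
  also have "\<dots> = (\<integral>\<^sup>+t. ennreal (poisson r t) * ennreal (\<phi> (s * norm (f (x - t)))) \<partial>circle)"
    using poisson_nonneg[OF r] phi_nonneg s by (intro nn_integral_cong ennreal_mult) auto
  finally show ?thesis unfolding T_def .
qed

lemma modular_poisson_mean:
  assumes f[measurable]: "f \<in> borel_measurable borel" and per: "periodic f" and int: "integrable circle f"
    and r: "0 < r" "r < 1" and s: "0 \<le> s"
  shows "modular \<phi> s (poisson_mean r f) \<le> modular \<phi> s f"
proof -
  interpret pair_sigma_finite circle circle ..
  let ?F = "\<lambda>y. ennreal (\<phi> (s * norm (f y)))"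
  have Fm[measurable]: "?F \<in> borel_measurable borel"
    using phi_norm_measurable[OF f s] by measurable
  have perF: "periodic ?F" using per by (simp add: periodic_def)
  have "modular \<phi> s (poisson_mean r f) \<le> (\<integral>\<^sup>+x. \<integral>\<^sup>+t. ennreal (poisson r t) * ?F (x - t) \<partial>circle \<partial>circle)"
    unfolding modular_def by (intro nn_integral_mono poisson_jensen[OF f per int r s])
  also have "\<dots> = (\<integral>\<^sup>+t. \<integral>\<^sup>+x. ennreal (poisson r t) * ?F (x - t) \<partial>circle \<partial>circle)"
    by (rule Fubini'[symmetric]) measurable
  also have "\<dots> = (\<integral>\<^sup>+t. ennreal (poisson r t) * modular \<phi> s f \<partial>circle)"
  proof (rule nn_integral_cong)
    fix t
    have "(\<integral>\<^sup>+x. ennreal (poisson r t) * ?F (x - t) \<partial>circle) = ennreal (poisson r t) * (\<integral>\<^sup>+x. ?F (x + (- t)) \<partial>circle)"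
      by (subst nn_integral_cmult[symmetric]) auto
    then show "(\<integral>\<^sup>+x. ennreal (poisson r t) * ?F (x - t) \<partial>circle) = ennreal (poisson r t) * modular \<phi> s f"
      by (simp only: nn_integral_circle_shift[OF Fm perF] modular_def)
  qed
  also have "\<dots> = (\<integral>\<^sup>+t. ennreal (poisson r t) \<partial>circle) * modular \<phi> s f"
    by (rule nn_integral_multc) measurable
  also have "(\<integral>\<^sup>+t. ennreal (poisson r t) \<partial>circle) = ennreal (\<integral>t. poisson r t \<partial>circle)"
    by (rule nn_integral_eq_integral, rule integrable_circle_bounded[where B="1 / (1-r)\<^sup>2"])
      (use poisson_bounded[OF r] poisson_nonneg[OF r] in auto)
  finally show ?thesis by (simp add: integral_poisson[OF r])
qed

text \<open>
  Poisson means converge almost everywhere, but there is no dominating function. Since they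
  do not increase the modular, Fatou's lemma applies to \<open>A j - B j\<close>, where \<open>B j\<close> is the
  integrand to be made small and \<open>A j\<close> its majorant from convexity: the integrals of \<open>A j\<close> do
  not exceed that of the limit of \<open>A j\<close>, so the integrals of \<open>B j\<close> cannot all be at least 1.
\<close>

lemma poisson_mean_modular_approx:
  assumes f[measurable]: "f \<in> borel_measurable borel" and per: "periodic f" and int: "integrable circle f"
    and c: "0 \<le> c" and fin: "modular \<phi> (2 * c) f < \<infinity>"
  obtains r where "0 < r" "r < 1" "modular \<phi> c (\<lambda>x. poisson_mean r f x - f x) \<le> 1"
proof -
  define \<rho> where "\<rho> = (\<lambda>j. 1 - inverse (real (Suc (Suc j))))"
  have \<rho>: "0 < \<rho> j" "\<rho> j < 1" for j by (auto simp: \<rho>_def field_simps)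
  let ?u = "\<lambda>j. poisson_mean (\<rho> j) f"
  let ?I = "modular \<phi> (2 * c) f"
  have "filterlim (\<lambda>j. inverse (real (Suc (Suc j)))) (at_right 0) sequentially"
    by (rule filterlim_inverse_at_right_top[THEN filterlim_compose])
      (intro filterlim_compose[OF filterlim_real_sequentially] filterlim_compose[OF filterlim_Suc] filterlim_Suc)
  then have lim: "AE x in lborel. (\<lambda>j. ?u j x) \<longlonglongrightarrow> f x"
    using poisson_AE_tendsto[OF f per int]
    by (auto elim!: eventually_mono simp: poisson_mean_def \<rho>_def dest: filterlim_compose)
  have "\<exists>j. modular \<phi> c (\<lambda>x. ?u j x - f x) \<le> 1"
  proof (rule ccontr)
    assume "\<nexists>j. modular \<phi> c (\<lambda>x. ?u j x - f x) \<le> 1"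
    then have gt: "1 \<le> modular \<phi> c (\<lambda>x. ?u j x - f x)" for j by (meson le_cases)
    define A where "A = (\<lambda>j x. (\<phi> (2 * c * norm (?u j x)) + \<phi> (2 * c * norm (f x))) / 2)"
    define B where "B = (\<lambda>j x. \<phi> (c * norm (?u j x - f x)))"
    have c2: "0 \<le> 2 * c" using c by simp
    have um: "(\<lambda>x. \<phi> (2 * c * norm (?u j x))) \<in> borel_measurable borel" for j
      by (rule phi_norm_measurable[OF _ c2]) measurable
    have fm: "(\<lambda>x. \<phi> (2 * c * norm (f x))) \<in> borel_measurable borel"
      by (rule phi_norm_measurable[OF f c2])
    have Am[measurable]: "A j \<in> borel_measurable borel" for j
      unfolding A_def by (intro borel_measurable_divide borel_measurable_add um fm borel_measurable_const)
    have Bm[measurable]: "B j \<in> borel_measurable borel" for j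
      unfolding B_def by (rule phi_norm_measurable[OF _ c]) measurable
    have B0: "0 \<le> B j x" for j x unfolding B_def using c by (intro phi_nonneg) auto
    have BA: "B j x \<le> A j x" for j x
    proof -
      have "c * norm (?u j x - f x) \<le> c * (norm (?u j x) + norm (f x))"
        using c by (intro mult_left_mono norm_triangle_ineq4)
      then have "c * norm (?u j x - f x) \<le> (2 * c * norm (?u j x) + 2 * c * norm (f x)) / 2"
        by (simp add: algebra_simps)
      then have "B j x \<le> \<phi> ((2 * c * norm (?u j x) + 2 * c * norm (f x)) / 2)"
        unfolding B_def using c by (intro phi_mono) auto
      also have "\<dots> \<le> \<phi> (2 * c * norm (?u j x)) / 2 + \<phi> (2 * c * norm (f x)) / 2"
        using c by (intro phi_midpoint) auto
      also have "\<dots> = A j x" by (simp only: A_def add_divide_distrib)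
      finally show ?thesis .
    qed
    have Aint: "(\<integral>\<^sup>+x. ennreal (A j x) \<partial>circle) \<le> ?I" for j
    proof -
      have "(\<integral>\<^sup>+x. ennreal (A j x) \<partial>circle)
          = (\<integral>\<^sup>+x. (ennreal (\<phi> (2 * c * norm (?u j x))) + ennreal (\<phi> (2 * c * norm (f x)))) / 2 \<partial>circle)"
      proof (rule nn_integral_cong)
        fix x
        have "0 \<le> \<phi> (2 * c * norm (?u j x))" "0 \<le> \<phi> (2 * c * norm (f x))" using c by (auto intro!: phi_nonneg)
        then show "ennreal (A j x) = (ennreal (\<phi> (2 * c * norm (?u j x))) + ennreal (\<phi> (2 * c * norm (f x)))) / 2"
          unfolding A_def by (subst divide_ennreal[symmetric]) auto
      qed
      also have "\<dots> = (\<integral>\<^sup>+x. ennreal (\<phi> (2 * c * norm (?u j x))) + ennreal (\<phi> (2 * c * norm (f x))) \<partial>circle) / 2"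
        using um fm by (intro nn_integral_divide) simp
      also have "\<dots> = (modular \<phi> (2 * c) (?u j) + ?I) / 2"
        unfolding modular_def using um fm by (subst nn_integral_add) auto
      also have "\<dots> \<le> (?I + ?I) / 2"
        by (intro divide_right_mono_ennreal add_right_mono modular_poisson_mean[OF f per int \<rho> c2])
      also have "\<dots> = ?I"
      proof -
        obtain i where i: "?I = ennreal i" "0 \<le> i" using fin by (cases ?I) auto
        have "(ennreal i + ennreal i) / 2 = ennreal ((i + i) / 2)"
          using i(2) by (subst divide_ennreal[symmetric]) (simp_all add: ennreal_plus[symmetric] del: ennreal_plus)
        then show ?thesis by (simp add: i(1))
      qed
      finally show ?thesis .
    qed
    have diff: "(\<integral>\<^sup>+x. ennreal (A j x - B j x) \<partial>circle) + 1 \<le> ?I" for j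
    proof -
      have "(\<integral>\<^sup>+x. ennreal (A j x - B j x) \<partial>circle) + 1 \<le> (\<integral>\<^sup>+x. ennreal (A j x - B j x) \<partial>circle) + (\<integral>\<^sup>+x. ennreal (B j x) \<partial>circle)"
        using gt[of j] by (intro add_left_mono) (simp add: modular_def B_def)
      also have "\<dots> = (\<integral>\<^sup>+x. ennreal (A j x - B j x) + ennreal (B j x) \<partial>circle)"
        by (rule nn_integral_add[symmetric]) measurable
      also have "\<dots> = (\<integral>\<^sup>+x. ennreal (A j x) \<partial>circle)"
        using B0 BA by (intro nn_integral_cong) (simp add: ennreal_plus[symmetric] del: ennreal_plus)
      also have "\<dots> \<le> ?I" by (rule Aint)
      finally show ?thesis .
    qed
    have AB: "AE x in circle. (\<lambda>j. ennreal (A j x - B j x)) \<longlonglongrightarrow> ennreal (\<phi> (2 * c * norm (f x)))"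
      using AE_circle[OF lim]
    proof eventually_elim
      case (elim x)
      have "(\<lambda>j. A j x) \<longlonglongrightarrow> (\<phi> (2 * c * norm (f x)) + \<phi> (2 * c * norm (f x))) / 2"
        unfolding A_def using c elim by (intro tendsto_intros phi_tendsto) auto
      moreover have "(\<lambda>j. B j x) \<longlonglongrightarrow> \<phi> (c * norm (f x - f x))"
        unfolding B_def using c elim by (intro tendsto_intros phi_tendsto) auto
      ultimately have "(\<lambda>j. A j x - B j x) \<longlonglongrightarrow> \<phi> (2 * c * norm (f x))"
        using tendsto_diff by fastforce
      then show ?case by (rule tendsto_ennrealI)
    qed
    have "?I = (\<integral>\<^sup>+x. liminf (\<lambda>j. ennreal (A j x - B j x)) \<partial>circle)"
      unfolding modular_def
    proof (rule nn_integral_cong_AE)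
      show "AE x in circle. ennreal (\<phi> (2 * c * norm (f x))) = liminf (\<lambda>j. ennreal (A j x - B j x))"
        using AB by eventually_elim (simp add: lim_imp_Liminf)
    qed
    also have "\<dots> \<le> liminf (\<lambda>j. \<integral>\<^sup>+x. ennreal (A j x - B j x) \<partial>circle)"
      by (rule nn_integral_liminf) measurable
    also have "\<dots> \<le> liminf (\<lambda>j. ?I - 1)"
      by (intro Liminf_mono always_eventually allI) (simp add: ennreal_le_minus_iff diff)
    also have "\<dots> = ?I - 1" by (rule Liminf_const) simp
    finally have *: "?I \<le> ?I - 1" .
    have "1 \<le> ?I" using diff[of 0] by (meson add_increasing order_refl order_trans zero_le le_add_same_cancel2)
    then show False using * fin
      by (cases ?I) (auto simp: ennreal_minus ennreal_le_iff simp flip: ennreal_1)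
  qed
  then show thesis using that \<rho> by blast
qed

lemma trig_sum_modular_approx:
  assumes f[measurable]: "f \<in> borel_measurable borel" and per: "periodic f" and int: "integrable circle f"
    and c: "0 < c" and fin: "modular \<phi> (4 * c) f < \<infinity>"
  obtains A a where "finite A" "modular \<phi> c (\<lambda>x. trig_sum A a x - f x) \<le> 1"
proof -
  obtain r where r: "0 < r" "r < 1" "modular \<phi> (2 * c) (\<lambda>x. poisson_mean r f x - f x) \<le> 1"
    using poisson_mean_modular_approx[OF f per int, of "2 * c"] c fin by (auto simp: mult.assoc[symmetric])
  have p1: "0 < p 1" by (rule p_pos) simp
  \<comment> \<open>With \<open>y = 2 * c * d\<close>, \<open>\<phi> y \<le> p y * y \<le> p 1 * y \<le> 1\<close> because \<open>y \<le> 1\<close>.\<close>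
  define d where "d = min 1 (1 / p 1) / (2 * c)"
  have d: "0 < d" "2 * c * d \<le> 1" "p 1 * (2 * c * d) \<le> 1" using c p1 by (auto simp: d_def min_def field_simps)
  obtain M a where a: "\<And>x. norm (poisson_mean r f x - trig_sum {- int M..int M} a x) \<le> d"
    using poisson_mean_trig_approx[OF f per int r(1,2) d(1)] by blast
  have small: "\<phi> (2 * c * d) \<le> 1"
  proof -
    have "\<phi> (2 * c * d) \<le> p (2 * c * d) * (2 * c * d)" using c d by (intro phi_le_p) auto
    also have "\<dots> \<le> p 1 * (2 * c * d)"
      using p_mono c d by (intro mult_right_mono) (auto simp: mono_on_def)
    finally show ?thesis using d by simp
  qed
  have "modular \<phi> (2 * c) (\<lambda>x. poisson_mean r f x - trig_sum {- int M..int M} a x) \<le> (\<integral>\<^sup>+x. 1 \<partial>circle)"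
    unfolding modular_def
  proof (rule nn_integral_mono)
    fix x
    have "\<phi> (2 * c * norm (poisson_mean r f x - trig_sum {- int M..int M} a x)) \<le> \<phi> (2 * c * d)"
      using c a by (intro phi_mono mult_left_mono) auto
    then show "ennreal (\<phi> (2 * c * norm (poisson_mean r f x - trig_sum {- int M..int M} a x))) \<le> 1"
      using small by (simp add: ennreal_le_1)
  qed
  then have "modular \<phi> (2 * c) (\<lambda>x. poisson_mean r f x - trig_sum {- int M..int M} a x) \<le> 1"
    by (simp add: emeasure_circle_UNIV)
  moreover have "norm (trig_sum {- int M..int M} a x - f x)
      \<le> norm (poisson_mean r f x - trig_sum {- int M..int M} a x) + norm (poisson_mean r f x - f x)" for x
    using norm_triangle_ineq[of "trig_sum {- int M..int M} a x - poisson_mean r f x" "poisson_mean r f x - f x"]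
    by (simp add: norm_minus_commute)
  ultimately have "modular \<phi> (2 * c / 2) (\<lambda>x. trig_sum {- int M..int M} a x - f x) \<le> 1"
    using c r(3) by (intro modular_add_le_1[where f = "\<lambda>x. poisson_mean r f x - trig_sum {- int M..int M} a x"
      and g = "\<lambda>x. poisson_mean r f x - f x"]) auto
  then show thesis using that[of "{- int M..int M}" a] by simp
qed


section \<open>Extension of conjugation to the Orlicz space\<close>

text \<open>
  Trigonometric sums \<open>P j\<close> with \<open>modular \<phi> (2 ^ j) (P j - f) \<le> 1\<close> have conjugates \<open>q j\<close> whose
  increments are summable in \<open>L\<^sup>1\<close>, at the rate \<open>2 ^ - j\<close>. So \<open>q j\<close> converges almost
  everywhere and in \<open>L\<^sup>1\<close>. The bound for the limit is Fatou's lemma, and its relation to \<open>f\<close>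
  is that between \<open>P j\<close> and \<open>q j\<close>, telescoped.
\<close>

lemma conjugate_extension:
  assumes K: "0 < K"
    and H: "conj_bound \<phi> K"
    and f[measurable]: "f \<in> borel_measurable borel" and per: "periodic f" and int: "integrable circle f"
    and M: "modular \<phi> 1 f \<le> 1" and fin: "\<And>c. 0 \<le> c \<Longrightarrow> modular \<phi> c f < \<infinity>"
  obtains g where "g \<in> borel_measurable borel" "periodic g" "integrable circle g"
    "modular \<phi> (1 / (2 * K)) g \<le> 1"
    "conjugate_function f g"
proof -
  have "\<exists>A a. finite A \<and> modular \<phi> (2 ^ j) (\<lambda>x. trig_sum A a x - f x) \<le> 1" for j :: nat
  proof (rule trig_sum_modular_approx[OF f per int])
    show "modular \<phi> (4 * 2 ^ j) f < \<infinity>" by (rule fin) simp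
  qed auto
  then obtain A a where A: "\<And>j. finite (A j)"
    and Ma: "\<And>j. modular \<phi> (2 ^ j) (\<lambda>x. trig_sum (A j) (a j) x - f x) \<le> 1"
    by metis
  define P where "P = (\<lambda>j. trig_sum (A j) (a j))"
  define q where "q = (\<lambda>j. trig_sum (A j) (conj_coeff (a j)))"
  have [measurable]: "P j \<in> borel_measurable borel" "q j \<in> borel_measurable borel" for j
    by (simp_all add: P_def q_def)
  define \<kappa> where "\<kappa> = 1 + 1 / p 1"
  have Pf: "integrable circle (\<lambda>x. P j x - f x)" "(\<integral>x. norm (P j x - f x) \<partial>circle) \<le> \<kappa> / 2 ^ j" for j
    using modular_L1[OF _ _ Ma[of j]] by (auto simp: P_def \<kappa>_def)
  have "\<exists>B b. finite B \<and> (\<forall>x. trig_sum B b x = P (Suc j) x - P j x)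
      \<and> (\<forall>x. trig_sum B (conj_coeff b) x = q (Suc j) x - q j x)" for j
    unfolding P_def q_def by (rule trig_sum_diff[OF A[of "Suc j"] A[of j]]) blast
  then obtain B b where B: "\<And>j. finite (B j)" and Pd: "\<And>j x. trig_sum (B j) (b j) x = P (Suc j) x - P j x"
    and qd': "\<And>j x. trig_sum (B j) (conj_coeff (b j)) x = q (Suc j) x - q j x"
    by metis
  define d where "d = (\<lambda>j. trig_sum (B j) (conj_coeff (b j)))"
  have qd: "d j x = q (Suc j) x - q j x" for j x unfolding d_def by (rule qd')
  have [measurable]: "d j \<in> borel_measurable borel" for j by (simp add: d_def)
  have dM: "modular \<phi> (2 ^ j / 2 / K) (d j) \<le> 1" for j
  proof -
    have "modular \<phi> (2 ^ j) (\<lambda>x. P (Suc j) x - f x) \<le> modular \<phi> (2 ^ Suc j) (\<lambda>x. P (Suc j) x - f x)"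
      by (rule modular_mono_scale) auto
    also have "\<dots> \<le> 1" unfolding P_def by (rule Ma)
    finally have 1: "modular \<phi> (2 ^ j) (\<lambda>x. P (Suc j) x - f x) \<le> 1" .
    have 2: "modular \<phi> (2 ^ j) (\<lambda>x. P j x - f x) \<le> 1" unfolding P_def by (rule Ma)
    have tri: "norm (trig_sum (B j) (b j) x) \<le> norm (P (Suc j) x - f x) + norm (P j x - f x)" for x
      unfolding Pd using norm_triangle_ineq4[of "P (Suc j) x - f x" "P j x - f x"] by simp
    have "modular \<phi> (2 ^ j / 2) (trig_sum (B j) (b j)) \<le> 1"
      by (rule modular_add_le_1[OF _ _ _ tri 1 2]) auto
    then show ?thesis unfolding d_def
      by (intro conj_bound_scaled[OF K H B]) auto
  qed
  have d1: "integrable circle (d j)" "(\<integral>x. norm (d j x) \<partial>circle) \<le> (2 * K * \<kappa>) * (1 / 2) ^ j" for j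
    using modular_L1[OF _ _ dM[of j]] K by (auto simp: \<kappa>_def field_simps)
  have p1: "0 < p 1" by (rule p_pos) simp
  have gs: "summable (\<lambda>j. (2 * K * \<kappa>) * (1 / 2 :: real) ^ j)" by (intro summable_mult summable_geometric) simp
  have dsum: "summable (\<lambda>j. \<integral>x. norm (d j x) \<partial>circle)"
    by (rule summable_comparison_test'[OF gs, of 0]) (use d1 in \<open>simp add: Bochner_Integration.integral_nonneg\<close>)
  have AEs: "AE x in circle. summable (\<lambda>j. norm (d j x))"
  proof -
    have "(\<integral>\<^sup>+x. (\<Sum>j. ennreal (norm (d j x))) \<partial>circle) = (\<Sum>j. \<integral>\<^sup>+x. ennreal (norm (d j x)) \<partial>circle)"
      by (rule nn_integral_suminf) measurable
    also have "\<dots> = (\<Sum>j. ennreal (\<integral>x. norm (d j x) \<partial>circle))"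
      using d1(1) by (intro suminf_cong nn_integral_eq_integral) auto
    also have "\<dots> \<noteq> \<infinity>"
      using dsum by (simp add: suminf_ennreal2 Bochner_Integration.integral_nonneg)
    finally have "AE x in circle. (\<Sum>j. ennreal (norm (d j x))) \<noteq> \<infinity>"
      by (intro nn_integral_PInf_AE) auto
    then show ?thesis by eventually_elim (rule summable_suminf_not_top, auto)
  qed
  define S where "S = (\<lambda>x. \<Sum>j. d j x)"
  define g where "g = (\<lambda>x. q 0 x + S x)"
  have Sm[measurable]: "S \<in> borel_measurable borel" unfolding S_def by measurable
  have gm[measurable]: "g \<in> borel_measurable borel" unfolding g_def by measurable
  have Si: "integrable circle S" unfolding S_def by (rule integrable_suminf[OF d1(1) AEs dsum])
  have gi: "integrable circle g" unfolding g_def q_def using Si integrable_trig_sum by simp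
  have perd: "periodic (d j)" and perq: "periodic (q j)" for j
    by (simp_all add: d_def q_def periodic_trig_sum)
  have perg: "periodic g"
    using perd perq by (simp add: periodic_def g_def S_def)
  have conj: "conv (conj_poisson r) f x = conv (poisson r) g x"
    if r: "0 < r" "r < 1" for r x
  proof -
    define L where "L = (\<lambda>j. conv (conj_poisson r) (P j) x)"
    define L0 where "L0 = conv (conj_poisson r) f x"
    let ?k = "\<lambda>t. complex_of_real (poisson r (x - t))"
    have comm: "conv (poisson r) h x = (\<integral>t. ?k t * h t \<partial>circle)"
      if "h \<in> borel_measurable borel" "periodic h" for h
      by (rule integral_circle_convolution_commute[of h "\<lambda>t. of_real (poisson r t)"])
        (use that periodic_poisson in \<open>auto simp: periodic_def\<close>)
    have kb: "\<bar>poisson r (x - t)\<bar> \<le> 1 / (1 - r)\<^sup>2" for t by (rule poisson_bounded(1)[OF r])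
    have Lq: "L j = (\<integral>t. ?k t * q j t \<partial>circle)" for j
      unfolding L_def P_def conj_poisson_trig_sum[OF r] q_def[symmetric]
      unfolding fun_cong[OF q_def, symmetric] by (rule comm[OF _ perq]) measurable
    have qi: "integrable circle (q j)" for j by (simp add: q_def integrable_trig_sum)
    have kqi: "integrable circle (\<lambda>t. ?k t * q j t)" for j
      by (rule integrable_circle_mult_bounded(1)[OF _ kb qi]) measurable
    have kdi: "integrable circle (\<lambda>t. ?k t * d j t)" for j
      by (rule integrable_circle_mult_bounded(1)[OF _ kb d1(1)]) measurable
    have dL: "(\<integral>t. ?k t * d j t \<partial>circle) = L (Suc j) - L j" for j
      unfolding Lq qd using kqi by (simp add: right_diff_distrib)
    have "L \<longlonglongrightarrow> L0"
    proof (rule LIM_zero_cancel, rule Lim_null_comparison)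
      show "\<forall>\<^sub>F j in sequentially. norm (L j - L0) \<le> 2 / (1 - r)\<^sup>2 * (\<kappa> * (1 / 2) ^ j)"
      proof (intro always_eventually allI)
        fix j
        note Q = conj_poisson_measurable poisson_bounded(2)[OF r]
        have "L j - L0 = conv (conj_poisson r) (\<lambda>t. P j t - f t) x"
          unfolding L_def L0_def P_def
          by (rule conv_diff[symmetric, OF conv_integrable[OF Q trig_sum_measurable periodic_trig_sum integrable_trig_sum]
            conv_integrable[OF Q f per int]])
        also have "norm \<dots> \<le> 2 / (1 - r)\<^sup>2 * (\<integral>t. norm (P j t - f t) \<partial>circle)"
          by (rule norm_conv_le[OF Q]) (use per periodic_trig_sum Pf(1) in \<open>auto simp: periodic_def P_def\<close>)
        also have "\<dots> \<le> 2 / (1 - r)\<^sup>2 * (\<kappa> * (1 / 2) ^ j)"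
          using Pf(2)[of j] by (intro mult_left_mono) (simp_all add: power_divide)
        finally show "norm (L j - L0) \<le> 2 / (1 - r)\<^sup>2 * (\<kappa> * (1 / 2) ^ j)" .
      qed
      have "(\<lambda>j. 2 / (1 - r)\<^sup>2 * (\<kappa> * (1 / 2) ^ j)) \<longlonglongrightarrow> 2 / (1 - r)\<^sup>2 * (\<kappa> * 0)"
        by (intro tendsto_mult tendsto_const LIMSEQ_realpow_zero) auto
      then show "(\<lambda>j. 2 / (1 - r)\<^sup>2 * (\<kappa> * (1 / 2) ^ j)) \<longlonglongrightarrow> 0" by simp
    qed
    then have tele: "(\<lambda>j. L (Suc j) - L j) sums (L0 - L 0)" by (rule telescope_sums)
    have kS: "?k t * S t = (\<Sum>j. ?k t * d j t)" if "summable (\<lambda>j. norm (d j t))" for t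
      unfolding S_def by (rule suminf_mult[symmetric]) (rule summable_norm_cancel[OF that])
    have "(\<lambda>j. \<integral>t. ?k t * d j t \<partial>circle) sums (\<integral>t. (\<Sum>j. ?k t * d j t) \<partial>circle)"
    proof (rule sums_integral[OF kdi])
      show "AE t in circle. summable (\<lambda>j. norm (?k t * d j t))"
        using AEs by eventually_elim (simp only: norm_mult summable_mult)
      show "summable (\<lambda>j. \<integral>t. norm (?k t * d j t) \<partial>circle)"
      proof (rule summable_comparison_test'[OF summable_mult[OF dsum, of "1 / (1 - r)\<^sup>2"], of 0])
        fix j
        show "norm (\<integral>t. norm (?k t * d j t) \<partial>circle) \<le> 1 / (1 - r)\<^sup>2 * (\<integral>t. norm (d j t) \<partial>circle)"
          using integrable_circle_mult_bounded(2)[OF _ kb d1(1)[of j]]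
          by (simp add: Bochner_Integration.integral_nonneg)
      qed
    qed
    then have "(\<integral>t. (\<Sum>j. ?k t * d j t) \<partial>circle) = L0 - L 0"
      unfolding dL using tele by (rule sums_unique2)
    moreover have "(\<integral>t. ?k t * S t \<partial>circle) = (\<integral>t. (\<Sum>j. ?k t * d j t) \<partial>circle)"
    proof (rule integral_cong_AE)
      show "AE t in circle. ?k t * S t = (\<Sum>j. ?k t * d j t)"
        using AEs by eventually_elim (rule kS)
    qed measurable
    ultimately have kSi: "(\<integral>t. ?k t * S t \<partial>circle) = L0 - L 0" by simp
    have "conv (poisson r) g x = (\<integral>t. ?k t * g t \<partial>circle)"
      by (rule comm[OF gm perg])
    also have "\<dots> = (\<integral>t. ?k t * q 0 t + ?k t * S t \<partial>circle)" by (simp add: g_def distrib_left)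
    also have "\<dots> = (\<integral>t. ?k t * q 0 t \<partial>circle) + (\<integral>t. ?k t * S t \<partial>circle)"
      by (rule Bochner_Integration.integral_add[OF kqi])
        (rule integrable_circle_mult_bounded(1)[OF _ kb Si], measurable)
    also have "\<dots> = L0" by (simp add: kSi Lq)
    finally show ?thesis by (simp add: L0_def)
  qed
  have qM: "modular \<phi> (1 / (2 * K)) (q j) \<le> 1" for j
  proof -
    have "modular \<phi> 1 (\<lambda>x. P j x - f x) \<le> modular \<phi> (2 ^ j) (\<lambda>x. P j x - f x)"
      by (rule modular_mono_scale) auto
    also have "\<dots> \<le> 1" unfolding P_def by (rule Ma)
    finally have 1: "modular \<phi> 1 (\<lambda>x. P j x - f x) \<le> 1" .
    have tri: "norm (trig_sum (A j) (a j) x) \<le> norm (P j x - f x) + norm (f x)" for x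
      using norm_triangle_ineq[of "P j x - f x" "f x"] by (simp add: P_def)
    have "modular \<phi> (1 / 2) (trig_sum (A j) (a j)) \<le> 1"
      by (rule modular_add_le_1[OF _ _ _ tri 1 M]) auto
    then have "modular \<phi> (1 / 2 / K) (q j) \<le> 1" unfolding q_def
      by (intro conj_bound_scaled[OF K H A]) auto
    then show ?thesis by (simp add: mult.commute)
  qed
  have qlim: "AE x in circle. (\<lambda>j. q j x) \<longlonglongrightarrow> g x"
    using AEs
  proof eventually_elim
    case (elim x)
    have "(\<lambda>j. d j x) sums S x" unfolding S_def by (rule summable_sums) (rule summable_norm_cancel[OF elim])
    then have "(\<lambda>n. q 0 x + (\<Sum>j<n. d j x)) \<longlonglongrightarrow> g x"
      unfolding g_def sums_def by (intro tendsto_intros)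
    moreover have "q 0 x + (\<Sum>j<n. d j x) = q n x" for n
      unfolding qd by (induction n) (simp_all add: algebra_simps)
    ultimately show ?case by simp
  qed
  have gM: "modular \<phi> (1 / (2 * K)) g \<le> 1"
  proof -
    let ?s = "1 / (2 * K)"
    have s: "0 \<le> ?s" using K by simp
    have "modular \<phi> ?s g = (\<integral>\<^sup>+x. liminf (\<lambda>j. ennreal (\<phi> (?s * norm (q j x)))) \<partial>circle)"
      unfolding modular_def
    proof (rule nn_integral_cong_AE)
      show "AE x in circle. ennreal (\<phi> (?s * norm (g x))) = liminf (\<lambda>j. ennreal (\<phi> (?s * norm (q j x))))"
        using qlim
      proof eventually_elim
        case (elim x)
        have "(\<lambda>j. \<phi> (?s * norm (q j x))) \<longlonglongrightarrow> \<phi> (?s * norm (g x))"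
          using s elim by (intro phi_tendsto tendsto_intros) auto
        then have "(\<lambda>j. ennreal (\<phi> (?s * norm (q j x)))) \<longlonglongrightarrow> ennreal (\<phi> (?s * norm (g x)))"
          by (rule tendsto_ennrealI)
        then show ?case by (intro lim_imp_Liminf[symmetric]) auto
      qed
    qed
    also have "\<dots> \<le> liminf (\<lambda>j. modular \<phi> ?s (q j))"
      unfolding modular_def
    proof (rule nn_integral_liminf)
      fix j
      have "(\<lambda>x. \<phi> (?s * norm (q j x))) \<in> borel_measurable borel"
        by (rule phi_norm_measurable[OF _ s]) measurable
      then show "(\<lambda>x. ennreal (\<phi> (?s * norm (q j x)))) \<in> borel_measurable circle" by simp
    qed
    also have "\<dots> \<le> liminf (\<lambda>j. 1)" by (intro Liminf_mono always_eventually allI qM)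
    also have "\<dots> = 1" by (rule Liminf_const) simp
    finally show ?thesis .
  qed
  have "conjugate_function f g" unfolding conjugate_function_def using conj by blast
  then show thesis by (rule that[OF gm perg gi gM])
qed

section \<open>The equivalence\<close>

text \<open>
  For each \<open>l\<close> admissible in the norm of \<open>f\<close>, the conjugate of \<open>f / l\<close>, multiplied by \<open>l\<close>, is
  almost everywhere the Hilbert transform of \<open>f\<close>, so \<open>2 * K * l\<close> is admissible for the latter.
  Working with \<open>f\<close> itself instead of \<open>hilbert_transform (f / l)\<close> avoids homogeneity of a limit
  that may fail to exist.
\<close>

lemma hilbert_bounded_of_conj_bound:
  assumes D: "Delta2 \<phi>" and K: "0 < K"
    and H: "conj_bound \<phi> K"
  shows "hilbert_bounded_on_Lphi \<phi>"
proof -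
  obtain D where D: "0 < D" "\<And>x. 0 < x \<Longrightarrow> \<phi> (2 * x) \<le> D * \<phi> x"
    using assms(1) unfolding Delta2_def by blast
  let ?C = "2 * K"
  have main: "hilbert_transform f \<in> Lphi \<phi> \<and> Lphi_norm \<phi> (hilbert_transform f) \<le> ennreal ?C * Lphi_norm \<phi> f"
    if f: "f \<in> Lphi \<phi>" for f
  proof -
    have fL1: "f \<in> L1_circle" and fnorm: "Lphi_norm \<phi> f < \<infinity>" using f by (auto simp: Lphi_def)
    obtain f0 where f0[measurable]: "f0 \<in> borel_measurable borel" and per0: "periodic f0"
      and int0: "integrable circle f0" and eq0: "AE x in lborel. f x = f0 x"
      using L1_circle_borel_representative[OF fL1] by blast
    have perf: "periodic f" using fL1 by (auto simp: L1_circle_def periodic_def)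
    have step: "\<exists>g. g \<in> borel_measurable borel \<and> integrable circle g \<and>
        (AE x in lborel. hilbert_transform f x = g x) \<and> modular \<phi> (1 / (?C * l)) g \<le> 1"
      if l: "0 < l" and Ml: "modular \<phi> (1 / l) f0 \<le> 1" for l
    proof -
      define h where "h = (\<lambda>x. f0 x / of_real l)"
      have hs: "modular \<phi> s h = modular \<phi> (s / l) f0" for s
        using l by (simp add: modular_def h_def norm_divide)
      have hm: "h \<in> borel_measurable borel" and hper: "periodic h" and hint: "integrable circle h"
        using per0 int0 by (simp_all add: h_def periodic_def)
      have M1: "modular \<phi> 1 h \<le> 1" using Ml by (simp add: hs)
      have fin: "modular \<phi> c h < \<infinity>" if "0 \<le> c" for c
        by (rule modular_finite_all[OF D hm, of 1]) (use M1 that in \<open>auto simp: less_top[symmetric] top_unique\<close>)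
      obtain g where g[measurable]: "g \<in> borel_measurable borel" and perg: "periodic g" and intg: "integrable circle g"
        and gM: "modular \<phi> (1 / ?C) g \<le> 1"
        and gc: "conjugate_function h g"
        by (rule conjugate_extension[OF K H hm hper hint M1 fin])
      let ?g = "\<lambda>x. of_real l * g x"
      have "AE x in lborel. hilbert_transform f x = ?g x"
      proof (rule hilbert_transform_AE[OF eq0 f0 per0 int0])
        show "?g \<in> borel_measurable borel" by measurable
        show "periodic ?g" using perg by (simp add: periodic_def)
        show "integrable circle ?g" using intg by simp
        show "conjugate_function f0 ?g"
          unfolding conjugate_function_def
        proof (intro allI impI)
          fix r x :: real assume r: "0 < r" "r < 1"
          have "conv (conj_poisson r) f0 x = of_real l * conv (conj_poisson r) h x"
            unfolding integral_mult_right_zero[symmetric]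
            using l by (intro Bochner_Integration.integral_cong) (auto simp: h_def)
          also have "\<dots> = of_real l * conv (poisson r) g x"
            using gc r by (simp add: conjugate_function_def)
          also have "\<dots> = conv (poisson r) ?g x"
            unfolding integral_mult_right_zero[symmetric]
            by (intro Bochner_Integration.integral_cong) (auto simp: mult_ac)
          finally show "conv (conj_poisson r) f0 x = conv (poisson r) ?g x" .
        qed
      qed
      moreover have "modular \<phi> (1 / (?C * l)) ?g \<le> 1"
        using gM l K by (simp add: modular_def norm_mult)
      moreover have "?g \<in> borel_measurable borel" "integrable circle ?g" using intg by auto
      ultimately show ?thesis by blast
    qed
    let ?S = "{l :: real. 0 < l \<and> ennreal (1 / (2 * pi)) * (\<integral>\<^sup>+ x \<in> {-pi..pi}. ennreal (\<phi> (cmod (f x) / l)) \<partial>lebesgue) \<le> 1}"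
    have S: "0 < l \<and> modular \<phi> (1 / l) f0 \<le> 1" if "l \<in> ?S" for l
      using that Lphi_constraint_eq_modular[OF f0 eq0] by auto
    have bound: "Lphi_norm \<phi> (hilbert_transform f) \<le> ennreal ?C * Lphi_norm \<phi> f"
      unfolding Lphi_norm_def
    proof (rule INF_le_mult_INF)
      fix l assume "l \<in> ?S"
      from S[OF this] have l: "0 < l" "modular \<phi> (1 / l) f0 \<le> 1" by blast+
      obtain g where g: "g \<in> borel_measurable borel" "AE x in lborel. hilbert_transform f x = g x"
        "modular \<phi> (1 / (?C * l)) g \<le> 1" using step[OF l] by blast
      have "0 < ?C * l" using K l by simp
      then show "?C * l \<in> {l. 0 < l \<and> ennreal (1 / (2 * pi)) *
          (\<integral>\<^sup>+ x \<in> {-pi..pi}. ennreal (\<phi> (cmod (hilbert_transform f x) / l)) \<partial>lebesgue) \<le> 1}"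
        using Lphi_constraint_eq_modular[OF g(1,2)] g(3) by auto
    qed (use K in auto)
    obtain l where "l \<in> ?S" using fnorm unfolding Lphi_norm_def INF_less_iff by blast
    from S[OF this] have l: "0 < l" "modular \<phi> (1 / l) f0 \<le> 1" by blast+
    obtain g where g: "g \<in> borel_measurable borel" "integrable circle g" "AE x in lborel. hilbert_transform f x = g x"
      using step[OF l] by blast
    have "hilbert_transform f \<in> L1_circle"
      by (rule L1_circleI[OF g(1,2) periodic_hilbert_transform[OF perf] g(3)])
    moreover have "ennreal ?C * Lphi_norm \<phi> f < \<infinity>" using fnorm by (simp add: ennreal_mult_less_top)
    ultimately show ?thesis using bound by (auto simp: Lphi_def intro: le_less_trans)
  qed
  show ?thesis unfolding hilbert_bounded_on_Lphi_def
    using main K by (intro exI[of _ ?C]) auto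
qed

lemma conj_bound_of_hilbert_bounded:
  assumes "hilbert_bounded_on_Lphi \<phi>"
  obtains K where "1 \<le> K" "conj_bound \<phi> K"
proof -
  obtain C where C: "0 < C" "\<And>f. f \<in> Lphi \<phi> \<Longrightarrow> Lphi_norm \<phi> (hilbert_transform f) \<le> ennreal C * Lphi_norm \<phi> f"
    using assms unfolding hilbert_bounded_on_Lphi_def by blast
  have "modular \<phi> (1 / (C + 1)) (trig_sum A (conj_coeff a)) \<le> 1"
    if M: "modular \<phi> 1 (trig_sum A a) \<le> 1" for A a
  proof -
    let ?f = "trig_sum A a"
    have n1: "Lphi_norm \<phi> ?f \<le> ennreal 1"
      by (rule Lphi_norm_leI[where g = ?f]) (use M in auto)
    have "?f \<in> L1_circle"
      by (rule L1_circleI[where g = ?f]) (auto simp: integrable_trig_sum periodic_trig_sum)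
    then have "?f \<in> Lphi \<phi>" using n1 by (auto simp: Lphi_def intro: le_less_trans)
    then have "Lphi_norm \<phi> (hilbert_transform ?f) \<le> ennreal C * Lphi_norm \<phi> ?f" by (rule C(2))
    also have "\<dots> \<le> ennreal C * ennreal 1" using n1 by (rule mult_left_mono) simp
    also have "\<dots> < ennreal (C + 1)" using C(1) by (simp add: ennreal_less_iff)
    finally show ?thesis
      using C(1) by (intro modular_le_1I[OF _ hilbert_transform_trig_sum]) auto
  qed
  then have "conj_bound \<phi> (C + 1)" unfolding conj_bound_def by blast
  then show thesis using that[of "C + 1"] C(1) by simp
qed

lemma conj_bound_of_sampling_inequality:
  assumes C: "0 < C"
    and MZ: "\<And>n f. n \<ge> 1 \<Longrightarrow> trig_poly n f \<Longrightarrow> Lphi_norm \<phi> f \<le> ennreal C * Lphi_sample_norm \<phi> n f"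
  shows "conj_bound \<phi> (8 * (C + 1))"
proof -
  have MZ': "modular \<phi> (1 / (C + 1)) f \<le> 1"
    if n: "n \<ge> 1" and f: "trig_poly n f"
      and smp: "sample_mean n (\<lambda>x. \<phi> (norm (f x))) \<le> 1" for n f
  proof -
    have "Lphi_sample_norm \<phi> n f \<le> ennreal 1"
      unfolding Lphi_sample_norm_def by (rule INF_lower) (use smp in simp)
    then have "ennreal C * Lphi_sample_norm \<phi> n f \<le> ennreal C * ennreal 1" by (rule mult_left_mono) simp
    also have "\<dots> < ennreal (C + 1)" using C by (simp add: ennreal_less_iff)
    finally have "Lphi_norm \<phi> f < ennreal (C + 1)" using MZ[OF n f] by (rule le_less_trans[rotated])
    moreover have "f \<in> borel_measurable borel" using f by (auto simp: trig_poly_iff)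
    ultimately show ?thesis using C by (intro modular_le_1I[of f f]) auto
  qed
  have C1: "0 < C + 1" using C by simp
  have "conj_bound \<phi> (2 * (4 * (C + 1)))"
  proof (rule conj_bound_of_riesz)
    show "0 < 4 * (C + 1)" using C by simp
    fix A a assume "finite A" "modular \<phi> 1 (trig_sum A a) \<le> 1"
    then show "modular \<phi> (1 / (4 * (C + 1))) (trig_sum {k \<in> A. 0 \<le> k} a) \<le> 1"
      by (intro riesz_projection_bound[OF C1 MZ']) auto
  qed
  then show ?thesis by simp
qed

lemma sampling_inequality_of_conj_bound:
  assumes K: "1 \<le> K"
    and H: "conj_bound \<phi> K"
    and f: "trig_poly n f"
  shows "Lphi_norm \<phi> f \<le> ennreal (4 * K\<^sup>2) * Lphi_sample_norm \<phi> n f"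
  unfolding Lphi_norm_def Lphi_sample_norm_def
proof (rule INF_le_mult_INF)
  show "0 < 4 * K\<^sup>2" using K by simp
  fix l assume l: "l \<in> {l. 0 < l \<and> 1 / (2 * real n + 1) * (\<Sum>k = - int n..int n. \<phi> (cmod (f (sample_point n k)) / l)) \<le> 1}"
  then have l0: "0 < l" by simp
  show "0 < l" by (rule l0)
  have 1: "trig_poly n (\<lambda>x. of_real (1 / l) * f x)" using f by (rule trig_poly_cmult)
  have 2: "1 / (2 * real n + 1) * (\<Sum>k = - int n..int n. \<phi> (norm (of_real (1 / l) * f (sample_point n k)))) \<le> 1"
    using l by (simp add: norm_mult norm_divide)
  have "modular \<phi> (1 / (4 * K\<^sup>2)) (\<lambda>x. of_real (1 / l) * f x) \<le> 1"
    by (rule sampling_bound_of_conj[OF K H 1 2])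
  then have "modular \<phi> (1 / (4 * K\<^sup>2 * l)) f \<le> 1"
    using l0 by (simp add: modular_def norm_mult norm_divide)
  moreover have "f \<in> borel_measurable borel" using f by (auto simp: trig_poly_iff)
  moreover have "0 < 4 * K\<^sup>2 * l" using l0 K by simp
  ultimately show "4 * K\<^sup>2 * l \<in> {l. 0 < l \<and> ennreal (1 / (2 * pi)) *
      (\<integral>\<^sup>+ x \<in> {-pi..pi}. ennreal (\<phi> (cmod (f x) / l)) \<partial>lebesgue) \<le> 1}"
    using Lphi_constraint_eq_modular[of f f "4 * K\<^sup>2 * l"] by simp
qed

end

theorem theorem3:
  fixes \<phi> :: "real \<Rightarrow> real"
  assumes "N_function \<phi>" and "Delta2 \<phi>"
  shows "(\<exists>C::real. C > 0 \<and>
            (\<forall>n::nat. n \<ge> 1 \<longrightarrow> (\<forall>f. trig_poly n f \<longrightarrow>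
               Lphi_norm \<phi> f \<le> ennreal C * Lphi_sample_norm \<phi> n f)))
         \<longleftrightarrow> hilbert_bounded_on_Lphi \<phi>"
proof -
  obtain p where "young_function \<phi> p" by (rule young_function_of_N_function[OF assms(1)])
  then interpret young_function \<phi> p .
  show ?thesis
  proof
    assume "\<exists>C::real. C > 0 \<and> (\<forall>n::nat. n \<ge> 1 \<longrightarrow> (\<forall>f. trig_poly n f \<longrightarrow>
               Lphi_norm \<phi> f \<le> ennreal C * Lphi_sample_norm \<phi> n f))"
    then obtain C :: real where C: "0 < C"
      "\<And>n f. n \<ge> 1 \<Longrightarrow> trig_poly n f \<Longrightarrow> Lphi_norm \<phi> f \<le> ennreal C * Lphi_sample_norm \<phi> n f" by blast
    have "0 < 8 * (C + 1)" using C(1) by simp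
    then show "hilbert_bounded_on_Lphi \<phi>"
      using conj_bound_of_sampling_inequality[OF C] by (rule hilbert_bounded_of_conj_bound[OF assms(2)])
  next
    assume "hilbert_bounded_on_Lphi \<phi>"
    then obtain K where K: "1 \<le> K" "conj_bound \<phi> K"
      by (rule conj_bound_of_hilbert_bounded)
    have "0 < 4 * K\<^sup>2" using K(1) by simp
    moreover have "Lphi_norm \<phi> f \<le> ennreal (4 * K\<^sup>2) * Lphi_sample_norm \<phi> n f" if "trig_poly n f" for n f
      by (rule sampling_inequality_of_conj_bound[OF K that])
    ultimately show "\<exists>C::real. C > 0 \<and> (\<forall>n::nat. n \<ge> 1 \<longrightarrow> (\<forall>f. trig_poly n f \<longrightarrow>
               Lphi_norm \<phi> f \<le> ennreal C * Lphi_sample_norm \<phi> n f))" by blast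
  qed
qed

end
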